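(* Let $\ell\ge2$, $\ell_1=\lfloor\ell/2\rfloor$, $\ell_2=\lceil\ell/2\rceil$, and $A=\begin{pmatrix}0&0\\ \epsilon&0\end{pmatrix}\in\mathfrak g(\mathfrak o_{\ell_1})$. For any irreducible representations $\rho_1,\rho_2$ of $\mathrm G(\mathfrak o_\ell)$ whose restrictions to $K^{\ell_2}$ contain $\psi_A$, there exists an irreducible representation $\rho$ of $\mathrm G(\mathfrak o_\ell)$ whose restriction to $K^{\ell_2}$ contains $\psi_A$ such that $\langle\rho_1\otimes\rho_2,\rho\rangle\geq(q-2)q^{\lfloor\ell_1/2\rfloor+\ell_1-\ell_2-1}$.
   Context: Let $\mathcal O$ be a complete discrete valuation ring with maximal ideal $\mathfrak p=\pi\mathcal O$ and finite residue field of odd characteristic and cardinality $q$. Let $\mathfrak O=\mathcal O[\vartheta]$ be the unramified quadratic extension, with $\vartheta^2\in\mathcal O^\times$ a non-square, and Galois involution $x\mapsto x^\circ$, $\vartheta^\circ=-\vartheta$. Let $\mathfrak o_k=\mathcal O/\mathfrak p^k$ and $\mathfrak O_k=\mathfrak O/\pi^k\mathfrak O$. $\mathrm G$ denotes either $\mathrm{GL}_2$ (so $\mathrm G(\mathfrak o_k)=\mathrm{GL}_2(\mathfrak o_k)$, $R_k=\mathfrak o_k$, $\epsilon=1$, $\mathfrak g(\mathfrak o_k)=M_2(\mathfrak o_k)$) or $\mathrm{GU}_2$ (so $\mathrm G(\mathfrak o_k)=\{A\in \mathrm{GL}_2(\mathfrak O_k): A^\star A=I\}$ where $(a_{ij})^\star=W(a_{ji}^\circ)W^{-1}$,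 $W=\begin{pmatrix}0&1\\1&0\end{pmatrix}$, $R_k=\mathfrak O_k$, $\epsilon=\vartheta$, $\mathfrak g(\mathfrak o_k)=\{A\in M_2(\mathfrak O_k):A+A^\star=0\}$). $K^{i}=\{I+\pi^iB\}\cap\mathrm G(\mathfrak o_\ell)$. Fix an additive character $\psi$ of $R_\ell$ nontrivial on $\pi^{\ell-1}\mathfrak o_\ell$ (for $\mathrm{GU}_2$ with $\psi(x+\vartheta y)=\psi'(x)\psi'(y)$ for such a character $\psi'$ of $\mathfrak o_\ell$). For $A\in\mathfrak g(\mathfrak o_{\ell_1})$, $\psi_A$ is the character $I+\pi^{\ell_2}B\mapsto\psi(\pi^{\ell_2}\mathrm{tr}(\tilde AB))$ of $K^{\ell_2}$, $\tilde A$ any lift of $A$ to $\mathfrak g(\mathfrak o_\ell)$. *)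

theory Defs
  imports Complex_Main "Jordan_Normal_Form.Matrix"
begin

text \<open>A finite commutative local ring whose maximal ideal is generated by pi,
  with pi^l = 0 and pi^(l-1) nonzero; this is exactly o_l = O/p^l.\<close>
definition chain_ring_of_length :: "'r::comm_ring_1 \<Rightarrow> nat \<Rightarrow> bool" where
  "chain_ring_of_length \<pi> l \<longleftrightarrow>
     finite (UNIV :: 'r set) \<and> \<pi> ^ l = 0 \<and> \<pi> ^ (l - 1) \<noteq> 0 \<and>
     (\<forall>x::'r. \<not> (x dvd 1) \<longrightarrow> \<pi> dvd x)"

definition residue_card :: "'r::comm_ring_1 \<Rightarrow> nat" where
  "residue_card \<pi> = card (range (\<lambda>x::'r. {y. \<pi> dvd (y - x)}))"

definition add_char :: "('a::ab_group_add \<Rightarrow> complex) \<Rightarrow> bool" where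
  "add_char \<psi> \<longleftrightarrow> \<psi> 0 = 1 \<and> (\<forall>x y. \<psi> (x + y) = \<psi> x * \<psi> y)"

definition mat_tr :: "'a::comm_ring_1 mat \<Rightarrow> 'a" where
  "mat_tr A = (\<Sum>i<dim_row A. A $$ (i, i))"

definition GL2 :: "'a::comm_ring_1 mat set" where
  "GL2 = {A \<in> carrier_mat 2 2. invertible_mat A}"

definition Wmat :: "'a::comm_ring_1 mat" where
  "Wmat = mat 2 2 (\<lambda>(i, j). if i \<noteq> j then 1 else 0)"

text \<open>(a_ij)^star = W (a_ji^circ) W^{-1}, with W^{-1} = W.\<close>
definition star_mat :: "('a::comm_ring_1 \<Rightarrow> 'a) \<Rightarrow> 'a mat \<Rightarrow> 'a mat" where
  "star_mat \<sigma> A = Wmat * mat 2 2 (\<lambda>(i, j). \<sigma> (A $$ (j, i))) * Wmat"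

definition GU2 :: "('a::comm_ring_1 \<Rightarrow> 'a) \<Rightarrow> 'a mat set" where
  "GU2 \<sigma> = {A \<in> carrier_mat 2 2. invertible_mat A \<and> star_mat \<sigma> A * A = 1\<^sub>m 2}"

text \<open>The lift of A = ((0,0),(eps,0)).\<close>
definition Amat :: "'a::comm_ring_1 \<Rightarrow> 'a mat" where
  "Amat \<epsilon> = mat 2 2 (\<lambda>(i, j). if i = 1 \<and> j = 0 then \<epsilon> else 0)"

definition is_rep :: "'a::comm_ring_1 mat set \<Rightarrow> nat \<Rightarrow> ('a mat \<Rightarrow> complex mat) \<Rightarrow> bool" where
  "is_rep G n \<rho> \<longleftrightarrow>
     (\<forall>g\<in>G. \<rho> g \<in> carrier_mat n n) \<and>
     (\<forall>g\<in>G. \<forall>h\<in>G. \<rho> (g * h) = \<rho> g * \<rho> h) \<and>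
     \<rho> (1\<^sub>m 2) = 1\<^sub>m n"

definition invariant_subspace ::
  "'a::comm_ring_1 mat set \<Rightarrow> nat \<Rightarrow> ('a mat \<Rightarrow> complex mat) \<Rightarrow> complex vec set \<Rightarrow> bool" where
  "invariant_subspace G n \<rho> W \<longleftrightarrow>
     W \<subseteq> carrier_vec n \<and> 0\<^sub>v n \<in> W \<and>
     (\<forall>v\<in>W. \<forall>w\<in>W. v + w \<in> W) \<and>
     (\<forall>c. \<forall>v\<in>W. c \<cdot>\<^sub>v v \<in> W) \<and>
     (\<forall>g\<in>G. \<forall>v\<in>W. \<rho> g *\<^sub>v v \<in> W)"

definition irrep :: "'a::comm_ring_1 mat set \<Rightarrow> nat \<Rightarrow> ('a mat \<Rightarrow> complex mat) \<Rightarrow> bool" where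
  "irrep G n \<rho> \<longleftrightarrow> is_rep G n \<rho> \<and> n > 0 \<and>
     (\<forall>W. invariant_subspace G n \<rho> W \<longrightarrow> W = {0\<^sub>v n} \<or> W = carrier_vec n)"

definition kron :: "complex mat \<Rightarrow> complex mat \<Rightarrow> complex mat" where
  "kron A B = mat (dim_row A * dim_row B) (dim_col A * dim_col B)
     (\<lambda>(i, j). A $$ (i div dim_row B, j div dim_col B) * B $$ (i mod dim_row B, j mod dim_col B))"

definition tensor_rep :: "('g \<Rightarrow> complex mat) \<Rightarrow> ('g \<Rightarrow> complex mat) \<Rightarrow> 'g \<Rightarrow> complex mat" where
  "tensor_rep \<rho>1 \<rho>2 g = kron (\<rho>1 g) (\<rho>2 g)"

definition rep_inner :: "'a::comm_ring_1 mat set \<Rightarrow> ('a mat \<Rightarrow> complex mat) \<Rightarrow> ('a mat \<Rightarrow> complex mat) \<Rightarrow> complex" where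
  "rep_inner G \<sigma> \<tau> = (\<Sum>g\<in>G. mat_tr (\<sigma> g) * cnj (mat_tr (\<tau> g))) / of_nat (card G)"

text \<open>The restriction of rho to K^{l2} = {I + pi^{l2} B} \<inter> G contains psi_A, where
  psi_A(I + pi^{l2} B) = psi(pi^{l2} tr(A B)).\<close>
definition contains_psiA ::
  "'a::comm_ring_1 mat set \<Rightarrow> 'a \<Rightarrow> nat \<Rightarrow> 'a mat \<Rightarrow> ('a \<Rightarrow> complex) \<Rightarrow> nat \<Rightarrow> ('a mat \<Rightarrow> complex mat) \<Rightarrow> bool" where
  "contains_psiA G \<pi> l2 A \<psi> n \<rho> \<longleftrightarrow>
     (\<exists>v\<in>carrier_vec n. v \<noteq> 0\<^sub>v n \<and>
        (\<forall>B\<in>carrier_mat 2 2. 1\<^sub>m 2 + \<pi> ^ l2 \<cdot>\<^sub>m B \<in> G \<longrightarrow>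
            \<rho> (1\<^sub>m 2 + \<pi> ^ l2 \<cdot>\<^sub>m B) *\<^sub>v v = \<psi> (\<pi> ^ l2 * mat_tr (A * B)) \<cdot>\<^sub>v v))"

definition tensor_bound_claim ::
  "'a::comm_ring_1 mat set \<Rightarrow> 'a \<Rightarrow> nat \<Rightarrow> 'a \<Rightarrow> ('a \<Rightarrow> complex) \<Rightarrow> nat \<Rightarrow> bool" where
  "tensor_bound_claim G \<pi> l \<epsilon> \<psi> q \<longleftrightarrow>
     (let l1 = l div 2; l2 = l - l div 2 in
      \<forall>n1 \<rho>1 n2 \<rho>2.
        irrep G n1 \<rho>1 \<and> contains_psiA G \<pi> l2 (Amat \<epsilon>) \<psi> n1 \<rho>1 \<and>
        irrep G n2 \<rho>2 \<and> contains_psiA G \<pi> l2 (Amat \<epsilon>) \<psi> n2 \<rho>2 \<longrightarrow>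
        (\<exists>n \<rho>. irrep G n \<rho> \<and> contains_psiA G \<pi> l2 (Amat \<epsilon>) \<psi> n \<rho> \<and>
           Re (rep_inner G (tensor_rep \<rho>1 \<rho>2) \<rho>)
             \<ge> (real q - 2) * real q powi (int (l1 div 2) + int l1 - int l2 - 1)))"

definition quad_ext ::
  "'r::comm_ring_1 \<Rightarrow> ('r \<Rightarrow> 'k::comm_ring_1) \<Rightarrow> 'k \<Rightarrow> ('k \<Rightarrow> 'k) \<Rightarrow> bool" where
  "quad_ext d \<iota> \<theta> \<sigma> \<longleftrightarrow>
     (\<forall>x y. \<iota> (x + y) = \<iota> x + \<iota> y) \<and> (\<forall>x y. \<iota> (x * y) = \<iota> x * \<iota> y) \<and> \<iota> 1 = 1 \<and>
     (\<forall>z. \<exists>!p. z = \<iota> (fst p) + \<theta> * \<iota> (snd p)) \<and>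
     \<theta> * \<theta> = \<iota> d \<and> d dvd 1 \<and> \<not> (\<exists>x. x * x = d) \<and>
     (\<forall>x y. \<sigma> (\<iota> x + \<theta> * \<iota> y) = \<iota> x - \<theta> * \<iota> y)"

end

theory Submission
  imports Defs "Jordan_Normal_Form.DL_Rank" "Jordan_Normal_Form.Spectral_Radius"
begin

text \<open>
  Let N be the abelian normal subgroup of all g in G that are scalar modulo \<open>\<pi>\<close>\<open>\<^bsup>l2\<^esup>\<close>. It contains
  the congruence subgroup \<open>K\<^bsup>l2\<^esup>\<close>, so \<open>\<rho>1\<close> and \<open>\<rho>2\<close> contain linear characters \<open>\<mu>\<close>, \<open>\<nu>\<close> of N that extend
  \<open>\<psi>\<^sub>A\<close>, each with multiplicity at least \<open>q\<^bsup>l2 - l1\<^esup>\<close> (for odd l by a Heisenberg argument). Explicit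
  conjugates of \<open>\<mu>\<close> and \<open>\<nu>\<close>, coming from \<open>X + Y = A\<close> with X and Y conjugate to A, all multiply to one
  character \<open>\<kappa>\<close> of N extending \<open>\<psi>\<^sub>A\<close>; counting the pairs (X, Y) bounds from below the multiplicity D
  of \<open>\<kappa>\<close> in the tensor product. If the irreducible \<open>\<rho>\<close> contains \<open>\<kappa>\<close> exactly \<open>e\<^sub>\<rho>\<close> times and has multiplicity
  \<open>m\<^sub>\<rho>\<close> in the tensor product, then D is the sum of the \<open>m\<^sub>\<rho> e\<^sub>\<rho>\<close>, while Bessel's inequality for the
  sum of the conjugates of \<open>\<kappa>\<close> bounds the sum of the \<open>e\<^sub>\<rho>\<^sup>2\<close> by the index s of N in the stabilizer
  of \<open>\<kappa>\<close>. Hence some \<open>m\<^sub>\<rho>\<close> is at least D / s. Only traces are used: composition factors suffice, so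
  complete reducibility is not needed.
\<close>

section \<open>Representations of finite matrix groups\<close>

text \<open>Conjugates can be multiplied on all of N although only the values of
  \<open>\<mu>\<close> and \<open>\<nu>\<close> on K are known: a conjugate of n in N is k n with k
  in K, so conjugation multiplies every extension of \<open>psi_A\<close> by the same explicit value
  of \<open>\<psi>\<close>. This is why all decompositions X + Y = A lead to one
  \<open>\<kappa>\<close>. N contains the scalars of G, which stabilize every character, and so the
  index s is independent of the size of the centre. The constants: X is a multiple of A conjugated
  by a unipotent with parameter \<open>\<epsilon> * \<beta>\<close>. The multiplier c and 1 - c must
  both be units, giving (q - 2) q^(l1 - 1) classes; the square of \<open>\<beta>\<close> must vanish
  modulo the l1-th power of \<open>\<pi>\<close>, giving q^(l1 div 2) classes. The index is s =
  q^(l2 + 2 (l2 - l1)), counted by the ratios of the entries of a stabilizing matrix. For odd l the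
  stabilizer grows by q^2, which is exactly compensated by the multiplicity q in each of the two
  factors. The quotient of these numbers is the bound.\<close>

lemma mat_tr_eq: "A \<in> carrier_mat n n \<Longrightarrow> mat_tr A = (\<Sum>i<n. A $$ (i, i))"
  by (auto simp: mat_tr_def)

lemma mult_mat_index:
  assumes "A \<in> carrier_mat n m" "B \<in> carrier_mat m k" "i < n" "j < k"
  shows "(A * B) $$ (i, j) = (\<Sum>a<m. A $$ (i, a) * B $$ (a, j))"
  using assms by (auto simp: scalar_prod_def atLeast0LessThan intro!: sum.cong)

lemma mat_tr_comm:
  assumes "A \<in> carrier_mat n m" "B \<in> carrier_mat m n"
  shows "mat_tr (A * B) = mat_tr (B * A)"
proof -
  have "mat_tr (A * B) = (\<Sum>i<n. \<Sum>a<m. A $$ (i, a) * B $$ (a, i))"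
    using assms by (subst mat_tr_eq[of _ n]) (auto simp: mult_mat_index simp del: index_mult_mat)
  also have "\<dots> = (\<Sum>a<m. \<Sum>i<n. B $$ (a, i) * A $$ (i, a))"
    by (subst sum.swap) (simp add: mult.commute)
  also have "\<dots> = mat_tr (B * A)"
    using assms by (subst mat_tr_eq[of _ m]) (auto simp: mult_mat_index simp del: index_mult_mat)
  finally show ?thesis .
qed

text \<open>A maximal independent subset of \<open>W\<close> is extended to a basis, whose members
  are the columns of \<open>P\<close>, those in \<open>W\<close> first. \<open>Q\<close> computes
  coordinates. In this basis operators that preserve \<open>W\<close> become block
  triangular.\<close>

lemma subspace_adapted_basis:
  fixes W :: "complex vec set"
  assumes W: "W \<subseteq> carrier_vec n" and W0: "0\<^sub>v n \<in> W"
    and add: "\<And>v w. v \<in> W \<Longrightarrow> w \<in> W \<Longrightarrow> v + w \<in> W"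
    and smult: "\<And>c v. v \<in> W \<Longrightarrow> c \<cdot>\<^sub>v v \<in> W"
  obtains P Q k where "P \<in> carrier_mat n n" "Q \<in> carrier_mat n n" "P * Q = 1\<^sub>m n" "Q * P = 1\<^sub>m n"
    "k \<le> n" "\<And>j. j < k \<Longrightarrow> col P j \<in> W"
    "\<And>w i. w \<in> W \<Longrightarrow> k \<le> i \<Longrightarrow> i < n \<Longrightarrow> (Q *\<^sub>v w) $ i = 0"
    "k = n \<Longrightarrow> W = carrier_vec n"
proof -
  interpret vec_space "TYPE(complex)" n .
  have dim_le: "finite A \<and> card A \<le> n" if "A \<subseteq> carrier_vec n" "lin_indpt A" for A
    using li_le_dim[OF _ that] fin_dim_li_fin[OF _ that(2)] that dim_is_n by (simp add: fin_dim)
  have "lin_indpt {}" by (simp add: lin_dep_def)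
  hence "\<exists>A. finite A \<and> maximal A (\<lambda>S. S \<subseteq> W \<and> lin_indpt S)"
    using W by (intro maximal_exists[of _ n "{}"]) (auto intro!: dim_le[THEN conjunct1] dim_le[THEN conjunct2])
  then obtain A where A: "finite A" "maximal A (\<lambda>S. S \<subseteq> W \<and> lin_indpt S)" by blast
  hence AW: "A \<subseteq> W" "lin_indpt A" by (auto simp: maximal_def)
  have WA: "w \<in> span A" if w: "w \<in> W" for w
  proof (rule ccontr)
    assume n: "w \<notin> span A"
    have "w \<notin> A" using n in_own_span[of A] AW W by auto
    moreover have "lin_indpt (A \<union> {w})"
      using lin_dep_iff_in_span[of A w] n AW W w \<open>w \<notin> A\<close> by auto
    ultimately show False using A(2) w AW by (auto simp: maximal_def)
  qed
  have "\<exists>B. finite B \<and> maximal B (\<lambda>S. A \<subseteq> S \<and> S \<subseteq> carrier_vec n \<and> lin_indpt S)"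
    using W AW by (intro maximal_exists[of _ n A]) (auto intro!: dim_le[THEN conjunct1] dim_le[THEN conjunct2])
  then obtain B where B: "finite B" "maximal B (\<lambda>S. A \<subseteq> S \<and> S \<subseteq> carrier_vec n \<and> lin_indpt S)"
    by blast
  hence BC: "A \<subseteq> B" "B \<subseteq> carrier_vec n" "lin_indpt B" by (auto simp: maximal_def)
  have "maximal B (\<lambda>S. S \<subseteq> carrier_vec n \<and> lin_indpt S)"
    using B BC by (auto simp: maximal_def)
  hence "basis B" using max_li_is_basis by simp
  hence cardB: "card B = n" using dim_basis[OF B(1)] dim_is_n by simp
  obtain as where as: "set as = A" "distinct as" using A(1) finite_distinct_list by auto
  obtain bs where bs: "set bs = B - A" "distinct bs" using B(1) finite_distinct_list by blast
  define k where "k = length as"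
  let ?l = "as @ bs"
  have l: "set ?l = B" "distinct ?l" using as bs BC by auto
  have len: "length ?l = n" using l cardB distinct_card by metis
  define P where "P = mat_of_cols n ?l"
  have P: "P \<in> carrier_mat n n" unfolding P_def using len by (metis mat_of_cols_carrier(1))
  have cP: "cols P = ?l" unfolding P_def using l BC by (intro cols_mat_of_cols) auto
  have "rank P = n" using lin_indpt_full_rank[OF P] cP l BC by auto
  hence "det P \<noteq> 0" using det_rank_iff[OF P] by auto
  then obtain Q where Q: "Q \<in> carrier_mat n n" "P * Q = 1\<^sub>m n" "Q * P = 1\<^sub>m n"
    using det_non_zero_imp_unit[OF P] unfolding Units_def ring_mat_def by auto
  have colP: "col P j = ?l ! j" if "j < n" for j
    using cP P that by (metis cols_nth carrier_matD(2))
  have kn: "k \<le> n" using len by (auto simp: k_def)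
  \<comment> \<open>The vectors without coordinates from \<open>k\<close> on form a subspace. It
    contains the chosen basis of \<open>W\<close>, hence the whole span.\<close>
  define U where "U = {w \<in> carrier_vec n. \<forall>i. k \<le> i \<longrightarrow> i < n \<longrightarrow> (Q *\<^sub>v w) $ i = 0}"
  have AU: "A \<subseteq> U"
  proof
    fix a assume a: "a \<in> A"
    then obtain j where j: "j < k" "as ! j = a" using as by (auto simp: in_set_conv_nth k_def)
    hence "a = col P j" using colP[of j] kn by (auto simp: nth_append k_def)
    hence "Q *\<^sub>v a = unit_vec n j"
      using Q P j kn col_mult2[OF Q(1) P, of j] by simp
    thus "a \<in> U" using a AW W j by (auto simp: U_def)
  qed
  have "submodule class_ring U V"
    unfolding U_def using Q
    by (intro LinearCombinations.submodule.intro module_axioms)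
       (auto simp: scalar_prod_add_distrib[of _ n])
  hence "span A \<subseteq> U" using AU span_is_subset by blast
  hence "(Q *\<^sub>v w) $ i = 0" if "w \<in> W" "k \<le> i" "i < n" for w i
    using WA[OF that(1)] that by (auto simp: U_def)
  moreover have "col P j \<in> W" if "j < k" for j
    using colP[of j] that kn as AW by (auto simp: nth_append k_def)
  moreover have "W = carrier_vec n" if "k = n"
  proof -
    have "bs = []" using len that by (simp add: k_def)
    hence "A = B" using bs BC by auto
    hence "span A = carrier_vec n" using \<open>basis B\<close> by (simp add: basis_def)
    moreover have "submodule class_ring W V" using W W0 add smult
      by (intro LinearCombinations.submodule.intro module_axioms) auto
    hence "span A \<subseteq> W" using AW span_is_subset by blast
    ultimately show ?thesis using W by auto
  qed
  ultimately show ?thesis using that[OF P Q kn] by blast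
qed

section \<open>Finite matrix groups, subrepresentations and composition factors\<close>

definition minv :: "'a::comm_ring_1 mat \<Rightarrow> 'a mat" where
  "minv g = (SOME h. h \<in> carrier_mat 2 2 \<and> g * h = 1\<^sub>m 2 \<and> h * g = 1\<^sub>m 2)"

lemma minv_unique:
  assumes "g \<in> carrier_mat 2 2" "h \<in> carrier_mat 2 2" "g * h = 1\<^sub>m 2" "h * g = 1\<^sub>m 2"
  shows "minv g = h"
proof -
  have *: "minv g \<in> carrier_mat 2 2 \<and> g * minv g = 1\<^sub>m 2 \<and> minv g * g = 1\<^sub>m 2"
    unfolding minv_def by (rule someI[of _ h]) (use assms in auto)
  have "minv g = minv g * (g * h)" using * assms by (auto simp: right_mult_one_mat[of _ 2 2])
  also have "\<dots> = h" using * assms by (subst assoc_mult_mat[symmetric, of _ 2 2 _ 2 _ 2]) auto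
  finally show ?thesis .
qed

locale mat_group =
  fixes G :: "'a::comm_ring_1 mat set"
  assumes finG: "finite G"
    and carrG: "G \<subseteq> carrier_mat 2 2"
    and oneG: "1\<^sub>m 2 \<in> G"
    and multG: "g \<in> G \<Longrightarrow> h \<in> G \<Longrightarrow> g * h \<in> G"
    and invG: "g \<in> G \<Longrightarrow> \<exists>h\<in>G. g * h = 1\<^sub>m 2 \<and> h * g = 1\<^sub>m 2"
begin

lemma carr: "g \<in> G \<Longrightarrow> g \<in> carrier_mat 2 2" using carrG by auto

lemma minv_props:
  assumes "g \<in> G"
  shows "minv g \<in> G" "g * minv g = 1\<^sub>m 2" "minv g * g = 1\<^sub>m 2"
proof -
  obtain h where h: "h \<in> G" "g * h = 1\<^sub>m 2" "h * g = 1\<^sub>m 2" using invG assms by blast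
  hence "minv g = h" using minv_unique carr assms by blast
  thus "minv g \<in> G" "g * minv g = 1\<^sub>m 2" "minv g * g = 1\<^sub>m 2" using h by auto
qed

lemma assoc: "g \<in> G \<Longrightarrow> h \<in> G \<Longrightarrow> k \<in> G \<Longrightarrow> g * h * k = g * (h * k)"
  using carr by (intro assoc_mult_mat[of _ 2 2 _ 2 _ 2]) auto

lemma l_one: "g \<in> G \<Longrightarrow> 1\<^sub>m 2 * g = g" by (auto dest: carr)

lemma r_one: "g \<in> G \<Longrightarrow> g * 1\<^sub>m 2 = g" by (auto dest: carr)

lemma minv_cancel_left: "g \<in> G \<Longrightarrow> h \<in> G \<Longrightarrow> minv g * (g * h) = h"
  by (simp add: assoc[symmetric] minv_props l_one)

lemma minv_cancel_right: "g \<in> G \<Longrightarrow> h \<in> G \<Longrightarrow> g * (minv g * h) = h"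
  by (simp add: assoc[symmetric] minv_props l_one)

lemma minv_minv: "g \<in> G \<Longrightarrow> minv (minv g) = g"
  using minv_unique[of "minv g" g] minv_props carr by auto

lemma minv_mult: "g \<in> G \<Longrightarrow> h \<in> G \<Longrightarrow> minv (g * h) = minv h * minv g"
  by (intro minv_unique) (auto simp: assoc minv_props minv_cancel_left minv_cancel_right multG carr)

lemma card_pos: "card G > 0" using finG oneG by (auto simp: card_gt_0_iff)

lemma sum_lmult: "h \<in> G \<Longrightarrow> (\<Sum>g\<in>G. f (h * g)) = (\<Sum>g\<in>G. f g)"
  by (rule sum.reindex_bij_witness[of _ "\<lambda>g. minv h * g" "\<lambda>g. h * g"])
     (auto simp: minv_cancel_left minv_cancel_right multG minv_props)

lemma is_rep_subset: "is_rep G n \<rho> \<Longrightarrow> N \<subseteq> G \<Longrightarrow> is_rep N n \<rho>"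
  unfolding is_rep_def by blast

lemma is_repD:
  assumes "is_rep G n \<rho>"
  shows "g \<in> G \<Longrightarrow> \<rho> g \<in> carrier_mat n n" "g \<in> G \<Longrightarrow> h \<in> G \<Longrightarrow> \<rho> (g * h) = \<rho> g * \<rho> h"
    "\<rho> (1\<^sub>m 2) = 1\<^sub>m n"
  using assms by (auto simp: is_rep_def)

lemma rep_minv:
  assumes "is_rep G n \<rho>" "g \<in> G"
  shows "\<rho> g * \<rho> (minv g) = 1\<^sub>m n" "\<rho> (minv g) * \<rho> g = 1\<^sub>m n"
  using is_repD[OF assms(1)] minv_props assms(2) by metis+

text \<open>In an adapted basis the block below \<open>W\<close> vanishes, so both diagonal blocks
  are multiplicative: \<open>\<sigma>1\<close> is the action on \<open>W\<close>,
  \<open>\<sigma>2\<close> the action on the quotient. The last clause is the trace of a scalar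
  block; it measures what an eigenline contributes.\<close>

lemma rep_split:
  assumes rep: "is_rep G n \<rho>" and inv: "invariant_subspace G n \<rho> W"
  shows "\<exists>k \<sigma>1 \<sigma>2. k \<le> n \<and> is_rep G k \<sigma>1 \<and> is_rep G (n - k) \<sigma>2 \<and>
    (\<forall>g\<in>G. mat_tr (\<rho> g) = mat_tr (\<sigma>1 g) + mat_tr (\<sigma>2 g)) \<and>
    (W \<noteq> {0\<^sub>v n} \<longrightarrow> k > 0) \<and> (W \<noteq> carrier_vec n \<longrightarrow> k < n) \<and>
    (\<forall>g\<in>G. \<forall>c. (\<forall>w\<in>W. \<rho> g *\<^sub>v w = c \<cdot>\<^sub>v w) \<longrightarrow> mat_tr (\<sigma>1 g) = of_nat k * c)"
proof -
  note iv = inv[unfolded invariant_subspace_def]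
  obtain P Q k where P: "P \<in> carrier_mat n n" and Q: "Q \<in> carrier_mat n n"
    and PQ: "P * Q = 1\<^sub>m n" "Q * P = 1\<^sub>m n" and kn: "k \<le> n"
    and colP: "\<And>j. j < k \<Longrightarrow> col P j \<in> W"
    and QW: "\<And>w i. w \<in> W \<Longrightarrow> k \<le> i \<Longrightarrow> i < n \<Longrightarrow> (Q *\<^sub>v w) $ i = 0"
    and kW: "k = n \<Longrightarrow> W = carrier_vec n"
    using subspace_adapted_basis[of W n] iv by metis
  define R where "R g = Q * (\<rho> g * P)" for g
  note rc = is_repD(1)[OF rep]
  have R: "R g \<in> carrier_mat n n" if "g \<in> G" for g using rc[OF that] P Q by (simp add: R_def)
  have Rj: "R g $$ (i, j) = (Q *\<^sub>v (\<rho> g *\<^sub>v col P j)) $ i" if "g \<in> G" "i < n" "j < n" for g i j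
  proof -
    have "R g $$ (i, j) = col (R g) j $ i" using R[OF that(1)] that by simp
    also have "col (R g) j = Q *\<^sub>v col (\<rho> g * P) j"
      unfolding R_def by (rule col_mult2) (use rc[OF that(1)] P Q that in auto)
    also have "col (\<rho> g * P) j = \<rho> g *\<^sub>v col P j"
      by (rule col_mult2) (use rc[OF that(1)] P Q that in auto)
    finally show ?thesis .
  qed
  \<comment> \<open>Invariance of \<open>W\<close> enters here: the image of a column in
    \<open>W\<close> stays in \<open>W\<close>, where the coordinates from \<open>k\<close> on are
    0.\<close>
  have R0: "R g $$ (i, j) = 0" if "g \<in> G" "k \<le> i" "i < n" "j < k" for g i j
    using Rj[of g i j] QW[of "\<rho> g *\<^sub>v col P j" i] colP[of j] iv that kn by auto
  have Rm: "R (g * h) = R g * R h" if gh: "g \<in> G" "h \<in> G" for g h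
  proof -
    have "R g * R h = Q * (\<rho> g * P * (Q * (\<rho> h * P)))"
      unfolding R_def using P Q rc[OF gh(1)] rc[OF gh(2)] by (intro assoc_mult_mat) auto
    also have "\<rho> g * P * (Q * (\<rho> h * P)) = \<rho> g * (P * (Q * (\<rho> h * P)))"
      using P Q rc[OF gh(1)] rc[OF gh(2)] by (intro assoc_mult_mat) auto
    also have "P * (Q * (\<rho> h * P)) = P * Q * (\<rho> h * P)"
      using P Q rc[OF gh(1)] rc[OF gh(2)] by (intro assoc_mult_mat[symmetric]) auto
    also have "\<dots> = \<rho> h * P" using PQ P rc[OF gh(2)] by simp
    also have "\<rho> g * (\<rho> h * P) = \<rho> g * \<rho> h * P"
      using P rc[OF gh(1)] rc[OF gh(2)] by (intro assoc_mult_mat[symmetric]) auto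
    finally show ?thesis using is_repD(2)[OF rep gh] by (simp add: R_def)
  qed
  have R1: "R (1\<^sub>m 2) = 1\<^sub>m n" using is_repD(3)[OF rep] PQ P Q by (simp add: R_def)
  have Rmij: "R (g * h) $$ (i, j) = (\<Sum>a<k. R g $$ (i, a) * R h $$ (a, j)) +
      (\<Sum>a<n - k. R g $$ (i, a + k) * R h $$ (a + k, j))"
    if "g \<in> G" "h \<in> G" "i < n" "j < n" for g h i j
  proof -
    have "R (g * h) $$ (i, j) = (\<Sum>a<n. R g $$ (i, a) * R h $$ (a, j))"
      using Rm[OF that(1,2)] mult_mat_index[OF R[OF that(1)] R[OF that(2)]] that by simp
    also have "\<dots> = (\<Sum>a<k. R g $$ (i, a) * R h $$ (a, j)) + (\<Sum>a=k..<n. R g $$ (i, a) * R h $$ (a, j))"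
      using kn by (metis (no_types) atLeast0LessThan le0 sum.atLeastLessThan_concat)
    also have "(\<Sum>a=k..<n. R g $$ (i, a) * R h $$ (a, j)) =
        (\<Sum>a<n - k. R g $$ (i, a + k) * R h $$ (a + k, j))"
      using kn by (intro sum.reindex_bij_witness[of _ "\<lambda>a. a + k" "\<lambda>a. a - k"]) auto
    finally show ?thesis .
  qed
  define S1 where "S1 g = mat k k (\<lambda>(i, j). R g $$ (i, j))" for g
  define S2 where "S2 g = mat (n - k) (n - k) (\<lambda>(i, j). R g $$ (i + k, j + k))" for g
  have S1c: "S1 g \<in> carrier_mat k k" and S2c: "S2 g \<in> carrier_mat (n - k) (n - k)" for g
    by (auto simp: S1_def S2_def)
  have "S1 (g * h) = S1 g * S1 h" if gh: "g \<in> G" "h \<in> G" for g h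
  proof (rule eq_matI)
    fix i j assume "i < dim_row (S1 g * S1 h)" "j < dim_col (S1 g * S1 h)"
    hence ij: "i < k" "j < k" by (auto simp: S1_def)
    have "S1 (g * h) $$ (i, j) = R (g * h) $$ (i, j)" using ij by (simp add: S1_def)
    also have "\<dots> = (\<Sum>a<k. R g $$ (i, a) * R h $$ (a, j))"
      using Rmij[OF gh, of i j] R0[OF gh(2)] ij kn by simp
    also have "\<dots> = (S1 g * S1 h) $$ (i, j)"
      using ij by (subst mult_mat_index[OF S1c S1c]) (auto simp: S1_def)
    finally show "S1 (g * h) $$ (i, j) = (S1 g * S1 h) $$ (i, j)" .
  qed (auto simp: S1_def)
  moreover have "S1 (1\<^sub>m 2) = 1\<^sub>m k" using R1 kn by (auto simp: S1_def)
  ultimately have rep1: "is_rep G k S1" using S1c by (auto simp: is_rep_def)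
  have "S2 (g * h) = S2 g * S2 h" if gh: "g \<in> G" "h \<in> G" for g h
  proof (rule eq_matI)
    fix i j assume "i < dim_row (S2 g * S2 h)" "j < dim_col (S2 g * S2 h)"
    hence ij: "i < n - k" "j < n - k" by (auto simp: S2_def)
    have "S2 (g * h) $$ (i, j) = R (g * h) $$ (i + k, j + k)" using ij by (simp add: S2_def)
    also have "\<dots> = (\<Sum>a<n - k. R g $$ (i + k, a + k) * R h $$ (a + k, j + k))"
      using Rmij[OF gh, of "i + k" "j + k"] R0[OF gh(1)] ij kn by simp
    also have "\<dots> = (S2 g * S2 h) $$ (i, j)"
      using ij by (subst mult_mat_index[OF S2c S2c]) (auto simp: S2_def)
    finally show "S2 (g * h) $$ (i, j) = (S2 g * S2 h) $$ (i, j)" .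
  qed (auto simp: S2_def)
  moreover have "S2 (1\<^sub>m 2) = 1\<^sub>m (n - k)" using R1 kn by (auto simp: S2_def)
  ultimately have rep2: "is_rep G (n - k) S2" using S2c by (auto simp: is_rep_def)
  have tr: "mat_tr (\<rho> g) = mat_tr (S1 g) + mat_tr (S2 g)" if g: "g \<in> G" for g
  proof -
    have "mat_tr (R g) = mat_tr (\<rho> g * P * Q)"
      unfolding R_def using rc[OF g] P Q by (intro mat_tr_comm) auto
    also have "\<rho> g * P * Q = \<rho> g" using rc[OF g] P Q PQ by (simp add: assoc_mult_mat[of _ n n _ n _ n])
    finally have "mat_tr (\<rho> g) = (\<Sum>i<n. R g $$ (i, i))" using R[OF g] by (simp add: mat_tr_def)
    also have "\<dots> = (\<Sum>i<k. R g $$ (i, i)) + (\<Sum>i=k..<n. R g $$ (i, i))"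
      using kn by (metis (no_types) atLeast0LessThan le0 sum.atLeastLessThan_concat)
    also have "(\<Sum>i=k..<n. R g $$ (i, i)) = (\<Sum>i<n - k. R g $$ (i + k, i + k))"
      using kn by (intro sum.reindex_bij_witness[of _ "\<lambda>a. a + k" "\<lambda>a. a - k"]) auto
    finally show ?thesis by (simp add: mat_tr_def S1_def S2_def)
  qed
  have k0: "k > 0" if "W \<noteq> {0\<^sub>v n}"
  proof (rule ccontr)
    assume "\<not> k > 0"
    have "w = 0\<^sub>v n" if w: "w \<in> W" for w
    proof -
      have wc: "w \<in> carrier_vec n" using w iv by auto
      have "Q *\<^sub>v w = 0\<^sub>v n" using QW[OF w] \<open>\<not> k > 0\<close> Q by (intro eq_vecI) auto
      hence "(P * Q) *\<^sub>v w = P *\<^sub>v 0\<^sub>v n" using P Q wc by (simp add: assoc_mult_mat_vec[of _ n n _ n])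
      thus ?thesis using PQ wc P by auto
    qed
    thus False using that iv by blast
  qed
  have scal: "mat_tr (S1 g) = of_nat k * c" if g: "g \<in> G" and c: "\<forall>w\<in>W. \<rho> g *\<^sub>v w = c \<cdot>\<^sub>v w" for g c
  proof -
    have "R g $$ (i, i) = c" if i: "i < k" for i
    proof -
      have "R g $$ (i, i) = (Q *\<^sub>v (c \<cdot>\<^sub>v col P i)) $ i"
        using Rj[OF g, of i i] c colP[OF i] i kn by simp
      also have "\<dots> = c * (Q *\<^sub>v col P i) $ i"
        using mult_mat_vec[OF Q, of "col P i" c] P Q i kn by simp
      also have "Q *\<^sub>v col P i = col (Q * P) i" using col_mult2[OF Q P, of i] i kn by simp
      finally show ?thesis using PQ i kn by simp
    qed
    thus ?thesis by (simp add: mat_tr_def S1_def)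
  qed
  show ?thesis using kn rep1 rep2 tr k0 kW scal by (intro exI[of _ k] exI[of _ S1] exI[of _ S2]) auto
qed

lemma trace_sum_irreps:
  "is_rep G n \<rho> \<Longrightarrow> \<exists>L. (\<forall>(m, \<tau>) \<in> set L. irrep G m \<tau>) \<and>
     (\<forall>g\<in>G. mat_tr (\<rho> g) = (\<Sum>(m, \<tau>)\<leftarrow>L. mat_tr (\<tau> g)))"
proof (induction n arbitrary: \<rho> rule: less_induct)
  case (less n)
  consider "n = 0" | "irrep G n \<rho>" |
    W where "invariant_subspace G n \<rho> W" "W \<noteq> {0\<^sub>v n}" "W \<noteq> carrier_vec n"
    using less.prems by (auto simp: irrep_def)
  thus ?case
  proof cases
    case 1
    hence "mat_tr (\<rho> g) = 0" if "g \<in> G" for g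
      using is_repD(1)[OF less.prems that] by (simp add: mat_tr_eq[of _ 0])
    thus ?thesis by (intro exI[of _ "[]"]) auto
  next
    case 2
    thus ?thesis by (intro exI[of _ "[(n, \<rho>)]"]) auto
  next
    case 3
    obtain k s1 s2 where k: "0 < k" "k < n" and s: "is_rep G k s1" "is_rep G (n - k) s2"
      and tr: "\<forall>g\<in>G. mat_tr (\<rho> g) = mat_tr (s1 g) + mat_tr (s2 g)"
      using rep_split[OF less.prems 3(1)] 3 by blast
    obtain L1 where L1: "\<forall>(m, \<tau>) \<in> set L1. irrep G m \<tau>"
        "\<forall>g\<in>G. mat_tr (s1 g) = (\<Sum>(m, \<tau>)\<leftarrow>L1. mat_tr (\<tau> g))"
      using less.IH[OF _ s(1)] k by blast
    obtain L2 where L2: "\<forall>(m, \<tau>) \<in> set L2. irrep G m \<tau>"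
        "\<forall>g\<in>G. mat_tr (s2 g) = (\<Sum>(m, \<tau>)\<leftarrow>L2. mat_tr (\<tau> g))"
      using less.IH[OF _ s(2)] k by (metis diff_less zero_less_iff_neq_zero not_less_zero)
    show ?thesis using L1 L2 tr by (intro exI[of _ "L1 @ L2"]) auto
  qed
qed

end

section \<open>Matrix identities and tensor products\<close>

lemma mult_unit_vec:
  fixes T :: "complex mat"
  assumes "T \<in> carrier_mat n m" "j < m"
  shows "T *\<^sub>v unit_vec m j = col T j"
  using col_mult2[OF assms(1) one_carrier_mat assms(2)] assms by simp

lemma mat_eq_by_vec:
  fixes S T :: "complex mat"
  assumes S: "S \<in> carrier_mat n m" and T: "T \<in> carrier_mat n m"
    and eq: "\<And>v. v \<in> carrier_vec m \<Longrightarrow> S *\<^sub>v v = T *\<^sub>v v"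
  shows "S = T"
proof (rule mat_col_eqI)
  fix j assume "j < dim_col T"
  hence j: "j < m" using T by auto
  show "col S j = col T j" using mult_unit_vec[OF S j] mult_unit_vec[OF T j] eq[of "unit_vec m j"] by simp
qed (use S T in auto)

lemma smult_one_mult_vec:
  fixes v :: "complex vec"
  assumes "v \<in> carrier_vec n"
  shows "(c \<cdot>\<^sub>m 1\<^sub>m n) *\<^sub>v v = c \<cdot>\<^sub>v v"
  using assms by (intro eq_vecI) (auto simp: row_smult smult_scalar_prod_distrib[of _ n])

lemma kron_carrier:
  assumes "A \<in> carrier_mat n n" "B \<in> carrier_mat m m"
  shows "kron A B \<in> carrier_mat (n * m) (n * m)"
  using assms by (auto simp: kron_def)

lemma sum_div_mod:
  fixes f :: "nat \<Rightarrow> nat \<Rightarrow> 'b::comm_monoid_add"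
  shows "(\<Sum>i<n * m. f (i div m) (i mod m)) = (\<Sum>a<n. \<Sum>b<m. f a b)"
proof (cases "m = 0")
  case False
  have "(\<Sum>a<n. \<Sum>b<m. f a b) = (\<Sum>(a, b)\<in>{..<n} \<times> {..<m}. f a b)"
    by (simp add: sum.cartesian_product)
  also have "\<dots> = (\<Sum>i<n * m. f (i div m) (i mod m))"
  proof (rule sum.reindex_bij_witness[of _ "\<lambda>i. (i div m, i mod m)" "\<lambda>(a, b). a * m + b"])
    fix x assume x: "x \<in> {..<n} \<times> {..<m}"
    then obtain a b where ab: "x = (a, b)" "a < n" "b < m" by auto
    have "a * m + b < Suc a * m" using ab by simp
    also have "\<dots> \<le> n * m" using ab by (intro mult_right_mono) auto
    finally show "(case x of (a, b) \<Rightarrow> a * m + b) \<in> {..<n * m}" using ab by simp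
  qed (use False in \<open>auto simp: less_mult_imp_div_less mult.commute\<close>)
  finally show ?thesis by simp
qed auto

lemma mat_tr_kron:
  assumes "A \<in> carrier_mat n n" "B \<in> carrier_mat m m"
  shows "mat_tr (kron A B) = mat_tr A * mat_tr B"
proof -
  have "mat_tr (kron A B) = (\<Sum>i<n * m. A $$ (i div m, i div m) * B $$ (i mod m, i mod m))"
    using assms by (subst mat_tr_eq[OF kron_carrier[OF assms]]) (auto simp: kron_def)
  also have "\<dots> = (\<Sum>a<n. \<Sum>b<m. A $$ (a, a) * B $$ (b, b))"
    by (rule sum_div_mod)
  finally show ?thesis using assms by (simp add: mat_tr_eq sum_product)
qed

lemma kron_mult:
  assumes A: "A \<in> carrier_mat n n" "C \<in> carrier_mat n n" and B: "B \<in> carrier_mat m m" "D \<in> carrier_mat m m"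
  shows "kron (A * C) (B * D) = kron A B * kron C D"
proof (rule eq_matI)
  note c = kron_carrier[OF A(1) B(1)] kron_carrier[OF A(2) B(2)]
  fix i j assume "i < dim_row (kron A B * kron C D)" "j < dim_col (kron A B * kron C D)"
  hence ij: "i < n * m" "j < n * m" using c by auto
  hence m: "m > 0" by (cases m) auto
  have d: "i div m < n" "j div m < n" "i mod m < m" "j mod m < m"
    using ij m by (auto simp: less_mult_imp_div_less)
  have "(kron A B * kron C D) $$ (i, j) = (\<Sum>k<n * m. kron A B $$ (i, k) * kron C D $$ (k, j))"
    by (rule mult_mat_index[OF c ij])
  also have "\<dots> = (\<Sum>k<n * m. A $$ (i div m, k div m) * B $$ (i mod m, k mod m) *
      (C $$ (k div m, j div m) * D $$ (k mod m, j mod m)))"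
    using A B ij by (intro sum.cong) (auto simp: kron_def)
  also have "\<dots> = (\<Sum>a<n. \<Sum>b<m. A $$ (i div m, a) * B $$ (i mod m, b) *
      (C $$ (a, j div m) * D $$ (b, j mod m)))"
    by (rule sum_div_mod)
  also have "\<dots> = (A * C) $$ (i div m, j div m) * (B * D) $$ (i mod m, j mod m)"
    by (simp add: mult_mat_index[OF A d(1,2)] mult_mat_index[OF B d(3,4)] sum_product mult_ac
        del: index_mult_mat)
  also have "\<dots> = kron (A * C) (B * D) $$ (i, j)" using A B ij by (simp add: kron_def)
  finally show "kron (A * C) (B * D) $$ (i, j) = (kron A B * kron C D) $$ (i, j)" by simp
qed (use A B in \<open>auto simp: kron_def\<close>)

lemma kron_one: "kron (1\<^sub>m n) (1\<^sub>m m) = 1\<^sub>m (n * m)"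
proof (rule eq_matI)
  fix i j assume "i < dim_row (1\<^sub>m (n * m) :: complex mat)" "j < dim_col (1\<^sub>m (n * m) :: complex mat)"
  hence ij: "i < n * m" "j < n * m" by auto
  hence m: "m > 0" by (cases m) auto
  have "i div m < n" "j div m < n" "i mod m < m" "j mod m < m"
    using ij m by (auto simp: less_mult_imp_div_less)
  moreover have "i = j" if "i div m = j div m" "i mod m = j mod m"
    using that by (metis div_mult_mod_eq)
  ultimately show "kron (1\<^sub>m n) (1\<^sub>m m) $$ (i, j) = 1\<^sub>m (n * m) $$ (i, j)"
    using ij by (auto simp: kron_def)
qed (auto simp: kron_def)

lemma tensor_rep_is_rep:
  assumes r: "is_rep G n \<rho>" and s: "is_rep G m \<sigma>"
  shows "is_rep G (n * m) (tensor_rep \<rho> \<sigma>)"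
  using r s unfolding is_rep_def tensor_rep_def
  by (simp add: kron_carrier kron_one kron_mult[of _ n _ _ m])

text \<open>Linear characters vanish outside N, so that equality on N is equality of functions.\<close>
definition lchar :: "'a::comm_ring_1 mat set \<Rightarrow> ('a mat \<Rightarrow> complex) set" where
  "lchar N = {\<mu>. (\<forall>x\<in>N. \<forall>y\<in>N. \<mu> (x * y) = \<mu> x * \<mu> y) \<and> \<mu> (1\<^sub>m 2) = 1 \<and> (\<forall>x. x \<notin> N \<longrightarrow> \<mu> x = 0)}"

definition char_mult :: "'a::comm_ring_1 mat set \<Rightarrow> ('a mat \<Rightarrow> complex) \<Rightarrow> ('a mat \<Rightarrow> complex) \<Rightarrow> complex" where
  "char_mult N \<chi> \<mu> = (\<Sum>g\<in>N. \<chi> g * cnj (\<mu> g)) / of_nat (card N)"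

abbreviation rep_mult :: "'a::comm_ring_1 mat set \<Rightarrow> ('a mat \<Rightarrow> complex mat) \<Rightarrow> ('a mat \<Rightarrow> complex) \<Rightarrow> complex" where
  "rep_mult N \<rho> \<mu> \<equiv> char_mult N (\<lambda>g. mat_tr (\<rho> g)) \<mu>"

section \<open>Schur's lemma and orthogonality of irreducible characters\<close>

context mat_group
begin

text \<open>Kernel and image of an intertwiner are invariant, so the kernel is zero and the image
  everything. The inverse is assembled column by column from preimages of the unit vectors, since
  \<open>n\<close> and \<open>m\<close> may a priori differ.\<close>

lemma schur_lemma:
  assumes r: "irrep G n \<rho>" and s: "irrep G m \<sigma>" and T: "T \<in> carrier_mat n m"
    and comm: "\<And>g. g \<in> G \<Longrightarrow> \<rho> g * T = T * \<sigma> g" and nz: "T \<noteq> 0\<^sub>m n m"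
  shows "\<exists>S\<in>carrier_mat m n. T * S = 1\<^sub>m n \<and> S * T = 1\<^sub>m m"
proof -
  have rr: "is_rep G n \<rho>" and ss: "is_rep G m \<sigma>" using r s by (auto simp: irrep_def)
  note rc = is_repD(1)[OF rr] and sc = is_repD(1)[OF ss]
  have cv: "\<rho> g *\<^sub>v (T *\<^sub>v v) = T *\<^sub>v (\<sigma> g *\<^sub>v v)" if "g \<in> G" "v \<in> carrier_vec m" for g v
    using comm[OF that(1)] assoc_mult_mat_vec[OF rc[OF that(1)] T that(2)]
      assoc_mult_mat_vec[OF T sc[OF that(1)] that(2)] by simp
  have z: "0\<^sub>m n m *\<^sub>v v = (0\<^sub>v n :: complex vec)" if "v \<in> carrier_vec m" for v
    using that by (intro eq_vecI) auto
  define Ker where "Ker = {v \<in> carrier_vec m. T *\<^sub>v v = 0\<^sub>v n}"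
  define Im where "Im = (\<lambda>v. T *\<^sub>v v) ` carrier_vec m"
  have "invariant_subspace G m \<sigma> Ker"
    unfolding invariant_subspace_def
  proof (intro conjI ballI allI)
    fix g v assume "g \<in> G" "v \<in> Ker"
    moreover from this have "\<rho> g *\<^sub>v 0\<^sub>v n = 0\<^sub>v n" using rc[of g] by auto
    ultimately show "\<sigma> g *\<^sub>v v \<in> Ker" using cv[of g v] sc[of g] by (auto simp: Ker_def)
  qed (use T in \<open>auto simp: Ker_def mult_add_distrib_mat_vec[OF T] mult_mat_vec[OF T]\<close>)
  moreover have "Ker \<noteq> carrier_vec m"
  proof
    assume K: "Ker = carrier_vec m"
    have "T *\<^sub>v v = 0\<^sub>m n m *\<^sub>v v" if "v \<in> carrier_vec m" for v
    proof -
      have "v \<in> Ker" using K that by simp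
      thus ?thesis using z[OF that] by (simp add: Ker_def)
    qed
    thus False using mat_eq_by_vec[OF T, of "0\<^sub>m n m"] nz by auto
  qed
  ultimately have K0: "Ker = {0\<^sub>v m}" using s by (auto simp: irrep_def)
  have "invariant_subspace G n \<rho> Im"
    unfolding invariant_subspace_def
  proof (intro conjI ballI allI)
    show "Im \<subseteq> carrier_vec n" using T by (auto simp: Im_def)
    show "0\<^sub>v n \<in> Im" using T by (auto simp: Im_def intro!: image_eqI[of _ _ "0\<^sub>v m"])
  next
    fix v w assume "v \<in> Im" "w \<in> Im"
    then obtain x y where "x \<in> carrier_vec m" "y \<in> carrier_vec m" "v = T *\<^sub>v x" "w = T *\<^sub>v y"
      by (auto simp: Im_def)
    thus "v + w \<in> Im" unfolding Im_def
      by (intro image_eqI[of _ _ "x + y"]) (simp_all add: mult_add_distrib_mat_vec[OF T])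
  next
    fix c v assume "v \<in> Im"
    then obtain x where "x \<in> carrier_vec m" "v = T *\<^sub>v x" by (auto simp: Im_def)
    thus "c \<cdot>\<^sub>v v \<in> Im" unfolding Im_def
      by (intro image_eqI[of _ _ "c \<cdot>\<^sub>v x"]) (simp_all add: mult_mat_vec[OF T])
  next
    fix g v assume g: "g \<in> G" and "v \<in> Im"
    then obtain x where "x \<in> carrier_vec m" "v = T *\<^sub>v x" by (auto simp: Im_def)
    thus "\<rho> g *\<^sub>v v \<in> Im" unfolding Im_def using cv[OF g] sc[OF g]
      by (intro image_eqI[of _ _ "\<sigma> g *\<^sub>v x"]) auto
  qed
  moreover have "Im \<noteq> {0\<^sub>v n}"
  proof
    assume I: "Im = {0\<^sub>v n}"
    have "T *\<^sub>v v = 0\<^sub>m n m *\<^sub>v v" if "v \<in> carrier_vec m" for v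
    proof -
      have "T *\<^sub>v v \<in> Im" using that by (auto simp: Im_def)
      thus ?thesis using I z[OF that] by auto
    qed
    thus False using mat_eq_by_vec[OF T, of "0\<^sub>m n m"] nz by auto
  qed
  ultimately have I: "Im = carrier_vec n" using r by (auto simp: irrep_def)
  have "\<exists>s. s \<in> carrier_vec m \<and> T *\<^sub>v s = unit_vec n i" for i
  proof -
    have "unit_vec n i \<in> Im" using I by auto
    thus ?thesis by (auto simp: Im_def)
  qed
  then obtain f where f: "\<And>i. f i \<in> carrier_vec m" "\<And>i. T *\<^sub>v f i = unit_vec n i" by metis
  define S where "S = mat_of_cols m (map f [0..<n])"
  have S: "S \<in> carrier_mat m n" unfolding S_def by (simp add: carrier_matI)
  have cS: "col S j = f j" if "j < n" for j
    using that f(1) by (simp add: S_def)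
  have TS: "T * S = 1\<^sub>m n"
    by (rule mat_col_eqI) (use T S col_mult2[OF T S] cS f in auto)
  have "S * T = 1\<^sub>m m"
  proof (rule mat_eq_by_vec[of _ m m])
    fix v :: "complex vec" assume v: "v \<in> carrier_vec m"
    have "T *\<^sub>v (S *\<^sub>v (T *\<^sub>v v)) = T *\<^sub>v v"
      using assoc_mult_mat_vec[OF T S, of "T *\<^sub>v v"] T v TS by auto
    hence "T *\<^sub>v (S *\<^sub>v (T *\<^sub>v v) - v) = 0\<^sub>v n"
      using T S v by (subst mult_minus_distrib_mat_vec[OF T]) auto
    hence "S *\<^sub>v (T *\<^sub>v v) - v \<in> Ker" using T S v by (auto simp: Ker_def)
    hence z: "S *\<^sub>v (T *\<^sub>v v) - v = 0\<^sub>v m" using K0 by auto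
    have "S *\<^sub>v (T *\<^sub>v v) = v"
    proof (rule eq_vecI)
      fix i assume i: "i < dim_vec v"
      have "(S *\<^sub>v (T *\<^sub>v v) - v) $ i = 0" using z i v by simp
      thus "(S *\<^sub>v (T *\<^sub>v v)) $ i = v $ i" using i v S by simp
    qed (use S v in auto)
    thus "(S * T) *\<^sub>v v = 1\<^sub>m m *\<^sub>v v" using assoc_mult_mat_vec[OF S T v] v by simp
  qed (use S T in auto)
  thus ?thesis using S TS by blast
qed

lemma schur_scalar:
  assumes r: "irrep G n \<rho>" and T: "T \<in> carrier_mat n n"
    and comm: "\<And>g. g \<in> G \<Longrightarrow> \<rho> g * T = T * \<rho> g"
  shows "\<exists>c. T = c \<cdot>\<^sub>m 1\<^sub>m n"
proof -
  have rr: "is_rep G n \<rho>" and n: "n > 0" using r by (auto simp: irrep_def)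
  note rc = is_repD(1)[OF rr]
  obtain c where "eigenvalue T c"
    using spectrum_non_empty[OF T n] by (auto simp: spectrum_def)
  then obtain v where v: "v \<in> carrier_vec n" "v \<noteq> 0\<^sub>v n" "T *\<^sub>v v = c \<cdot>\<^sub>v v"
    using T by (auto simp: eigenvalue_def eigenvector_def)
  define E where "E = {v \<in> carrier_vec n. T *\<^sub>v v = c \<cdot>\<^sub>v v}"
  have "invariant_subspace G n \<rho> E"
    unfolding invariant_subspace_def
  proof (intro conjI ballI allI)
    fix g v assume gv: "g \<in> G" "v \<in> E"
    hence vc: "v \<in> carrier_vec n" by (auto simp: E_def)
    have "T *\<^sub>v (\<rho> g *\<^sub>v v) = \<rho> g *\<^sub>v (T *\<^sub>v v)"
      using comm[OF gv(1)] assoc_mult_mat_vec[OF rc[OF gv(1)] T vc]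
        assoc_mult_mat_vec[OF T rc[OF gv(1)] vc] by simp
    thus "\<rho> g *\<^sub>v v \<in> E" using gv rc[OF gv(1)] by (auto simp: E_def mult_mat_vec[of _ n n])
  qed (use T in \<open>auto simp: E_def mult_add_distrib_mat_vec[OF T] mult_mat_vec[OF T]
        smult_add_distrib_vec[of _ n] smult_smult_assoc mult.commute\<close>)
  moreover have "E \<noteq> {0\<^sub>v n}" using v by (auto simp: E_def)
  ultimately have E: "E = carrier_vec n" using r by (auto simp: irrep_def)
  have "T = c \<cdot>\<^sub>m 1\<^sub>m n"
  proof (rule mat_eq_by_vec[OF T])
    fix v :: "complex vec" assume v: "v \<in> carrier_vec n"
    hence "T *\<^sub>v v = c \<cdot>\<^sub>v v" using E by (auto simp: E_def)
    also have "\<dots> = (c \<cdot>\<^sub>m 1\<^sub>m n) *\<^sub>v v" using v by (simp add: smult_one_mult_vec)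
    finally show "T *\<^sub>v v = (c \<cdot>\<^sub>m 1\<^sub>m n) *\<^sub>v v" .
  qed auto
  thus ?thesis by blast
qed

text \<open>\<open>T\<close> is the sum over g of \<open>\<rho> g * E * \<sigma> (minv g)\<close>,
  where E is the matrix unit at position (a, b). Reindexing the sum by h g moves h from the left
  side to the right.\<close>

lemma averaged_intertwiner:
  assumes rr: "is_rep G n \<rho>" and ss: "is_rep G m \<sigma>" and h: "h \<in> G" and a: "a < n" and b: "b < m"
    and T: "T = mat n m (\<lambda>(i, j). \<Sum>g\<in>G. \<rho> g $$ (i, a) * \<sigma> (minv g) $$ (b, j))"
  shows "\<rho> h * T = T * \<sigma> h"
proof (rule eq_matI)
  note rc = is_repD(1)[OF rr] and sc = is_repD(1)[OF ss]
  have Tc: "T \<in> carrier_mat n m" by (simp add: T)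
  fix i j assume "i < dim_row (T * \<sigma> h)" "j < dim_col (T * \<sigma> h)"
  hence ij: "i < n" "j < m" using Tc sc[OF h] by auto
  have "(\<rho> h * T) $$ (i, j) = (\<Sum>k<n. \<rho> h $$ (i, k) * T $$ (k, j))"
    by (rule mult_mat_index[OF rc[OF h] Tc ij])
  also have "\<dots> = (\<Sum>k<n. \<Sum>g\<in>G. \<rho> h $$ (i, k) * (\<rho> g $$ (k, a) * \<sigma> (minv g) $$ (b, j)))"
    using ij by (simp add: T sum_distrib_left)
  also have "\<dots> = (\<Sum>g\<in>G. (\<Sum>k<n. \<rho> h $$ (i, k) * \<rho> g $$ (k, a)) * \<sigma> (minv g) $$ (b, j))"
    by (subst sum.swap) (simp add: sum_distrib_right mult.assoc)
  also have "\<dots> = (\<Sum>g\<in>G. \<rho> (h * g) $$ (i, a) * \<sigma> (minv (h * g) * h) $$ (b, j))"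
  proof (intro sum.cong refl)
    fix g assume g: "g \<in> G"
    have "minv (h * g) * h = minv g" using g h by (simp add: minv_mult assoc minv_props r_one)
    thus "(\<Sum>k<n. \<rho> h $$ (i, k) * \<rho> g $$ (k, a)) * \<sigma> (minv g) $$ (b, j) =
        \<rho> (h * g) $$ (i, a) * \<sigma> (minv (h * g) * h) $$ (b, j)"
      using is_repD(2)[OF rr h g] mult_mat_index[OF rc[OF h] rc[OF g] ij(1) a] by simp
  qed
  also have "\<dots> = (\<Sum>g\<in>G. \<rho> g $$ (i, a) * \<sigma> (minv g * h) $$ (b, j))"
    by (rule sum_lmult[OF h, of "\<lambda>g. \<rho> g $$ (i, a) * \<sigma> (minv g * h) $$ (b, j)"])
  also have "\<dots> = (\<Sum>g\<in>G. \<Sum>k<m. \<rho> g $$ (i, a) * \<sigma> (minv g) $$ (b, k) * \<sigma> h $$ (k, j))"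
  proof (intro sum.cong refl)
    fix g assume g: "g \<in> G"
    show "\<rho> g $$ (i, a) * \<sigma> (minv g * h) $$ (b, j) =
        (\<Sum>k<m. \<rho> g $$ (i, a) * \<sigma> (minv g) $$ (b, k) * \<sigma> h $$ (k, j))"
      using is_repD(2)[OF ss minv_props(1)[OF g] h]
        mult_mat_index[OF sc[OF minv_props(1)[OF g]] sc[OF h] b ij(2)]
      by (simp add: sum_distrib_left mult.assoc)
  qed
  also have "\<dots> = (\<Sum>k<m. T $$ (i, k) * \<sigma> h $$ (k, j))"
    using ij by (subst sum.swap) (simp add: T sum_distrib_right)
  also have "\<dots> = (T * \<sigma> h) $$ (i, j)"
    by (rule mult_mat_index[OF Tc sc[OF h] ij, symmetric])
  finally show "(\<rho> h * T) $$ (i, j) = (T * \<sigma> h) $$ (i, j)" .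
qed (use is_repD(1)[OF rr h] is_repD(1)[OF ss h] in \<open>auto simp: T\<close>)

text \<open>Irreducible representations are compared through their traces: a nonzero averaged
  intertwiner is invertible by Schur's lemma and would force the traces to agree. The averaging
  argument produces the second trace at \<open>minv g\<close>; \<open>trace_minv\<close> later turns
  it into a complex conjugate.\<close>

lemma irrep_orthogonality:
  assumes r: "irrep G n \<rho>" and s: "irrep G m \<sigma>"
  shows "(\<Sum>g\<in>G. mat_tr (\<rho> g) * mat_tr (\<sigma> (minv g))) =
    (if \<forall>g\<in>G. mat_tr (\<rho> g) = mat_tr (\<sigma> g) then of_nat (card G) else 0)"
proof (cases "\<forall>g\<in>G. mat_tr (\<rho> g) = mat_tr (\<sigma> g)")
  case False
  have rr: "is_rep G n \<rho>" and ss: "is_rep G m \<sigma>" using r s by (auto simp: irrep_def)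
  note rc = is_repD(1)[OF rr] and sc = is_repD(1)[OF ss]
  have "(\<Sum>g\<in>G. \<rho> g $$ (a, a) * \<sigma> (minv g) $$ (b, b)) = 0" if ab: "a < n" "b < m" for a b
  proof (rule ccontr)
    assume nz: "(\<Sum>g\<in>G. \<rho> g $$ (a, a) * \<sigma> (minv g) $$ (b, b)) \<noteq> 0"
    define T where "T = mat n m (\<lambda>(i, j). \<Sum>g\<in>G. \<rho> g $$ (i, a) * \<sigma> (minv g) $$ (b, j))"
    have T: "T \<in> carrier_mat n m" by (simp add: T_def)
    have comm: "\<rho> g * T = T * \<sigma> g" if "g \<in> G" for g
      by (rule averaged_intertwiner[OF rr ss that ab T_def])
    have "T $$ (a, b) \<noteq> 0" using nz ab by (simp add: T_def)
    hence "T \<noteq> 0\<^sub>m n m" using ab by auto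
    from schur_lemma[OF r s T comm this] obtain S where S: "S \<in> carrier_mat m n"
      and TS: "T * S = 1\<^sub>m n" "S * T = 1\<^sub>m m" by blast
    have "mat_tr (\<rho> g) = mat_tr (\<sigma> g)" if g: "g \<in> G" for g
    proof -
      have "mat_tr (\<rho> g) = mat_tr (\<rho> g * T * S)"
        using rc[OF g] T S TS by (simp add: assoc_mult_mat[of _ n n _ m _ n])
      also have "\<dots> = mat_tr (T * (\<sigma> g * S))"
        using comm[OF g] T S sc[OF g] by (simp add: assoc_mult_mat[of _ n m _ m _ n])
      also have "\<dots> = mat_tr (\<sigma> g * S * T)"
        using T S sc[OF g] by (intro mat_tr_comm) auto
      also have "\<sigma> g * S * T = \<sigma> g"
        using T S sc[OF g] TS by (simp add: assoc_mult_mat[of _ m m _ n _ m])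
      finally show ?thesis .
    qed
    thus False using False by blast
  qed
  hence "(\<Sum>a<n. \<Sum>b<m. \<Sum>g\<in>G. \<rho> g $$ (a, a) * \<sigma> (minv g) $$ (b, b)) = 0" by simp
  also have "(\<Sum>a<n. \<Sum>b<m. \<Sum>g\<in>G. \<rho> g $$ (a, a) * \<sigma> (minv g) $$ (b, b)) =
      (\<Sum>g\<in>G. \<Sum>a<n. \<Sum>b<m. \<rho> g $$ (a, a) * \<sigma> (minv g) $$ (b, b))"
    by (rule trans[OF sum.cong[OF refl sum.swap] sum.swap])
  also have "\<dots> = (\<Sum>g\<in>G. mat_tr (\<rho> g) * mat_tr (\<sigma> (minv g)))"
    using minv_props(1) by (intro sum.cong) (auto simp: mat_tr_eq[OF rc] mat_tr_eq[OF sc] sum_product)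
  finally show ?thesis unfolding if_not_P[OF False] .
next
  case True
  have rr: "is_rep G n \<rho>" and n: "n > 0" using r by (auto simp: irrep_def)
  note rc = is_repD(1)[OF rr]
  have key: "(\<Sum>g\<in>G. \<rho> g $$ (a, a) * \<rho> (minv g) $$ (b, b)) = (if a = b then of_nat (card G) / of_nat n else 0)"
    if ab: "a < n" "b < n" for a b
  proof -
    define T where "T = mat n n (\<lambda>(i, j). \<Sum>g\<in>G. \<rho> g $$ (i, a) * \<rho> (minv g) $$ (b, j))"
    have T: "T \<in> carrier_mat n n" by (simp add: T_def)
    have comm: "\<rho> g * T = T * \<rho> g" if "g \<in> G" for g
      by (rule averaged_intertwiner[OF rr rr that ab T_def])
    obtain c where c: "T = c \<cdot>\<^sub>m 1\<^sub>m n" using schur_scalar[OF r T comm] by blast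
    have "(\<Sum>g\<in>G. \<rho> g $$ (a, a) * \<rho> (minv g) $$ (b, b)) = T $$ (a, b)" using ab by (simp add: T_def)
    also have "\<dots> = (if a = b then c else 0)" using ab by (simp add: c)
    finally have 1: "(\<Sum>g\<in>G. \<rho> g $$ (a, a) * \<rho> (minv g) $$ (b, b)) = (if a = b then c else 0)" .
    \<comment> \<open>The trace of the scalar matrix \<open>T\<close>, computed a second time from
      \<open>\<rho> (minv g) * \<rho> g = 1\<close> in each summand, determines
      \<open>c\<close>.\<close>
    have "of_nat n * c = (\<Sum>i<n. T $$ (i, i))" by (simp add: c)
    also have "\<dots> = (\<Sum>i<n. \<Sum>g\<in>G. \<rho> (minv g) $$ (b, i) * \<rho> g $$ (i, a))"
      by (simp add: T_def mult.commute)
    also have "\<dots> = (\<Sum>g\<in>G. \<Sum>i<n. \<rho> (minv g) $$ (b, i) * \<rho> g $$ (i, a))" by (rule sum.swap)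
    also have "\<dots> = (\<Sum>g\<in>G. 1\<^sub>m n $$ (b, a))"
    proof (intro sum.cong refl)
      fix g assume g: "g \<in> G"
      show "(\<Sum>i<n. \<rho> (minv g) $$ (b, i) * \<rho> g $$ (i, a)) = 1\<^sub>m n $$ (b, a)"
        using mult_mat_index[OF rc[OF minv_props(1)[OF g]] rc[OF g] ab(2,1)] rep_minv[OF rr g] by simp
    qed
    also have "\<dots> = (if a = b then of_nat (card G) else 0)" using ab by simp
    finally have "a = b \<Longrightarrow> c = of_nat (card G) / of_nat n" using n by (simp add: field_simps)
    thus ?thesis using 1 by simp
  qed
  have "(\<Sum>g\<in>G. mat_tr (\<rho> g) * mat_tr (\<sigma> (minv g))) = (\<Sum>g\<in>G. mat_tr (\<rho> g) * mat_tr (\<rho> (minv g)))"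
    using True minv_props(1) by (intro sum.cong) auto
  also have "\<dots> = (\<Sum>g\<in>G. \<Sum>a<n. \<Sum>b<n. \<rho> g $$ (a, a) * \<rho> (minv g) $$ (b, b))"
    using minv_props(1) by (intro sum.cong) (auto simp: mat_tr_eq[OF rc] sum_product)
  also have "\<dots> = (\<Sum>a<n. \<Sum>b<n. \<Sum>g\<in>G. \<rho> g $$ (a, a) * \<rho> (minv g) $$ (b, b))"
    by (rule sym) (rule trans[OF sum.cong[OF refl sum.swap] sum.swap])
  also have "\<dots> = (\<Sum>a<n. \<Sum>b<n. if a = b then of_nat (card G) / of_nat n else 0)"
    by (intro sum.cong refl) (auto simp: key)
  also have "\<dots> = of_nat (card G)" using n by (simp add: sum.delta)
  finally show ?thesis using True by simp
qed

section \<open>Abelian groups, linear characters and traces of inverses\<close>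

lemma abelian_irrep_dim:
  assumes ab: "\<And>g h. g \<in> G \<Longrightarrow> h \<in> G \<Longrightarrow> g * h = h * g" and r: "irrep G n \<rho>"
  shows "n = 1"
proof (rule ccontr)
  assume "n \<noteq> 1"
  have rr: "is_rep G n \<rho>" and n: "n > 0" using r by (auto simp: irrep_def)
  hence n2: "n \<ge> 2" using \<open>n \<noteq> 1\<close> by simp
  have sc: "\<exists>c. \<rho> g = c \<cdot>\<^sub>m 1\<^sub>m n" if g: "g \<in> G" for g
    by (rule schur_scalar[OF r is_repD(1)[OF rr g]]) (metis ab g is_repD(2)[OF rr])
  define W where "W = range (\<lambda>c. c \<cdot>\<^sub>v (unit_vec n 0 :: complex vec))"
  have "invariant_subspace G n \<rho> W"
    unfolding invariant_subspace_def
  proof (intro conjI ballI allI)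
    fix v w assume "v \<in> W" "w \<in> W"
    then obtain c d where "v = c \<cdot>\<^sub>v unit_vec n 0" "w = d \<cdot>\<^sub>v unit_vec n 0" by (auto simp: W_def)
    thus "v + w \<in> W" unfolding W_def by (intro image_eqI[of _ _ "c + d"]) (auto simp: add_smult_distrib_vec)
  next
    fix g v assume "g \<in> G" "v \<in> W"
    then obtain c d where "\<rho> g = c \<cdot>\<^sub>m 1\<^sub>m n" "v = d \<cdot>\<^sub>v unit_vec n 0"
      using sc[of g] unfolding W_def by blast
    thus "\<rho> g *\<^sub>v v \<in> W" unfolding W_def
      by (intro image_eqI[of _ _ "c * d"]) (auto simp: smult_one_mult_vec smult_smult_assoc)
  next
    show "0\<^sub>v n \<in> W" unfolding W_def by (intro image_eqI[of _ _ 0]) auto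
  qed (auto simp: W_def smult_smult_assoc)
  hence "W = {0\<^sub>v n} \<or> W = carrier_vec n" using r by (auto simp: irrep_def)
  thus False
  proof
    assume "W = {0\<^sub>v n}"
    moreover have "unit_vec n 0 \<in> W" unfolding W_def by (intro image_eqI[of _ _ 1]) auto
    ultimately have "unit_vec n 0 = (0\<^sub>v n :: complex vec)" by auto
    hence "unit_vec n 0 $ 0 = (0\<^sub>v n :: complex vec) $ 0" by simp
    thus False using n by simp
  next
    assume "W = carrier_vec n"
    hence "unit_vec n 1 \<in> W" by auto
    then obtain c where "unit_vec n 1 = c \<cdot>\<^sub>v (unit_vec n 0 :: complex vec)" by (auto simp: W_def)
    hence "unit_vec n 1 $ 1 = (c \<cdot>\<^sub>v unit_vec n 0 :: complex vec) $ 1" by simp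
    thus False using n2 by simp
  qed
qed

lemma trace_sum_lchars:
  assumes ab: "\<And>g h. g \<in> G \<Longrightarrow> h \<in> G \<Longrightarrow> g * h = h * g" and r: "is_rep G n \<rho>"
  shows "\<exists>L. set L \<subseteq> lchar G \<and> (\<forall>g\<in>G. mat_tr (\<rho> g) = (\<Sum>\<mu>\<leftarrow>L. \<mu> g))"
proof -
  obtain L where L: "\<forall>(m, \<tau>) \<in> set L. irrep G m \<tau>"
    "\<forall>g\<in>G. mat_tr (\<rho> g) = (\<Sum>(m, \<tau>)\<leftarrow>L. mat_tr (\<tau> g))"
    using trace_sum_irreps[OF r] by blast
  define F :: "nat \<times> ('a mat \<Rightarrow> complex mat) \<Rightarrow> 'a mat \<Rightarrow> complex"
    where "F = (\<lambda>(m, \<tau>) g. if g \<in> G then mat_tr (\<tau> g) else 0)"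
  have "F (m, \<tau>) \<in> lchar G" if mt: "(m, \<tau>) \<in> set L" for m \<tau>
  proof -
    have "irrep G m \<tau>" using L mt by auto
    moreover from this have "m = 1" using abelian_irrep_dim ab by blast
    ultimately have t: "is_rep G 1 \<tau>" by (auto simp: irrep_def)
    note tc = is_repD(1)[OF t]
    have "F (m, \<tau>) g = \<tau> g $$ (0, 0)" if "g \<in> G" for g
      using that mat_tr_eq[OF tc[OF that]] by (simp add: F_def)
    moreover have "\<tau> (g * h) $$ (0, 0) = \<tau> g $$ (0, 0) * \<tau> h $$ (0, 0)" if "g \<in> G" "h \<in> G" for g h
      using is_repD(2)[OF t that] mult_mat_index[OF tc[OF that(1)] tc[OF that(2)], of 0 0] by simp
    moreover have "\<tau> (1\<^sub>m 2) $$ (0, 0) = 1" using is_repD(3)[OF t] by simp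
    ultimately show ?thesis using oneG multG unfolding lchar_def by (auto simp: F_def)
  qed
  hence "set (map F L) \<subseteq> lchar G" by auto
  moreover have "mat_tr (\<rho> g) = (\<Sum>\<mu>\<leftarrow>map F L. \<mu> g)" if "g \<in> G" for g
    using L(2) that by (auto simp: F_def o_def case_prod_unfold)
  ultimately show ?thesis by blast
qed

lemma lcharD:
  assumes "\<mu> \<in> lchar G"
  shows "g \<in> G \<Longrightarrow> h \<in> G \<Longrightarrow> \<mu> (g * h) = \<mu> g * \<mu> h" "\<mu> (1\<^sub>m 2) = 1" "g \<notin> G \<Longrightarrow> \<mu> g = 0"
  using assms by (auto simp: lchar_def)

lemma lchar_minv_mult: "\<mu> \<in> lchar G \<Longrightarrow> g \<in> G \<Longrightarrow> \<mu> g * \<mu> (minv g) = 1"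
  using lcharD(1)[of \<mu> g "minv g"] lcharD(2)[of \<mu>] minv_props[of g] by simp

text \<open>Translation by \<open>g\<close> permutes the factors in the product of all values of
  \<open>\<mu>\<close>, so \<open>\<mu> g ^ card G = 1\<close>.\<close>

lemma lchar_norm:
  assumes m: "\<mu> \<in> lchar G" and g: "g \<in> G"
  shows "cmod (\<mu> g) = 1"
proof -
  have nz: "\<mu> x \<noteq> 0" if "x \<in> G" for x using lchar_minv_mult[OF m that] by auto
  have "(\<Prod>x\<in>G. \<mu> (g * x)) = (\<Prod>x\<in>G. \<mu> x)"
    by (rule prod.reindex_bij_witness[of _ "\<lambda>x. minv g * x" "\<lambda>x. g * x"])
       (auto simp: minv_cancel_left minv_cancel_right multG minv_props g)
  moreover have "(\<Prod>x\<in>G. \<mu> (g * x)) = \<mu> g ^ card G * (\<Prod>x\<in>G. \<mu> x)"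
    using lcharD(1)[OF m g] by (simp add: prod.distrib)
  ultimately have "\<mu> g ^ card G = 1" using nz finG by auto
  hence "cmod (\<mu> g) ^ card G = 1" by (metis norm_one norm_power)
  thus ?thesis using power_eq_imp_eq_base[of "cmod (\<mu> g)" "card G" 1] card_pos by simp
qed

lemma lchar_cnj: "\<mu> \<in> lchar G \<Longrightarrow> g \<in> G \<Longrightarrow> \<mu> g * cnj (\<mu> g) = 1"
  using lchar_norm[of \<mu> g] by (simp add: complex_norm_square[symmetric])

lemma lchar_minv:
  assumes "\<mu> \<in> lchar G" "g \<in> G"
  shows "\<mu> (minv g) = cnj (\<mu> g)"
proof -
  have "\<mu> g * \<mu> (minv g) = \<mu> g * cnj (\<mu> g)" using lchar_minv_mult lchar_cnj assms by simp
  thus ?thesis using lchar_norm[OF assms] by auto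
qed

lemma lchar_orthogonality:
  assumes m: "\<mu> \<in> lchar G" and n: "\<nu> \<in> lchar G"
  shows "(\<Sum>g\<in>G. \<mu> g * cnj (\<nu> g)) = (if \<mu> = \<nu> then of_nat (card G) else 0)"
proof (cases "\<mu> = \<nu>")
  case True
  thus ?thesis using lchar_cnj[OF n] by simp
next
  case False
  then obtain h where "\<mu> h \<noteq> \<nu> h" by auto
  hence h: "h \<in> G" "\<mu> h \<noteq> \<nu> h" using lcharD(3)[OF m, of h] lcharD(3)[OF n, of h] by metis+
  let ?S = "\<Sum>g\<in>G. \<mu> g * cnj (\<nu> g)"
  have "?S = (\<Sum>g\<in>G. \<mu> (h * g) * cnj (\<nu> (h * g)))" using sum_lmult[OF h(1), of "\<lambda>g. \<mu> g * cnj (\<nu> g)"] by simp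
  also have "\<dots> = \<mu> h * cnj (\<nu> h) * ?S"
    using lcharD(1)[OF m h(1)] lcharD(1)[OF n h(1)] by (simp add: sum_distrib_left mult_ac)
  finally have "?S = 0 \<or> \<mu> h * cnj (\<nu> h) = 1" by auto
  moreover have "\<mu> h * cnj (\<nu> h) \<noteq> 1"
  proof
    assume "\<mu> h * cnj (\<nu> h) = 1"
    hence "\<mu> h * (\<nu> h * cnj (\<nu> h)) = \<nu> h" by (simp add: mult_ac)
    thus False using lchar_cnj[OF n h(1)] h(2) by simp
  qed
  ultimately show ?thesis using False by simp
qed

lemma char_mult_lchar:
  assumes "\<mu> \<in> lchar G" "\<nu> \<in> lchar G"
  shows "char_mult G \<mu> \<nu> = (if \<mu> = \<nu> then 1 else 0)"
  using lchar_orthogonality[OF assms] card_pos by (simp add: char_mult_def)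

lemma char_mult_list:
  assumes "set L \<subseteq> lchar G" "\<nu> \<in> lchar G" "\<forall>g\<in>G. \<chi> g = (\<Sum>\<mu>\<leftarrow>L. \<mu> g)"
  shows "char_mult G \<chi> \<nu> = of_nat (count_list L \<nu>)"
proof -
  have "char_mult G \<chi> \<nu> = char_mult G (\<lambda>g. \<Sum>\<mu>\<leftarrow>L. \<mu> g) \<nu>"
    unfolding char_mult_def using assms(3) by (intro arg_cong2[of _ _ _ _ "(/)"] sum.cong) auto
  also have "\<dots> = of_nat (count_list L \<nu>)" using assms(1)
  proof (induction L)
    case (Cons a L)
    have "char_mult G (\<lambda>g. \<Sum>\<mu>\<leftarrow>a # L. \<mu> g) \<nu> = char_mult G a \<nu> + char_mult G (\<lambda>g. \<Sum>\<mu>\<leftarrow>L. \<mu> g) \<nu>"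
      by (simp add: char_mult_def sum.distrib add_divide_distrib distrib_right)
    thus ?case using Cons char_mult_lchar[of a \<nu>] assms(2) by auto
  qed (simp add: char_mult_def)
  finally show ?thesis .
qed

text \<open>An abelian subgroup containing g; closure under inverses needs no powers of g.\<close>
lemma double_centralizer_group:
  assumes g: "g \<in> G"
  defines "C \<equiv> {h \<in> G. \<forall>k\<in>G. k * g = g * k \<longrightarrow> h * k = k * h}"
  shows "mat_group C" "\<And>h k. h \<in> C \<Longrightarrow> k \<in> C \<Longrightarrow> h * k = k * h"
proof -
  show "mat_group C"
  proof
    show "finite C" using finG by (simp add: C_def)
    show "C \<subseteq> carrier_mat 2 2" using carrG by (auto simp: C_def)
    show "1\<^sub>m 2 \<in> C" using oneG by (auto simp: C_def l_one r_one)
  next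
    fix x y assume xy: "x \<in> C" "y \<in> C"
    have "x * y * k = k * (x * y)" if k: "k \<in> G" "k * g = g * k" for k
    proof -
      have "x * y * k = x * (k * y)" using xy k by (simp add: C_def assoc)
      also have "\<dots> = k * (x * y)" using xy k by (simp add: C_def assoc[symmetric])
      finally show ?thesis .
    qed
    thus "x * y \<in> C" using xy multG by (auto simp: C_def)
  next
    fix x assume x: "x \<in> C"
    have xG: "x \<in> G" using x by (simp add: C_def)
    have "minv x * k = k * minv x" if k: "k \<in> G" "k * g = g * k" for k
    proof -
      have "minv x * k = minv x * (k * x) * minv x"
        using xG k by (simp add: assoc minv_props multG r_one)
      also have "k * x = x * k" using x k by (simp add: C_def)
      also have "minv x * (x * k) * minv x = k * minv x" using xG k by (simp add: minv_cancel_left)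
      finally show ?thesis .
    qed
    hence "minv x \<in> C" using xG minv_props by (auto simp: C_def)
    thus "\<exists>h\<in>C. x * h = 1\<^sub>m 2 \<and> h * x = 1\<^sub>m 2" using minv_props[OF xG] by blast
  qed
next
  fix h k assume h: "h \<in> C" "k \<in> C"
  have "k * g = g * k" using h g unfolding C_def by blast
  thus "h * k = k * h" using h unfolding C_def by blast
qed

text \<open>On an abelian subgroup containing \<open>g\<close> the trace is a sum of linear
  characters. Their values have modulus 1, so inverting the argument conjugates each of
  them.\<close>

lemma trace_minv:
  assumes r: "is_rep G n \<rho>" and g: "g \<in> G"
  shows "mat_tr (\<rho> (minv g)) = cnj (mat_tr (\<rho> g))"
proof -
  define C where "C = {h \<in> G. \<forall>k\<in>G. k * g = g * k \<longrightarrow> h * k = k * h}"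
  interpret C: mat_group C unfolding C_def by (rule double_centralizer_group[OF g])
  have ab: "h * k = k * h" if "h \<in> C" "k \<in> C" for h k
    using double_centralizer_group(2)[OF g] that unfolding C_def by blast
  have gC: "g \<in> C" using g by (auto simp: C_def)
  have "is_rep C n \<rho>" using is_rep_subset[OF r, of C] by (auto simp: C_def)
  then obtain L where L: "set L \<subseteq> lchar C" "\<forall>g\<in>C. mat_tr (\<rho> g) = (\<Sum>\<mu>\<leftarrow>L. \<mu> g)"
    using C.trace_sum_lchars ab by blast
  have "mat_tr (\<rho> (minv g)) = sum_list (map (\<lambda>\<mu>. \<mu> (minv g)) L)"
    using L(2) C.minv_props(1)[OF gC] by blast
  also have "map (\<lambda>\<mu>. \<mu> (minv g)) L = map (\<lambda>\<mu>. cnj (\<mu> g)) L"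
    using L(1) C.lchar_minv gC by (intro map_cong) auto
  also have "(\<Sum>\<mu>\<leftarrow>L. cnj (\<mu> g)) = cnj (\<Sum>\<mu>\<leftarrow>L. \<mu> g)" by (induction L) auto
  also have "(\<Sum>\<mu>\<leftarrow>L. \<mu> g) = mat_tr (\<rho> g)" using L(2) gC by simp
  finally show ?thesis .
qed

lemma rep_inner_irreps:
  assumes r: "irrep G n \<rho>" and s: "irrep G m \<sigma>"
  shows "rep_inner G \<rho> \<sigma> = (if \<forall>g\<in>G. mat_tr (\<rho> g) = mat_tr (\<sigma> g) then 1 else 0)"
proof -
  have "(\<Sum>g\<in>G. mat_tr (\<rho> g) * cnj (mat_tr (\<sigma> g))) = (\<Sum>g\<in>G. mat_tr (\<rho> g) * mat_tr (\<sigma> (minv g)))"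
    using trace_minv[of m \<sigma>] s by (intro sum.cong) (auto simp: irrep_def)
  thus ?thesis using irrep_orthogonality[OF r s] card_pos by (simp add: rep_inner_def)
qed

end

section \<open>Characters of abelian subgroups\<close>

lemma card_le_image_mult:
  assumes "finite A" "\<And>y. y \<in> f ` A \<Longrightarrow> card {x \<in> A. f x = y} \<le> S"
  shows "card A \<le> card (f ` A) * S"
proof -
  have "card A = (\<Sum>y\<in>f ` A. card {x \<in> A. f x = y})"
    using sum.group[OF assms(1) finite_imageI[OF assms(1)], of f f "\<lambda>_. 1::nat"] by simp
  also have "\<dots> \<le> (\<Sum>y\<in>f ` A. S)" by (intro sum_mono assms(2))
  finally show ?thesis by simp
qed

lemma mult_cnj_cmod: "z * cnj z = (of_real (cmod z))\<^sup>2"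
  using complex_norm_square[of z] by simp

text \<open>\<open>S\<close> is the orthogonal projection of \<open>F\<close> to the span of
  \<open>C\<close>, whose members have squared norm \<open>K\<close>. The squared norm of
  \<open>F - S\<close> is that of \<open>F\<close> minus \<open>B / K\<close>, and it is
  nonnegative.\<close>

lemma bessel_inequality:
  fixes F :: "'g \<Rightarrow> complex"
  assumes fin: "finite G" "finite C" and K: "K > 0"
    and orth: "\<And>c c'. c \<in> C \<Longrightarrow> c' \<in> C \<Longrightarrow>
      (\<Sum>g\<in>G. c g * cnj (c' g)) = (if c = c' then of_real K else 0)"
  shows "(\<Sum>c\<in>C. (cmod (\<Sum>g\<in>G. F g * cnj (c g)))\<^sup>2) \<le> K * (\<Sum>g\<in>G. (cmod (F g))\<^sup>2)"
proof -
  define b where "b c = (\<Sum>g\<in>G. F g * cnj (c g))" for c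
  define S where "S g = (\<Sum>c\<in>C. b c / K * c g)" for g
  define B where "B = (\<Sum>c\<in>C. (cmod (b c))\<^sup>2)"
  have FS: "(\<Sum>g\<in>G. F g * cnj (S g)) = of_real (B / K)"
  proof -
    have "(\<Sum>g\<in>G. F g * cnj (S g)) = (\<Sum>g\<in>G. \<Sum>c\<in>C. cnj (b c) / K * (F g * cnj (c g)))"
      by (simp add: S_def sum_distrib_left mult_ac)
    also have "\<dots> = (\<Sum>c\<in>C. cnj (b c) / K * b c)"
      by (subst sum.swap) (simp add: b_def sum_distrib_left)
    also have "\<dots> = of_real (B / K)"
      by (simp add: B_def sum_divide_distrib mult_cnj_cmod mult.commute[of "cnj _"])
    finally show ?thesis .
  qed
  have SS: "(\<Sum>g\<in>G. S g * cnj (S g)) = of_real (B / K)"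
  proof -
    have "(\<Sum>g\<in>G. S g * cnj (S g)) =
        (\<Sum>g\<in>G. \<Sum>c\<in>C. \<Sum>c'\<in>C. b c / K * (cnj (b c') / K) * (c g * cnj (c' g)))"
      by (simp add: S_def sum_product mult_ac)
    also have "\<dots> = (\<Sum>c\<in>C. \<Sum>c'\<in>C. \<Sum>g\<in>G. b c / K * (cnj (b c') / K) * (c g * cnj (c' g)))"
      by (rule sym) (rule trans[OF sum.cong[OF refl sum.swap] sum.swap])
    also have "\<dots> = (\<Sum>c\<in>C. \<Sum>c'\<in>C. b c / K * (cnj (b c') / K) * (if c = c' then of_real K else 0))"
      by (intro sum.cong refl) (simp only: sum_distrib_left[symmetric] orth)
    also have "\<dots> = (\<Sum>c\<in>C. b c / K * cnj (b c))"
      using K fin by (intro sum.cong refl) (simp add: if_distrib sum.delta cong: if_cong)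
    also have "\<dots> = of_real (B / K)"
      by (simp add: B_def sum_divide_distrib mult_cnj_cmod)
    finally show ?thesis .
  qed
  have SF: "(\<Sum>g\<in>G. S g * cnj (F g)) = of_real (B / K)"
    using arg_cong[OF FS, of cnj] by (simp add: mult.commute)
  have "of_real (\<Sum>g\<in>G. (cmod (F g - S g))\<^sup>2) = (\<Sum>g\<in>G. (F g - S g) * cnj (F g - S g))"
    by (simp only: mult_cnj_cmod of_real_sum of_real_power)
  also have "\<dots> = (\<Sum>g\<in>G. F g * cnj (F g)) - (\<Sum>g\<in>G. F g * cnj (S g))
      - (\<Sum>g\<in>G. S g * cnj (F g)) + (\<Sum>g\<in>G. S g * cnj (S g))"
    by (simp add: algebra_simps sum.distrib sum_subtractf)
  also have "\<dots> = of_real ((\<Sum>g\<in>G. (cmod (F g))\<^sup>2) - B / K)"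
    unfolding FS SF SS by (simp add: mult_cnj_cmod)
  finally have "(\<Sum>g\<in>G. (cmod (F g - S g))\<^sup>2) = (\<Sum>g\<in>G. (cmod (F g))\<^sup>2) - B / K"
    using of_real_eq_iff by blast
  moreover have "(\<Sum>g\<in>G. (cmod (F g - S g))\<^sup>2) \<ge> 0" by (intro sum_nonneg) auto
  ultimately have "B / K \<le> (\<Sum>g\<in>G. (cmod (F g))\<^sup>2)" by simp
  thus ?thesis using K by (simp add: B_def b_def field_simps)
qed

text \<open>The value 0 outside N agrees with the convention of \<open>lchar\<close>, so that
  conjugates of linear characters can be compared as functions.\<close>

definition conj_char :: "'a::comm_ring_1 mat set \<Rightarrow> 'a mat \<Rightarrow> ('a mat \<Rightarrow> complex) \<Rightarrow> 'a mat \<Rightarrow> complex" where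
  "conj_char N x \<mu> n = (if n \<in> N then \<mu> (minv x * n * x) else 0)"

section \<open>Multiplicities of linear characters in a representation\<close>

locale abelian_subgroup = mat_group G + N: mat_group N for G N :: "'a::comm_ring_1 mat set" +
  assumes NG: "N \<subseteq> G"
    and abN: "g \<in> N \<Longrightarrow> h \<in> N \<Longrightarrow> g * h = h * g"
begin

text \<open>A property of single elements, because the larger abelian group that appears for odd l
  is conjugated only by certain unipotents.\<close>

definition normalizes :: "'a mat \<Rightarrow> bool" where
  "normalizes x \<longleftrightarrow> x \<in> G \<and> (\<forall>n\<in>N. minv x * n * x \<in> N)"

lemma conj_mult:
  assumes "x \<in> G" "g \<in> G" "h \<in> G"
  shows "minv x * (g * h) * x = minv x * g * x * (minv x * h * x)"
  using assms by (simp add: assoc minv_cancel_right multG minv_props)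

lemma conj_bij:
  assumes "normalizes x"
  shows "bij_betw (\<lambda>n. minv x * n * x) N N"
proof -
  have x: "x \<in> G" using assms by (auto simp: normalizes_def)
  have "inj_on (\<lambda>n. minv x * n * x) N"
  proof (rule inj_on_inverseI[where g = "\<lambda>n. x * n * minv x"])
    fix n assume "n \<in> N"
    thus "x * (minv x * n * x) * minv x = n"
      using x NG by (simp add: subset_iff assoc minv_cancel_right multG minv_props r_one)
  qed
  moreover have "(\<lambda>n. minv x * n * x) ` N \<subseteq> N" using assms by (auto simp: normalizes_def)
  ultimately show ?thesis using endo_inj_surj[OF N.finG] by (auto simp: bij_betw_def)
qed

lemma conj_char_lchar:
  assumes x: "normalizes x" and m: "\<mu> \<in> lchar N"
  shows "conj_char N x \<mu> \<in> lchar N"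
proof -
  have xG: "x \<in> G" using x by (auto simp: normalizes_def)
  have "conj_char N x \<mu> (g * h) = conj_char N x \<mu> g * conj_char N x \<mu> h" if "g \<in> N" "h \<in> N" for g h
    using that x NG by (simp add: conj_char_def N.multG conj_mult xG subset_iff N.lcharD(1)[OF m] normalizes_def)
  moreover have "conj_char N x \<mu> (1\<^sub>m 2) = 1"
    using N.oneG xG by (simp add: conj_char_def r_one minv_props N.lcharD(2)[OF m])
  ultimately show ?thesis by (auto simp: lchar_def conj_char_def)
qed

lemma char_mult_conj:
  assumes x: "normalizes x" and cl: "\<And>n. n \<in> N \<Longrightarrow> \<chi> (minv x * n * x) = \<chi> n"
  shows "char_mult N \<chi> (conj_char N x \<mu>) = char_mult N \<chi> \<mu>"
proof -
  have "(\<Sum>n\<in>N. \<chi> n * cnj (conj_char N x \<mu> n)) =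
      (\<Sum>n\<in>N. \<chi> (minv x * n * x) * cnj (\<mu> (minv x * n * x)))"
    by (intro sum.cong) (auto simp: conj_char_def cl)
  also have "\<dots> = (\<Sum>n\<in>N. \<chi> n * cnj (\<mu> n))"
    by (rule sum.reindex_bij_betw[OF conj_bij[OF x], of "\<lambda>n. \<chi> n * cnj (\<mu> n)"])
  finally show ?thesis by (simp add: char_mult_def)
qed

lemma trace_conj:
  assumes r: "is_rep G n \<rho>" and "x \<in> G" "g \<in> G"
  shows "mat_tr (\<rho> (minv x * g * x)) = mat_tr (\<rho> g)"
proof -
  note c = is_repD(1)[OF r]
  have "\<rho> (minv x * g * x) = \<rho> (minv x) * \<rho> (g * x)"
    using assms by (simp add: assoc is_repD(2)[OF r] minv_props multG)
  hence "mat_tr (\<rho> (minv x * g * x)) = mat_tr (\<rho> (g * x) * \<rho> (minv x))"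
    using mat_tr_comm[OF c c] assms minv_props multG by simp
  also have "\<rho> (g * x) * \<rho> (minv x) = \<rho> g"
    using assms by (simp add: is_repD(2)[OF r, symmetric] minv_props multG assoc r_one)
  finally show ?thesis .
qed

lemma rep_lchar_list:
  assumes "is_rep G n \<rho>"
  shows "\<exists>L. set L \<subseteq> lchar N \<and> (\<forall>g\<in>N. mat_tr (\<rho> g) = (\<Sum>\<mu>\<leftarrow>L. \<mu> g)) \<and>
    (\<forall>\<mu>\<in>lchar N. rep_mult N \<rho> \<mu> = of_nat (count_list L \<mu>))"
proof -
  have "is_rep N n \<rho>" using is_rep_subset[OF assms NG] .
  then obtain L where L: "set L \<subseteq> lchar N" "\<forall>g\<in>N. mat_tr (\<rho> g) = (\<Sum>\<mu>\<leftarrow>L. \<mu> g)"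
    using N.trace_sum_lchars abN by blast
  show ?thesis using L N.char_mult_list[OF L(1) _ L(2)] by blast
qed

text \<open>Splitting off the line through \<open>v\<close> leaves a quotient in which the
  multiplicity of \<open>\<mu>\<close> is again a count, so the positive contribution of the line
  cannot be cancelled.\<close>

lemma mult_pos_of_eigenvector:
  assumes r: "is_rep G n \<rho>" and v: "v \<in> carrier_vec n" "v \<noteq> 0\<^sub>v n" and m: "\<mu> \<in> lchar N"
    and ev: "\<And>g. g \<in> N \<Longrightarrow> \<rho> g *\<^sub>v v = \<mu> g \<cdot>\<^sub>v v"
  obtains k where "k > 0" "rep_mult N \<rho> \<mu> = of_nat k"
proof -
  have rN: "is_rep N n \<rho>" using is_rep_subset[OF r NG] .
  define W where "W = range (\<lambda>c. c \<cdot>\<^sub>v v)"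
  have sc: "\<rho> g *\<^sub>v w = \<mu> g \<cdot>\<^sub>v w" if "g \<in> N" "w \<in> W" for g w
    using that ev[OF that(1)] v mult_mat_vec[OF N.is_repD(1)[OF rN that(1)] v(1)]
    by (auto simp: W_def smult_smult_assoc mult.commute)
  have "invariant_subspace N n \<rho> W"
    unfolding invariant_subspace_def
  proof (intro conjI ballI allI)
    show "0\<^sub>v n \<in> W" using v unfolding W_def by (intro image_eqI[of _ _ 0]) auto
  next
    fix a b assume "a \<in> W" "b \<in> W"
    then obtain c d where "a = c \<cdot>\<^sub>v v" "b = d \<cdot>\<^sub>v v" by (auto simp: W_def)
    thus "a + b \<in> W" unfolding W_def by (intro image_eqI[of _ _ "c + d"]) (auto simp: add_smult_distrib_vec)
  next
    fix g w assume "g \<in> N" "w \<in> W"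
    thus "\<rho> g *\<^sub>v w \<in> W" unfolding sc[OF \<open>g \<in> N\<close> \<open>w \<in> W\<close>] by (auto simp: W_def smult_smult_assoc)
  qed (use v in \<open>auto simp: W_def smult_smult_assoc\<close>)
  moreover have "v \<in> W" unfolding W_def by (intro image_eqI[of _ _ 1]) auto
  hence "W \<noteq> {0\<^sub>v n}" using v by auto
  ultimately obtain k s1 s2 where k: "k > 0" and s2: "is_rep N (n - k) s2"
    and tr: "\<forall>g\<in>N. mat_tr (\<rho> g) = mat_tr (s1 g) + mat_tr (s2 g)"
    and s1: "\<forall>g\<in>N. \<forall>c. (\<forall>w\<in>W. \<rho> g *\<^sub>v w = c \<cdot>\<^sub>v w) \<longrightarrow> mat_tr (s1 g) = of_nat k * c"
    using N.rep_split[OF rN] by blast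
  obtain L where L: "set L \<subseteq> lchar N" "\<forall>g\<in>N. mat_tr (s2 g) = (\<Sum>\<mu>\<leftarrow>L. \<mu> g)"
    using N.trace_sum_lchars[OF abN s2] by blast
  have "mat_tr (\<rho> g) = of_nat k * \<mu> g + mat_tr (s2 g)" if "g \<in> N" for g
    using tr s1 sc that by simp
  hence "rep_mult N \<rho> \<mu> = of_nat k * char_mult N \<mu> \<mu> + rep_mult N s2 \<mu>"
    by (simp add: char_mult_def distrib_right sum.distrib add_divide_distrib sum_distrib_left mult.assoc)
  also have "\<dots> = of_nat (k + count_list L \<mu>)"
    using N.char_mult_list[OF L(1) m L(2)] N.char_mult_lchar[OF m m] by simp
  finally show ?thesis using that[of "k + count_list L \<mu>"] k by simp
qed

text \<open>The sum of the operators \<open>cnj (\<mu> g)\<close> times \<open>\<rho> g\<close> maps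
  into the eigenspace of \<open>\<mu>\<close>, and its trace is \<open>card N\<close> times the
  multiplicity. A nonzero trace has a nonzero diagonal entry (j, j), and column j is the
  eigenvector.\<close>

lemma eigenvector_of_mult:
  assumes r: "is_rep G n \<rho>" and m: "\<mu> \<in> lchar N"
    and nz: "rep_mult N \<rho> \<mu> \<noteq> 0"
  shows "\<exists>v\<in>carrier_vec n. v \<noteq> 0\<^sub>v n \<and> (\<forall>g\<in>N. \<rho> g *\<^sub>v v = \<mu> g \<cdot>\<^sub>v v)"
proof -
  note rc = is_repD(1)[OF r subsetD[OF NG]]
  have "(\<Sum>g\<in>N. mat_tr (\<rho> g) * cnj (\<mu> g)) = (\<Sum>i<n. \<Sum>g\<in>N. \<rho> g $$ (i, i) * cnj (\<mu> g))"
    by (subst sum.swap) (simp add: mat_tr_eq[OF rc] sum_distrib_right)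
  hence "(\<Sum>i<n. \<Sum>g\<in>N. \<rho> g $$ (i, i) * cnj (\<mu> g)) \<noteq> 0" using nz by (auto simp: char_mult_def)
  then obtain j where j: "j < n" "(\<Sum>g\<in>N. \<rho> g $$ (j, j) * cnj (\<mu> g)) \<noteq> 0"
    by (metis (no_types, lifting) sum.neutral lessThan_iff)
  define v where "v = vec n (\<lambda>i. \<Sum>g\<in>N. \<rho> g $$ (i, j) * cnj (\<mu> g))"
  have v: "v \<in> carrier_vec n" by (simp add: v_def)
  have "v $ j \<noteq> 0" using j by (simp add: v_def)
  hence "v \<noteq> 0\<^sub>v n" using j by auto
  moreover have "\<rho> h *\<^sub>v v = \<mu> h \<cdot>\<^sub>v v" if h: "h \<in> N" for h
  proof (rule eq_vecI)
    fix i assume "i < dim_vec (\<mu> h \<cdot>\<^sub>v v)"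
    hence i: "i < n" by (simp add: v_def)
    have "(\<rho> h *\<^sub>v v) $ i = (\<Sum>k<n. \<rho> h $$ (i, k) * v $ k)"
      using rc[OF h] i v by (auto simp: scalar_prod_def atLeast0LessThan intro!: sum.cong)
    also have "\<dots> = (\<Sum>k<n. \<Sum>g\<in>N. \<rho> h $$ (i, k) * \<rho> g $$ (k, j) * cnj (\<mu> g))"
      by (simp add: v_def sum_distrib_left mult.assoc)
    also have "\<dots> = (\<Sum>g\<in>N. \<rho> (h * g) $$ (i, j) * cnj (\<mu> g))"
    proof (subst sum.swap, intro sum.cong refl)
      fix g assume g: "g \<in> N"
      show "(\<Sum>k<n. \<rho> h $$ (i, k) * \<rho> g $$ (k, j) * cnj (\<mu> g)) = \<rho> (h * g) $$ (i, j) * cnj (\<mu> g)"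
        using is_repD(2)[OF r subsetD[OF NG h] subsetD[OF NG g]] mult_mat_index[OF rc[OF h] rc[OF g] i j(1)]
        by (simp add: sum_distrib_right)
    qed
    also have "\<dots> = (\<Sum>g\<in>N. \<mu> h * (\<rho> (h * g) $$ (i, j) * cnj (\<mu> (h * g))))"
    proof (intro sum.cong refl)
      fix g assume g: "g \<in> N"
      have "\<mu> h * cnj (\<mu> (h * g)) = (\<mu> h * cnj (\<mu> h)) * cnj (\<mu> g)"
        using N.lcharD(1)[OF m h g] by simp
      also have "\<dots> = cnj (\<mu> g)" using N.lchar_cnj[OF m h] by simp
      finally show "\<rho> (h * g) $$ (i, j) * cnj (\<mu> g) = \<mu> h * (\<rho> (h * g) $$ (i, j) * cnj (\<mu> (h * g)))"
        by (simp add: mult_ac)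
    qed
    also have "\<dots> = (\<Sum>g\<in>N. \<mu> h * (\<rho> g $$ (i, j) * cnj (\<mu> g)))"
      by (rule N.sum_lmult[OF h, of "\<lambda>g. \<mu> h * (\<rho> g $$ (i, j) * cnj (\<mu> g))"])
    also have "\<dots> = (\<mu> h \<cdot>\<^sub>v v) $ i" using i by (simp add: v_def sum_distrib_left)
    finally show "(\<rho> h *\<^sub>v v) $ i = (\<mu> h \<cdot>\<^sub>v v) $ i" .
  qed (use rc[OF h] v in auto)
  ultimately show ?thesis using v by blast
qed

text \<open>Expanding the first factor into linear characters, each \<open>\<mu>\<close> contributes
  the multiplicity in the second factor of the complementary character \<open>\<kappa>\<close>
  divided by \<open>\<mu>\<close>. Every member of \<open>P\<close> occurs \<open>d\<close> times at
  least, and so does its complement; all other contributions are nonnegative.\<close>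

lemma mult_tensor_ge:
  assumes r1: "is_rep G n1 \<rho>1" and r2: "is_rep G n2 \<rho>2" and l: "\<kappa> \<in> lchar N"
    and P: "finite P" "P \<subseteq> lchar N" and d: "d > 0"
    and P1: "\<And>\<mu>. \<mu> \<in> P \<Longrightarrow> \<exists>k\<ge>d. rep_mult N \<rho>1 \<mu> = of_nat k"
    and P2: "\<And>\<mu>. \<mu> \<in> P \<Longrightarrow> \<exists>\<nu>\<in>lchar N. (\<forall>n\<in>N. \<kappa> n = \<mu> n * \<nu> n) \<and>
      (\<exists>k\<ge>d. rep_mult N \<rho>2 \<nu> = of_nat k)"
  shows "\<exists>D\<ge>d * d * card P. rep_mult N (tensor_rep \<rho>1 \<rho>2) \<kappa> = of_nat D"
proof -
  obtain L1 where L1: "set L1 \<subseteq> lchar N" "\<forall>g\<in>N. mat_tr (\<rho>1 g) = (\<Sum>\<mu>\<leftarrow>L1. \<mu> g)"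
    "\<forall>\<mu>\<in>lchar N. rep_mult N \<rho>1 \<mu> = of_nat (count_list L1 \<mu>)"
    using rep_lchar_list[OF r1] by blast
  obtain L2 where L2: "\<forall>\<mu>\<in>lchar N. rep_mult N \<rho>2 \<mu> = of_nat (count_list L2 \<mu>)"
    using rep_lchar_list[OF r2] by blast
  \<comment> \<open>Values on N have modulus 1, so this product is the quotient of
    \<open>\<kappa>\<close> by \<open>\<mu>\<close>.\<close>
  define Q where "Q \<mu> n = \<kappa> n * cnj (\<mu> n)" for \<mu> n
  have Q: "Q \<mu> \<in> lchar N" if "\<mu> \<in> lchar N" for \<mu>
    using that l by (auto simp: lchar_def Q_def)
  have step: "(\<Sum>g\<in>N. (\<Sum>\<mu>\<leftarrow>L. \<mu> g) * mat_tr (\<rho>2 g) * cnj (\<kappa> g)) / of_nat (card N) =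
      of_nat (\<Sum>\<mu>\<leftarrow>L. count_list L2 (Q \<mu>))" if "set L \<subseteq> lchar N" for L
    using that
  proof (induction L)
    case (Cons a L)
    have "(\<Sum>g\<in>N. a g * mat_tr (\<rho>2 g) * cnj (\<kappa> g)) / of_nat (card N) = rep_mult N \<rho>2 (Q a)"
      by (simp add: char_mult_def Q_def mult_ac)
    also have "\<dots> = of_nat (count_list L2 (Q a))" using L2 Q Cons.prems by auto
    finally show ?case using Cons by (simp add: distrib_right sum.distrib add_divide_distrib)
  qed auto
  define D where "D = (\<Sum>\<mu>\<leftarrow>L1. count_list L2 (Q \<mu>))"
  have "rep_mult N (tensor_rep \<rho>1 \<rho>2) \<kappa> =
      (\<Sum>g\<in>N. (\<Sum>\<mu>\<leftarrow>L1. \<mu> g) * mat_tr (\<rho>2 g) * cnj (\<kappa> g)) / of_nat (card N)"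
    unfolding char_mult_def tensor_rep_def
    using NG by (intro arg_cong2[of _ _ _ _ "(/)"] sum.cong refl)
      (auto simp: L1(2)[THEN bspec, symmetric] mat_tr_kron[OF is_repD(1)[OF r1] is_repD(1)[OF r2]])
  hence "rep_mult N (tensor_rep \<rho>1 \<rho>2) \<kappa> = of_nat D"
    using step[OF L1(1)] by (simp add: D_def)
  moreover have "d * d * card P \<le> D"
  proof -
    have c1: "count_list L1 \<mu> \<ge> d" if "\<mu> \<in> P" for \<mu>
      using P1[OF that] L1(3) P that by auto
    have c2: "count_list L2 (Q \<mu>) \<ge> d" if m: "\<mu> \<in> P" for \<mu>
    proof -
      obtain \<nu> k where n: "\<nu> \<in> lchar N" "\<forall>n\<in>N. \<kappa> n = \<mu> n * \<nu> n" "k \<ge> d"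
        "rep_mult N \<rho>2 \<nu> = of_nat k" using P2[OF m] by blast
      have "Q \<mu> x = \<nu> x" for x
      proof (cases "x \<in> N")
        case True
        have "Q \<mu> x = (\<mu> x * cnj (\<mu> x)) * \<nu> x" using n(2) True by (simp add: Q_def)
        thus ?thesis using N.lchar_cnj[of \<mu> x] m P True by auto
      next
        case False
        thus ?thesis using N.lcharD(3)[OF l] N.lcharD(3)[OF n(1)] by (simp add: Q_def)
      qed
      hence "Q \<mu> = \<nu>" by auto
      thus ?thesis using L2 n(1,3,4) by simp
    qed
    have sub: "P \<subseteq> set L1"
    proof
      fix \<mu> assume "\<mu> \<in> P"
      hence "count_list L1 \<mu> \<noteq> 0" using c1 d by fastforce
      thus "\<mu> \<in> set L1" using count_notin by metis
    qed
    have "d * d * card P = (\<Sum>\<mu>\<in>P. d * d)" by simp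
    also have "\<dots> \<le> (\<Sum>\<mu>\<in>P. count_list L1 \<mu> * count_list L2 (Q \<mu>))"
      by (intro sum_mono mult_mono) (auto simp: c1 c2)
    also have "\<dots> \<le> (\<Sum>\<mu>\<in>set L1. count_list L1 \<mu> * count_list L2 (Q \<mu>))"
      using sub by (intro sum_mono2) auto
    also have "\<dots> = D" by (simp add: D_def sum_list_map_eq_sum_count)
    finally show ?thesis .
  qed
  ultimately show ?thesis by blast
qed

end

section \<open>Orbits of characters of a normal abelian subgroup and the constituent bound\<close>

locale abelian_normal_subgroup = abelian_subgroup +
  assumes normal: "x \<in> G \<Longrightarrow> n \<in> N \<Longrightarrow> minv x * n * x \<in> N"
begin

lemma normalizesI: "x \<in> G \<Longrightarrow> normalizes x" using normal by (auto simp: normalizes_def)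

lemma conj_char_comp:
  assumes "x \<in> G" "y \<in> G" and eq: "conj_char N x \<mu> = conj_char N y \<mu>" and m: "\<mu> \<in> lchar N"
  shows "conj_char N (minv x * y) \<mu> = \<mu>"
proof
  fix n
  show "conj_char N (minv x * y) \<mu> n = \<mu> n"
  proof (cases "n \<in> N")
    case True
    hence nG: "n \<in> G" using NG by auto
    define n' where "n' = x * n * minv x"
    have n': "n' \<in> N" using normal[OF minv_props(1)[OF assms(1)] True] assms(1) by (simp add: n'_def minv_minv)
    have "minv (minv x * y) * n * (minv x * y) = minv y * n' * y"
      using assms nG by (simp add: n'_def minv_mult minv_minv minv_props assoc multG)
    hence "conj_char N (minv x * y) \<mu> n = conj_char N y \<mu> n'"
      using True n' by (simp add: conj_char_def)
    also have "\<dots> = conj_char N x \<mu> n'" using eq by simp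
    also have "minv x * n' * x = n"
      using assms nG by (simp add: n'_def minv_props assoc multG minv_cancel_left r_one)
    hence "conj_char N x \<mu> n' = \<mu> n" using n' by (simp add: conj_char_def)
    finally show ?thesis .
  next
    case False
    thus ?thesis using N.lcharD(3)[OF m] by (simp add: conj_char_def)
  qed
qed

text \<open>Left multiplication by the inverse of x carries the fibre of the orbit map through x
  into the stabilizer. Orbit counting thus becomes an inequality as soon as the stabilizer is
  bounded from above.\<close>

lemma card_le_orbit:
  assumes m: "\<mu> \<in> lchar N" and s: "card {x \<in> G. conj_char N x \<mu> = \<mu>} \<le> S"
  shows "card G \<le> card ((\<lambda>x. conj_char N x \<mu>) ` G) * S"
proof -
  let ?f = "\<lambda>x. conj_char N x \<mu>"
  show ?thesis
  proof (rule card_le_image_mult[OF finG])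
    fix y assume "y \<in> ?f ` G"
    then obtain x where x: "x \<in> G" "y = ?f x" by auto
    have "card {z \<in> G. ?f z = y} \<le> card {z \<in> G. conj_char N z \<mu> = \<mu>}"
    proof (rule card_inj_on_le[where f = "\<lambda>z. minv x * z"])
      show "inj_on (\<lambda>z. minv x * z) {z \<in> G. ?f z = y}"
        by (rule inj_on_inverseI[where g = "\<lambda>z. x * z"]) (use x in \<open>auto simp: minv_cancel_right\<close>)
      show "(\<lambda>z. minv x * z) ` {z \<in> G. ?f z = y} \<subseteq> {z \<in> G. conj_char N z \<mu> = \<mu>}"
        using x conj_char_comp[OF x(1) _ _ m] multG minv_props by auto
    qed (use finG in auto)
    thus "card {x \<in> G. ?f x = y} \<le> S" using s by simp
  qed
qed

text \<open>Bessel's inequality is applied to \<open>F\<close>, the sum of the orbit of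
  \<open>\<kappa>\<close> extended by zero. A class function meets all conjugates of
  \<open>\<kappa>\<close> equally often, so its inner product with \<open>F\<close> is
  \<open>card N * card Orb * e c\<close>, while \<open>F\<close> has squared norm
  \<open>card N * card Orb\<close>. What remains is \<open>card G\<close> divided by
  \<open>card N * card Orb\<close>, and orbit counting bounds this by \<open>s\<close>.\<close>

lemma sum_mult_squares_le:
  assumes l: "\<kappa> \<in> lchar N" and s: "card {x \<in> G. conj_char N x \<kappa> = \<kappa>} \<le> s * card N"
    and C: "finite C"
    and orth: "\<And>c c'. c \<in> C \<Longrightarrow> c' \<in> C \<Longrightarrow>
      (\<Sum>g\<in>G. c g * cnj (c' g)) = (if c = c' then of_nat (card G) else 0)"
    and cl: "\<And>c x n. c \<in> C \<Longrightarrow> x \<in> G \<Longrightarrow> n \<in> N \<Longrightarrow> c (minv x * n * x) = c n"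
    and e: "\<And>c. c \<in> C \<Longrightarrow> char_mult N c \<kappa> = of_nat (e c)"
  shows "(\<Sum>c\<in>C. (e c)\<^sup>2) \<le> s"
proof -
  define Orb where "Orb = (\<lambda>x. conj_char N x \<kappa>) ` G"
  define F where "F g = (\<Sum>\<mu>\<in>Orb. \<mu> g)" for g
  have Orb: "finite Orb" "Orb \<subseteq> lchar N" "Orb \<noteq> {}"
    using finG oneG conj_char_lchar[OF normalizesI l] by (auto simp: Orb_def)
  have F0: "F g = 0" if "g \<notin> N" for g
    using Orb(2) N.lcharD(3) that unfolding F_def by (intro sum.neutral) auto
  have sumN: "(\<Sum>g\<in>G. F g * h g) = (\<Sum>g\<in>N. F g * h g)" for h
    by (rule sum.mono_neutral_right) (use NG finG F0 in auto)
  let ?b = "\<lambda>c. \<Sum>g\<in>G. F g * cnj (c g)"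
  have b: "?b c = of_nat (card N * card Orb * e c)" if c: "c \<in> C" for c
  proof -
    have "cnj (?b c) = (\<Sum>g\<in>N. \<Sum>\<mu>\<in>Orb. c g * cnj (\<mu> g))"
      by (simp add: sumN) (simp add: F_def sum_distrib_left mult.commute)
    also have "\<dots> = (\<Sum>\<mu>\<in>Orb. of_nat (card N) * char_mult N c \<mu>)"
      using N.card_pos by (subst sum.swap) (simp add: char_mult_def)
    also have "\<dots> = (\<Sum>\<mu>\<in>Orb. of_nat (card N) * of_nat (e c))"
    proof (intro sum.cong refl)
      fix \<mu> assume "\<mu> \<in> Orb"
      then obtain x where "x \<in> G" "\<mu> = conj_char N x \<kappa>" by (auto simp: Orb_def)
      thus "of_nat (card N) * char_mult N c \<mu> = of_nat (card N) * of_nat (e c)"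
        using char_mult_conj[of x c \<kappa>] normalizesI[of x] cl[OF c, of x] e[OF c] by simp
    qed
    finally have "cnj (?b c) = of_nat (card N * card Orb * e c)" by (simp add: mult_ac)
    hence "cnj (cnj (?b c)) = cnj (of_nat (card N * card Orb * e c))" by (rule arg_cong)
    thus ?thesis by (simp only: complex_cnj_cnj complex_cnj_of_nat)
  qed
  have FF: "(\<Sum>g\<in>G. (cmod (F g))\<^sup>2) = real (card N * card Orb)"
  proof -
    have "of_real (\<Sum>g\<in>G. (cmod (F g))\<^sup>2) = (\<Sum>g\<in>N. F g * cnj (F g))"
      using sumN[of "\<lambda>g. cnj (F g)"] by (simp add: mult_cnj_cmod)
    also have "\<dots> = (\<Sum>g\<in>N. \<Sum>\<mu>\<in>Orb. \<Sum>\<nu>\<in>Orb. \<mu> g * cnj (\<nu> g))"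
      by (simp add: F_def sum_product)
    also have "\<dots> = (\<Sum>\<mu>\<in>Orb. \<Sum>\<nu>\<in>Orb. \<Sum>g\<in>N. \<mu> g * cnj (\<nu> g))"
      by (rule sym) (rule trans[OF sum.cong[OF refl sum.swap] sum.swap])
    also have "\<dots> = (\<Sum>\<mu>\<in>Orb. \<Sum>\<nu>\<in>Orb. if \<mu> = \<nu> then of_nat (card N) else 0)"
      using Orb(2) by (intro sum.cong refl N.lchar_orthogonality) auto
    also have "\<dots> = of_real (real (card N * card Orb))" using Orb(1) by (simp add: sum.delta mult.commute)
    finally show ?thesis using of_real_eq_iff by blast
  qed
  have "(\<Sum>c\<in>C. (cmod (?b c))\<^sup>2) \<le> real (card G) * (\<Sum>g\<in>G. (cmod (F g))\<^sup>2)"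
    using card_pos by (intro bessel_inequality[OF finG C]) (auto simp: orth)
  moreover have "(\<Sum>c\<in>C. (cmod (?b c))\<^sup>2) = (\<Sum>c\<in>C. (real (card N * card Orb * e c))\<^sup>2)"
    by (intro sum.cong refl) (simp add: b del: of_nat_mult)
  ultimately have "(\<Sum>c\<in>C. (real (card N * card Orb * e c))\<^sup>2) \<le> real (card G * (card N * card Orb))"
    using FF by simp
  also have "(\<Sum>c\<in>C. (real (card N * card Orb * e c))\<^sup>2) =
      real ((card N * card Orb) * (card N * card Orb * (\<Sum>c\<in>C. (e c)\<^sup>2)))"
    by (simp add: sum_distrib_left power2_eq_square mult_ac)
  finally have "(card N * card Orb) * (card N * card Orb * (\<Sum>c\<in>C. (e c)\<^sup>2)) \<le> (card N * card Orb) * card G"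
    by (simp only: of_nat_le_iff mult.commute)
  moreover have pos: "card N * card Orb > 0" using Orb N.card_pos by (auto simp: card_gt_0_iff)
  ultimately have "card N * card Orb * (\<Sum>c\<in>C. (e c)\<^sup>2) \<le> card G" by simp
  also have "\<dots> \<le> card Orb * (s * card N)" unfolding Orb_def by (rule card_le_orbit[OF l s])
  also have "\<dots> = card N * card Orb * s" by (simp add: mult_ac)
  finally show ?thesis using pos by simp
qed

theorem tensor_constituent:
  assumes r1: "is_rep G n1 \<rho>1" and r2: "is_rep G n2 \<rho>2" and l: "\<kappa> \<in> lchar N"
    and s: "card {x \<in> G. conj_char N x \<kappa> = \<kappa>} \<le> s * card N"
    and D: "rep_mult N (tensor_rep \<rho>1 \<rho>2) \<kappa> = of_nat D" and B: "B \<le> D" "B > 0"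
  shows "\<exists>n \<rho>. irrep G n \<rho> \<and> (\<exists>v\<in>carrier_vec n. v \<noteq> 0\<^sub>v n \<and> (\<forall>g\<in>N. \<rho> g *\<^sub>v v = \<kappa> g \<cdot>\<^sub>v v)) \<and>
    real B \<le> real s * Re (rep_inner G (tensor_rep \<rho>1 \<rho>2) \<rho>)"
proof -
  let ?\<tau> = "tensor_rep \<rho>1 \<rho>2"
  obtain L where L: "\<forall>(m, \<tau>) \<in> set L. irrep G m \<tau>"
    "\<forall>g\<in>G. mat_tr (?\<tau> g) = (\<Sum>(m, \<tau>)\<leftarrow>L. mat_tr (\<tau> g))"
    using trace_sum_irreps[OF tensor_rep_is_rep[OF r1 r2]] by blast
  \<comment> \<open>Extension by zero outside \<open>G\<close> makes equality of characters an
    equality of functions. The set \<open>C\<close> then contains each irreducible character once,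
    and \<open>count_list cs c\<close> is its multiplicity in the tensor product.\<close>
  define ch :: "nat \<times> ('a mat \<Rightarrow> complex mat) \<Rightarrow> 'a mat \<Rightarrow> complex"
    where "ch = (\<lambda>(m, \<tau>) g. if g \<in> G then mat_tr (\<tau> g) else 0)"
  define cs where "cs = map ch L"
  define C where "C = set cs"
  have irr: "\<exists>m \<tau>. irrep G m \<tau> \<and> (\<forall>g\<in>G. c g = mat_tr (\<tau> g)) \<and> (\<forall>g. g \<notin> G \<longrightarrow> c g = 0)" if "c \<in> C" for c
    using that L(1) by (fastforce simp: C_def cs_def ch_def)
  have tr: "mat_tr (?\<tau> g) = (\<Sum>c\<leftarrow>cs. c g)" if "g \<in> G" for g
    using L(2) that by (auto simp: cs_def ch_def o_def case_prod_unfold)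
  have orth: "(\<Sum>g\<in>G. c g * cnj (c' g)) = (if c = c' then of_nat (card G) else 0)" if c: "c \<in> C" "c' \<in> C" for c c'
  proof -
    obtain m \<tau> where t: "irrep G m \<tau>" "\<forall>g\<in>G. c g = mat_tr (\<tau> g)" "\<forall>g. g \<notin> G \<longrightarrow> c g = 0"
      using irr[OF c(1)] by blast
    obtain m' \<tau>' where t': "irrep G m' \<tau>'" "\<forall>g\<in>G. c' g = mat_tr (\<tau>' g)" "\<forall>g. g \<notin> G \<longrightarrow> c' g = 0"
      using irr[OF c(2)] by blast
    have "c = c' \<longleftrightarrow> (\<forall>g\<in>G. mat_tr (\<tau> g) = mat_tr (\<tau>' g))"
      using t t' by (metis ext)
    thus ?thesis using rep_inner_irreps[OF t(1) t'(1)] t(2) t'(2) card_pos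
      by (auto simp: rep_inner_def field_simps split: if_splits)
  qed
  have "\<exists>e. \<forall>c\<in>C. char_mult N c \<kappa> = of_nat (e c)"
  proof (intro bchoice ballI)
    fix c assume "c \<in> C"
    then obtain m \<tau> where t: "irrep G m \<tau>" "\<forall>g\<in>G. c g = mat_tr (\<tau> g)" using irr by blast
    have "char_mult N c \<kappa> = rep_mult N \<tau> \<kappa>"
      using t(2) NG by (auto simp: char_mult_def intro!: arg_cong2[of _ _ _ _ "(/)"] sum.cong)
    moreover obtain k where "rep_mult N \<tau> \<kappa> = of_nat k"
      using rep_lchar_list[of m \<tau>] t(1) l by (metis irrep_def)
    ultimately show "\<exists>k. char_mult N c \<kappa> = of_nat k" by auto
  qed
  then obtain e where e: "\<And>c. c \<in> C \<Longrightarrow> char_mult N c \<kappa> = of_nat (e c)" by blast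
  have cl: "c (minv x * n * x) = c n" if h: "c \<in> C" "x \<in> G" "n \<in> N" for c x n
  proof -
    obtain m \<tau> where t: "irrep G m \<tau>" "\<forall>g\<in>G. c g = mat_tr (\<tau> g)" using irr[OF h(1)] by blast
    hence "is_rep G m \<tau>" by (simp add: irrep_def)
    thus ?thesis using t trace_conj[of m \<tau> x n] h NG multG minv_props by auto
  qed
  have sq: "(\<Sum>c\<in>C. (e c)\<^sup>2) \<le> s"
    by (rule sum_mult_squares_le[OF l s _ orth cl e]) (auto simp: C_def)
  have inner: "(\<Sum>g\<in>G. mat_tr (?\<tau> g) * cnj (c g)) / of_nat (card G) = of_nat (count_list cs c)" if c: "c \<in> C" for c
  proof -
    have "(\<Sum>g\<in>G. (\<Sum>c\<leftarrow>xs. c g) * cnj (c g)) = of_nat (card G) * of_nat (count_list xs c)"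
      if "set xs \<subseteq> C" for xs
      using that by (induction xs) (auto simp: distrib_right sum.distrib orth c algebra_simps)
    from this[of cs] show ?thesis using tr card_pos by (simp add: C_def)
  qed
  have "of_nat D = (\<Sum>g\<in>N. (\<Sum>c\<leftarrow>cs. c g) * cnj (\<kappa> g)) / of_nat (card N)"
    unfolding D[symmetric] char_mult_def using tr NG
    by (intro arg_cong2[of _ _ _ _ "(/)"] sum.cong) auto
  also have "\<dots> = of_nat (\<Sum>c\<leftarrow>cs. e c)"
  proof -
    have "(\<Sum>g\<in>N. (\<Sum>c\<leftarrow>xs. c g) * cnj (\<kappa> g)) / of_nat (card N) = of_nat (\<Sum>c\<leftarrow>xs. e c)" if "set xs \<subseteq> C" for xs
      using that
    proof (induction xs)
      case (Cons a xs)
      have "(\<Sum>g\<in>N. a g * cnj (\<kappa> g)) / of_nat (card N) = of_nat (e a)" using e[of a] Cons.prems by (simp add: char_mult_def)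
      thus ?case using Cons by (simp add: distrib_right sum.distrib add_divide_distrib)
    qed auto
    thus ?thesis by (simp add: C_def)
  qed
  finally have "D = (\<Sum>c\<leftarrow>cs. e c)" using of_nat_eq_iff by blast
  hence Dsum: "D = (\<Sum>c\<in>C. count_list cs c * e c)" by (simp add: C_def sum_list_map_eq_sum_count)
  \<comment> \<open>A weighted pigeonhole: otherwise \<open>count_list cs c * s \<le> B - 1\<close>
    whenever \<open>e c > 0\<close>. As a natural number is at most its square, summing with weights
    \<open>e c\<close> gives \<open>D * s \<le> (B - 1) * s\<close>, although
    \<open>B \<le> D\<close>.\<close>
  have "\<exists>c\<in>C. e c > 0 \<and> B \<le> count_list cs c * s"
  proof (rule ccontr)
    assume neg: "\<not> ?thesis"
    \<comment> \<open>The identity stabilizes \<open>\<kappa>\<close>, so the stabilizer bounded by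
      \<open>s * card N\<close> is not empty.\<close>
    have "s > 0"
    proof -
      have "conj_char N (1\<^sub>m 2) \<kappa> = \<kappa>"
      proof
        fix n show "conj_char N (1\<^sub>m 2) \<kappa> n = \<kappa> n"
          using N.lcharD(3)[OF l, of n] minv_unique[of "1\<^sub>m 2 :: 'a mat" "1\<^sub>m 2"]
          by (cases "n \<in> N") (auto simp: conj_char_def N.l_one N.r_one)
      qed
      hence "{x \<in> G. conj_char N x \<kappa> = \<kappa>} \<noteq> {}" using oneG by blast
      hence "card {x \<in> G. conj_char N x \<kappa> = \<kappa>} > 0" using finG by (simp add: card_gt_0_iff)
      thus ?thesis using s by (cases s) auto
    qed
    have "D * s = (\<Sum>c\<in>C. count_list cs c * s * e c)"
      by (simp add: Dsum sum_distrib_left mult_ac)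
    also have "\<dots> \<le> (\<Sum>c\<in>C. (B - 1) * (e c)\<^sup>2)"
    proof (rule sum_mono)
      fix c assume c: "c \<in> C"
      show "count_list cs c * s * e c \<le> (B - 1) * (e c)\<^sup>2"
      proof (cases "e c = 0")
        case False
        hence "count_list cs c * s \<le> B - 1" using neg c by fastforce
        moreover have "e c \<le> (e c)\<^sup>2" using False by (simp add: power2_eq_square)
        ultimately show ?thesis by (rule mult_mono) auto
      qed auto
    qed
    also have "\<dots> \<le> (B - 1) * s" using sq by (simp add: sum_distrib_left[symmetric])
    finally have "D \<le> B - 1" using \<open>s > 0\<close> by simp
    thus False using B by simp
  qed
  then obtain c where c: "c \<in> C" "e c > 0" "B \<le> count_list cs c * s" by blast
  obtain m \<tau> where t: "irrep G m \<tau>" "\<forall>g\<in>G. c g = mat_tr (\<tau> g)" using irr[OF c(1)] by blast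
  have tr': "is_rep G m \<tau>" using t by (simp add: irrep_def)
  have "rep_mult N \<tau> \<kappa> = char_mult N c \<kappa>"
    using t(2) NG by (auto simp: char_mult_def intro!: arg_cong2[of _ _ _ _ "(/)"] sum.cong)
  hence "rep_mult N \<tau> \<kappa> \<noteq> 0" using e[OF c(1)] c(2) by simp
  note ev = eigenvector_of_mult[OF tr' l this]
  have "rep_inner G ?\<tau> \<tau> = of_nat (count_list cs c)"
    using inner[OF c(1)] t(2) by (simp add: rep_inner_def)
  hence "real B \<le> real s * Re (rep_inner G ?\<tau> \<tau>)"
    using c(3) by (simp add: mult.commute flip: of_nat_mult)
  thus ?thesis using t(1) ev by blast
qed

end

section \<open>Restriction and extension between two nested abelian subgroups\<close>

locale abelian_tower = M: abelian_subgroup G M + N: abelian_subgroup G N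
  for G M N :: "'a::comm_ring_1 mat set" +
  assumes NM: "N \<subseteq> M"
begin

definition res :: "('a mat \<Rightarrow> complex) \<Rightarrow> 'a mat \<Rightarrow> complex" where
  "res \<nu> g = (if g \<in> N then \<nu> g else 0)"

lemma res_lchar: "\<nu> \<in> lchar M \<Longrightarrow> res \<nu> \<in> lchar N"
  using NM N.N.multG N.N.oneG by (auto simp: lchar_def res_def subset_iff)

lemma res_eq_iff: "\<mu> \<in> lchar N \<Longrightarrow> res \<nu> = \<mu> \<longleftrightarrow> (\<forall>g\<in>N. \<nu> g = \<mu> g)"
  by (fastforce simp: lchar_def res_def fun_eq_iff)

text \<open>One list of characters of \<open>M\<close> computes both multiplicities: restricting its
  members termwise yields the list that belongs to \<open>N\<close>.\<close>

lemma mult_restrict: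
  assumes r: "is_rep G n \<rho>" and m: "\<mu> \<in> lchar N"
  shows "\<exists>L. set L \<subseteq> lchar M \<and>
    (\<forall>\<nu>\<in>lchar M. rep_mult M \<rho> \<nu> = of_nat (count_list L \<nu>)) \<and>
    rep_mult N \<rho> \<mu> = of_nat (count_list (map res L) \<mu>)"
proof -
  obtain L where L: "set L \<subseteq> lchar M" "\<forall>g\<in>M. mat_tr (\<rho> g) = (\<Sum>\<mu>\<leftarrow>L. \<mu> g)"
    "\<forall>\<mu>\<in>lchar M. rep_mult M \<rho> \<mu> = of_nat (count_list L \<mu>)"
    using M.rep_lchar_list[OF r] by blast
  have "set (map res L) \<subseteq> lchar N" using L(1) res_lchar by auto
  moreover have "\<forall>g\<in>N. mat_tr (\<rho> g) = (\<Sum>\<mu>\<leftarrow>map res L. \<mu> g)"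
    using L(2) NM by (auto simp: res_def o_def)
  ultimately have "rep_mult N \<rho> \<mu> = of_nat (count_list (map res L) \<mu>)"
    by (rule N.N.char_mult_list[OF _ m])
  thus ?thesis using L by blast
qed

text \<open>The extension is picked from the linear characters of \<open>M\<close> that make up the
  trace of \<open>\<rho>\<close>, so it occurs in \<open>\<rho>\<close> by construction.\<close>

lemma extension_exists:
  assumes r: "is_rep G n \<rho>" and m: "\<mu> \<in> lchar N" and nz: "rep_mult N \<rho> \<mu> \<noteq> 0"
  shows "\<exists>\<nu>\<in>lchar M. (\<forall>g\<in>N. \<nu> g = \<mu> g) \<and> rep_mult M \<rho> \<nu> \<noteq> 0"
proof -
  obtain L where L: "set L \<subseteq> lchar M"
    "\<forall>\<nu>\<in>lchar M. rep_mult M \<rho> \<nu> = of_nat (count_list L \<nu>)"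
    "rep_mult N \<rho> \<mu> = of_nat (count_list (map res L) \<mu>)"
    using mult_restrict[OF r m] by blast
  have "\<mu> \<in> set (map res L)" using nz L(3) count_notin[of \<mu> "map res L"] by (metis of_nat_0)
  then obtain \<nu> where n: "\<nu> \<in> set L" "res \<nu> = \<mu>" by auto
  hence "\<nu> \<in> lchar M" "count_list L \<nu> \<noteq> 0" using L(1) by (auto simp: count_list_0_iff)
  thus ?thesis using L(2) n res_eq_iff[OF m] by (intro bexI[of _ \<nu>]) auto
qed

text \<open>Distinct extensions of \<open>\<mu>\<close> occupy distinct positions in the list of
  characters of \<open>M\<close>, and each of these positions restricts to
  \<open>\<mu>\<close>.\<close>

lemma mult_ge_card:
  assumes r: "is_rep G n \<rho>" and m: "\<mu> \<in> lchar N"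
    and Q: "\<And>\<nu>. \<nu> \<in> Q \<Longrightarrow> \<nu> \<in> lchar M \<and> (\<forall>g\<in>N. \<nu> g = \<mu> g) \<and> rep_mult M \<rho> \<nu> \<noteq> 0"
  shows "\<exists>k\<ge>card Q. rep_mult N \<rho> \<mu> = of_nat k"
proof -
  obtain L where L: "set L \<subseteq> lchar M"
    "\<forall>\<nu>\<in>lchar M. rep_mult M \<rho> \<nu> = of_nat (count_list L \<nu>)"
    "rep_mult N \<rho> \<mu> = of_nat (count_list (map res L) \<mu>)"
    using mult_restrict[OF r m] by blast
  have "Q \<subseteq> set (filter (\<lambda>\<nu>. res \<nu> = \<mu>) L)"
  proof
    fix \<nu> assume n: "\<nu> \<in> Q"
    hence "count_list L \<nu> \<noteq> 0" using Q[OF n] L(2) by auto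
    hence "\<nu> \<in> set L" using count_notin by metis
    thus "\<nu> \<in> set (filter (\<lambda>\<nu>. res \<nu> = \<mu>) L)" using Q[OF n] res_eq_iff[OF m] by auto
  qed
  hence "card Q \<le> card (set (filter (\<lambda>\<nu>. res \<nu> = \<mu>) L))" by (intro card_mono) auto
  also have "\<dots> \<le> length (filter (\<lambda>\<nu>. res \<nu> = \<mu>) L)" by (rule card_length)
  also have "\<dots> = count_list (map res L) \<mu>" by (induction L) auto
  finally show ?thesis using L(3) by blast
qed

end

section \<open>Finite chain rings\<close>

text \<open>\<open>g\<close> factors through \<open>f\<close> on \<open>J\<close>. This bounds a
  number of objects from below by the number of values of an invariant that they determine.\<close>

lemma card_image_le_card_image:
  assumes "finite J" "\<And>i j. i \<in> J \<Longrightarrow> j \<in> J \<Longrightarrow> f i = f j \<Longrightarrow> g i = g j"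
  shows "card (g ` J) \<le> card (f ` J)"
proof -
  define h where "h y = g (SOME i. i \<in> J \<and> f i = y)" for y
  have "h (f i) = g i" if "i \<in> J" for i
  proof -
    have "(SOME j. j \<in> J \<and> f j = f i) \<in> J \<and> f (SOME j. j \<in> J \<and> f j = f i) = f i"
      by (rule someI[of _ i]) (use that in auto)
    thus ?thesis using assms(2)[OF _ that] unfolding h_def by blast
  qed
  hence "g ` J \<subseteq> h ` (f ` J)" by force
  thus ?thesis using assms(1) by (meson card_image_le card_mono finite_imageI le_trans)
qed

lemma even_card_fixpoint_free_involution:
  assumes "finite A" "\<And>x. x \<in> A \<Longrightarrow> f x \<in> A" "\<And>x. x \<in> A \<Longrightarrow> f (f x) = x" "\<And>x. x \<in> A \<Longrightarrow> f x \<noteq> x"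
  shows "even (card A)"
  using assms
proof (induction "card A" arbitrary: A rule: less_induct)
  case less
  show ?case
  proof (cases "A = {}")
    case False
    then obtain x where x: "x \<in> A" by auto
    define B where "B = A - {x, f x}"
    have sub: "{x, f x} \<subseteq> A" "card {x, f x} = 2" using x less.prems by (auto simp: card_insert_if dest: sym)
    hence c: "card A = card B + 2" using less.prems(1) card_Diff_subset[of "{x, f x}" A] card_mono[OF less.prems(1) sub(1)]
      by (simp add: B_def)
    have "f y \<in> B" if "y \<in> B" for y
      using that less.prems x unfolding B_def by (metis Diff_iff empty_iff insert_iff)
    hence "even (card B)" using c less.prems by (intro less.hyps) (auto simp: B_def)
    thus ?thesis using c by simp
  qed auto
qed

lemma dvd_one_iff: "(x::'a::comm_ring_1) dvd 1 \<longleftrightarrow> (\<exists>y. x * y = 1)"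
  by (auto simp: dvd_def)

lemma unit_cancel:
  fixes u :: "'a::comm_ring_1"
  assumes "u dvd 1" "u * x = u * y"
  shows "x = y"
proof -
  obtain v where "u * v = 1" using assms(1) by (auto simp: dvd_one_iff)
  hence "x = v * (u * x)" "y = v * (u * y)" by (simp_all add: mult.assoc[symmetric] mult.commute[of v])
  thus ?thesis using assms(2) by simp
qed

lemma unit_mult: "(u::'a::comm_ring_1) dvd 1 \<Longrightarrow> v dvd 1 \<Longrightarrow> u * v dvd 1"
  using mult_dvd_mono[of u 1 v 1] by simp

lemma unit_factor: "(u::'a::comm_ring_1) * v dvd 1 \<Longrightarrow> u dvd 1"
  by (rule dvd_mult_left)

section \<open>Ideals, units and additive characters of a finite chain ring\<close>

locale chain_ring =
  fixes \<pi> :: "'r::comm_ring_1" and l :: nat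
  assumes chain: "chain_ring_of_length \<pi> l" and l_ge2: "l \<ge> 2" and odd_residue: "odd (residue_card \<pi>)"
begin

abbreviation q where "q \<equiv> residue_card \<pi>"

lemma finite_ring: "finite (A :: 'r set)"
  using chain finite_subset[of A UNIV] by (auto simp: chain_ring_of_length_def)

lemma pi_pow_l: "\<pi> ^ l = 0" and pi_pow_nz: "\<pi> ^ (l - 1) \<noteq> 0" and nonunit: "\<not> x dvd 1 \<Longrightarrow> \<pi> dvd x"
  using chain by (auto simp: chain_ring_of_length_def)

lemma pi_pow_0: "k \<ge> l \<Longrightarrow> \<pi> ^ k = 0"
  using pi_pow_l by (metis le_add_diff_inverse mult_zero_left power_add)

lemma pi_pow_nonzero: "k < l \<Longrightarrow> \<pi> ^ k \<noteq> 0"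
proof
  assume k: "k < l" and z: "\<pi> ^ k = 0"
  have "\<pi> ^ (l - 1) = \<pi> ^ k * \<pi> ^ (l - 1 - k)" using k by (simp flip: power_add)
  thus False using z pi_pow_nz by simp
qed

lemma pi_nonunit: "\<not> \<pi> dvd 1"
proof
  assume "\<pi> dvd 1"
  hence "\<pi> ^ l dvd 1" using dvd_power_same[of \<pi> 1 l] by simp
  hence "(1::'r) = 0" using pi_pow_l by simp
  thus False using pi_pow_nz by (metis mult_1 mult_zero_left)
qed

lemma unit_add_pi: "u dvd 1 \<Longrightarrow> \<pi> dvd x \<Longrightarrow> u + x dvd 1"
  using nonunit[of "u + x"] pi_nonunit dvd_trans[of \<pi> u 1] dvd_add_left_iff[of \<pi> x u] by blast

lemma decompose: "x \<noteq> 0 \<Longrightarrow> \<exists>v<l. \<exists>u. u dvd 1 \<and> x = \<pi> ^ v * u"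
proof -
  assume x: "x \<noteq> 0"
  have "(\<exists>v<k. \<exists>u. u dvd 1 \<and> x = \<pi> ^ v * u) \<or> \<pi> ^ k dvd x" if "k \<le> l" for k
    using that
  proof (induction k)
    case (Suc k)
    show ?case
    proof (cases "\<pi> ^ k dvd x")
      case True
      then obtain y where y: "x = \<pi> ^ k * y" by auto
      show ?thesis
      proof (cases "y dvd 1")
        case True thus ?thesis using y by blast
      next
        case False
        then obtain z where "y = \<pi> * z" using nonunit by blast
        hence "x = \<pi> ^ Suc k * z" using y by (simp add: mult_ac)
        thus ?thesis by simp
      qed
    next
      case False thus ?thesis using Suc less_Suc_eq by (metis Suc_leD)
    qed
  qed auto
  from this[of l] show ?thesis using x pi_pow_l by auto
qed

lemma pi_mult_zero_iff:
  assumes "k \<le> l"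
  shows "\<pi> ^ k * x = 0 \<longleftrightarrow> \<pi> ^ (l - k) dvd x"
proof
  assume z: "\<pi> ^ k * x = 0"
  show "\<pi> ^ (l - k) dvd x"
  proof (cases "x = 0")
    case False
    then obtain v u where vu: "v < l" "u dvd 1" "x = \<pi> ^ v * u" using decompose by blast
    have "\<pi> ^ (k + v) * u = 0" using z vu by (simp add: power_add mult.assoc)
    hence "u * \<pi> ^ (k + v) = u * 0" by (simp add: mult.commute)
    hence "\<pi> ^ (k + v) = 0" using unit_cancel[OF vu(2)] by blast
    hence "l \<le> k + v" using pi_pow_nonzero by (meson leI)
    thus ?thesis using vu(3) by (simp add: dvd_mult2 le_imp_power_dvd)
  qed auto
next
  assume "\<pi> ^ (l - k) dvd x"
  then obtain y where "x = \<pi> ^ (l - k) * y" by auto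
  thus "\<pi> ^ k * x = 0" using assms pi_pow_l by (simp add: mult.assoc[symmetric] flip: power_add)
qed

definition pideal :: "nat \<Rightarrow> 'r set" where "pideal k = range (\<lambda>x. \<pi> ^ k * x)"

text \<open>Residue classes modulo \<open>\<pi>\<^sup>i\<close> are represented by the elements \<open>\<pi>\<close>\<open>\<^bsup>l - i\<^esup> x\<close> here and below.\<close>
lemma residue_card_eq: "q = card (pideal (l - 1))"
proof -
  have eq: "{y. \<pi> dvd y - x} = {y. \<pi> dvd y - x'} \<longleftrightarrow> \<pi> ^ (l - 1) * x = \<pi> ^ (l - 1) * x'" for x x' :: 'r
  proof -
    have "{y. \<pi> dvd y - x} = {y. \<pi> dvd y - x'} \<longleftrightarrow> \<pi> dvd x - x'"
    proof
      assume "{y. \<pi> dvd y - x} = {y. \<pi> dvd y - x'}"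
      moreover have "x \<in> {y. \<pi> dvd y - x}" by simp
      ultimately show "\<pi> dvd x - x'" by blast
    next
      assume d: "\<pi> dvd x - x'"
      have "y - x' = (y - x) + (x - x')" for y by simp
      thus "{y. \<pi> dvd y - x} = {y. \<pi> dvd y - x'}"
        using dvd_add_left_iff[OF d] by (metis (no_types, lifting))
    qed
    also have "\<dots> \<longleftrightarrow> \<pi> ^ (l - 1) * (x - x') = 0"
      using pi_mult_zero_iff[of "l - 1" "x - x'"] l_ge2 by simp
    finally show ?thesis by (simp add: right_diff_distrib)
  qed
  show ?thesis
    unfolding residue_card_def pideal_def
    by (rule antisym) (rule card_image_le_card_image, rule finite_ring, simp only: eq)+
qed

text \<open>Multiplication by \<open>\<pi> ^ (l - 1 - k)\<close> maps the ideal of level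
  \<open>k\<close> onto the minimal nonzero ideal, which has \<open>q\<close> elements, and its
  fibres are cosets of the ideal of level \<open>Suc k\<close>.\<close>

lemma card_pideal_Suc:
  assumes k: "k < l"
  shows "card (pideal k) = q * card (pideal (Suc k))"
proof -
  let ?h = "\<lambda>y. \<pi> ^ (l - 1 - k) * y"
  have pw: "?h (\<pi> ^ k * x) = \<pi> ^ (l - 1) * x" for x
    using k by (simp add: mult.assoc[symmetric] flip: power_add)
  have im: "?h ` pideal k = pideal (l - 1)"
    unfolding pideal_def image_image using pw by simp
  have fib: "card {y \<in> pideal k. ?h y = z} = card (pideal (Suc k))" if z: "z \<in> ?h ` pideal k" for z
  proof -
    obtain x0 where x0: "z = ?h (\<pi> ^ k * x0)" using z unfolding pideal_def by blast
    have "bij_betw (\<lambda>w. \<pi> ^ k * x0 + w) (pideal (Suc k)) {y \<in> pideal k. ?h y = z}"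
      unfolding bij_betw_def
    proof
      show "inj_on ((+) (\<pi> ^ k * x0)) (pideal (Suc k))" by (auto simp: inj_on_def)
      show "(+) (\<pi> ^ k * x0) ` pideal (Suc k) = {y \<in> pideal k. ?h y = z}"
      proof (intro equalityI subsetI)
        fix y assume "y \<in> (+) (\<pi> ^ k * x0) ` pideal (Suc k)"
        then obtain w where "y = \<pi> ^ k * x0 + \<pi> ^ Suc k * w" by (auto simp: pideal_def)
        hence w: "y = \<pi> ^ k * (x0 + \<pi> * w)" by (simp add: algebra_simps)
        have "\<pi> ^ (l - 1) * (\<pi> * w) = 0" using pi_pow_l l_ge2
          power_minus_mult[of l \<pi>] by (simp add: mult.assoc[symmetric])
        hence "?h y = z" unfolding w x0 pw by (simp add: algebra_simps)
        thus "y \<in> {y \<in> pideal k. ?h y = z}" using w by (auto simp: pideal_def)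
      next
        fix y assume "y \<in> {y \<in> pideal k. ?h y = z}"
        then obtain x where x: "y = \<pi> ^ k * x" "?h y = z" by (auto simp: pideal_def)
        hence "\<pi> ^ (l - 1) * (x - x0) = 0" using pw x0 by (simp add: right_diff_distrib)
        hence "\<pi> dvd x - x0" using pi_mult_zero_iff[of "l - 1"] l_ge2 by simp
        then obtain t where "x - x0 = \<pi> * t" by auto
        hence "x = x0 + \<pi> * t" by (simp add: algebra_simps)
        hence "y = \<pi> ^ k * x0 + \<pi> ^ Suc k * t" using x by (simp add: algebra_simps)
        thus "y \<in> (+) (\<pi> ^ k * x0) ` pideal (Suc k)" by (auto simp: pideal_def)
      qed
    qed
    thus ?thesis by (metis bij_betw_same_card)
  qed
  have "card (pideal k) = (\<Sum>z\<in>?h ` pideal k. card {y \<in> pideal k. ?h y = z})"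
    using sum.group[OF finite_ring finite_ring, of ?h "pideal k" "?h ` pideal k" "\<lambda>_. 1::nat"] by simp
  also have "\<dots> = card (?h ` pideal k) * card (pideal (Suc k))" using fib by simp
  finally show ?thesis using im residue_card_eq by simp
qed

lemma card_pideal: "k \<le> l \<Longrightarrow> card (pideal k) = q ^ (l - k)"
proof (induction "l - k" arbitrary: k)
  case 0
  hence "pideal k = {0}" using pi_pow_l by (auto simp: pideal_def)
  thus ?case using 0 by simp
next
  case (Suc n)
  hence "card (pideal (Suc k)) = q ^ (l - Suc k)" by (intro Suc) auto
  thus ?case using Suc card_pideal_Suc[of k] by (metis Suc_diff_Suc power_Suc zero_less_Suc zero_less_diff)
qed

lemma q_ge_3: "q \<ge> 3"
proof -
  have "{0, \<pi> ^ (l - 1)} \<subseteq> pideal (l - 1)"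
    by (auto simp: pideal_def intro: range_eqI[of _ _ 0] range_eqI[of _ _ 1])
  hence "card {0, \<pi> ^ (l - 1)} \<le> q" unfolding residue_card_eq by (intro card_mono finite_ring)
  hence "q \<ge> 2" using pi_pow_nz by simp
  thus ?thesis using odd_residue by (cases "q = 2") auto
qed

text \<open>If \<open>\<pi>\<close> divided 2, translation by \<open>\<pi> ^ (l - 1)\<close> would
  be a fixed-point free involution of a set with \<open>q\<close> elements, but \<open>q\<close> is
  odd.\<close>

lemma two_unit: "(2::'r) dvd 1"
proof (rule ccontr)
  assume "\<not> (2::'r) dvd 1"
  then obtain t where t: "(2::'r) = \<pi> * t" using nonunit by blast
  have z: "\<pi> ^ (l - 1) + \<pi> ^ (l - 1) = 0"
  proof -
    have "\<pi> ^ (l - 1) + \<pi> ^ (l - 1) = \<pi> ^ (l - 1) * 2" by simp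
    also have "\<dots> = \<pi> ^ (l - 1) * \<pi> * t" by (simp add: t mult.assoc)
    also have "\<pi> ^ (l - 1) * \<pi> = \<pi> ^ l" using l_ge2 by (intro power_minus_mult) simp
    finally show ?thesis using pi_pow_l by simp
  qed
  have "even (card (pideal (l - 1)))"
  proof (rule even_card_fixpoint_free_involution[where f = "\<lambda>y. y + \<pi> ^ (l - 1)"])
    fix y assume "y \<in> pideal (l - 1)"
    then obtain x where "y = \<pi> ^ (l - 1) * x" by (auto simp: pideal_def)
    hence "y + \<pi> ^ (l - 1) = \<pi> ^ (l - 1) * (x + 1)" by (simp add: algebra_simps)
    thus "y + \<pi> ^ (l - 1) \<in> pideal (l - 1)" by (auto simp: pideal_def)
  qed (use z pi_pow_nz finite_ring in \<open>auto simp: add.assoc\<close>)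
  thus False using odd_residue residue_card_eq by simp
qed

text \<open>A nonzero \<open>y\<close> is a unit times some power of \<open>\<pi>\<close> below
  \<open>l\<close>, so its multiples include every multiple of \<open>\<pi> ^ (l - 1)\<close>, and
  there \<open>\<psi>\<close> is nontrivial.\<close>

lemma nondegenerate:
  fixes \<psi> :: "'r \<Rightarrow> complex"
  assumes nt: "\<exists>x. \<psi> (\<pi> ^ (l - 1) * x) \<noteq> 1" and triv: "\<And>s. \<psi> (y * s) = 1"
  shows "y = 0"
proof (rule ccontr)
  assume "y \<noteq> 0"
  then obtain v u where vu: "v < l" "u dvd 1" "y = \<pi> ^ v * u" using decompose by blast
  obtain u' where u': "u * u' = 1" using vu(2) by (auto simp: dvd_one_iff)
  obtain x where x: "\<psi> (\<pi> ^ (l - 1) * x) \<noteq> 1" using nt by blast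
  have "y * (\<pi> ^ (l - 1 - v) * u' * x) = (\<pi> ^ v * \<pi> ^ (l - 1 - v)) * (u * u') * x"
    by (simp add: vu(3) mult_ac)
  also have "\<dots> = \<pi> ^ (l - 1) * x" using vu(1) u' by (simp flip: power_add)
  finally show False using triv x by metis
qed

text \<open>Of the \<open>q ^ i\<close> classes modulo \<open>\<pi> ^ i\<close>, those with c
  congruent to 0 or to 1 modulo \<open>\<pi>\<close> are discarded, \<open>q ^ (i - 1)\<close> of
  each kind. This is the origin of the factor q - 2.\<close>

lemma card_unit_classes:
  assumes ij: "i + j = l" "i \<ge> 1"
  shows "(q - 2) * q ^ (i - 1) \<le> card ((\<lambda>c. \<pi> ^ j * c) ` {c. c dvd 1 \<and> 1 - c dvd 1})"
proof -
  let ?U = "(\<lambda>c. \<pi> ^ j * c) ` {c. c dvd 1 \<and> 1 - c dvd 1}"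
  have "pideal j \<subseteq> ?U \<union> (pideal (Suc j) \<union> (+) (\<pi> ^ j) ` pideal (Suc j))"
  proof
    fix y assume "y \<in> pideal j"
    then obtain c where c: "y = \<pi> ^ j * c" by (auto simp: pideal_def)
    consider "c dvd 1" "1 - c dvd 1" | x where "c = \<pi> * x" | x where "1 - c = \<pi> * x"
      using nonunit by (metis dvdE)
    thus "y \<in> ?U \<union> (pideal (Suc j) \<union> (+) (\<pi> ^ j) ` pideal (Suc j))"
    proof cases
      case 2
      hence "y = \<pi> ^ Suc j * x" using c by (simp add: mult_ac)
      thus ?thesis by (auto simp: pideal_def)
    next
      case 3
      have "c = 1 - (1 - c)" by simp
      hence "c = 1 - \<pi> * x" unfolding 3 .
      hence "y = \<pi> ^ j * (1 - \<pi> * x)" using c by simp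
      hence y: "y = \<pi> ^ j + \<pi> ^ Suc j * (- x)" by (simp add: algebra_simps)
      have "\<pi> ^ Suc j * (- x) \<in> pideal (Suc j)" unfolding pideal_def by (rule rangeI)
      thus ?thesis unfolding y by blast
    qed (use c in auto)
  qed
  hence "card (pideal j) \<le> card (?U \<union> (pideal (Suc j) \<union> (+) (\<pi> ^ j) ` pideal (Suc j)))"
    by (intro card_mono finite_ring)
  also have "\<dots> \<le> card ?U + (card (pideal (Suc j)) + card ((+) (\<pi> ^ j) ` pideal (Suc j)))"
    by (meson add_left_mono card_Un_le le_trans)
  also have "card ((+) (\<pi> ^ j) ` pideal (Suc j)) = card (pideal (Suc j))"
    by (intro card_image) auto
  also have "card (pideal (Suc j)) = q ^ (i - 1)" 
  proof -
    have "Suc j \<le> l" "l - Suc j = i - 1" using ij by auto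
    thus ?thesis using card_pideal[of "Suc j"] by simp
  qed
  also have "card (pideal j) = q ^ i"
  proof -
    have "j \<le> l" "l - j = i" using ij by auto
    thus ?thesis using card_pideal[of j] by simp
  qed
  also have "q ^ i = q * q ^ (i - 1)" using ij by (metis One_nat_def Suc_pred less_eq_Suc_le power_Suc)
  finally show ?thesis by (simp add: algebra_simps)
qed

end

section \<open>Squares and norms of units\<close>

context chain_ring
begin

lemma zero_nonunit: "\<not> (0::'r) dvd 1"
  using pi_nonunit pi_pow_0[of l] by (metis dvd_0_left_iff dvd_0_right)

text \<open>A counting substitute for Hensel's lemma: squaring is injective on the finite set of
  elements congruent to 1, because \<open>z + w\<close> is 2 plus a multiple of \<open>\<pi>\<close>
  and hence a unit. It is therefore surjective.\<close>

lemma one_plus_pi_square: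
  assumes x: "\<pi> dvd x"
  shows "\<exists>y. y * y = 1 + x"
proof -
  define A where "A = {z. \<pi> dvd z - 1}"
  have "inj_on (\<lambda>z. z * z) A"
  proof (rule inj_onI)
    fix z w assume zw: "z \<in> A" "w \<in> A" "z * z = w * w"
    have "2 + ((z - 1) + (w - 1)) dvd 1" using zw by (intro unit_add_pi two_unit dvd_add) (auto simp: A_def)
    hence u: "z + w dvd 1" by simp
    have "(z + w) * z = (z + w) * w" using zw(3) by (simp add: algebra_simps)
    thus "z = w" using unit_cancel[OF u] by blast
  qed
  moreover have "(\<lambda>z. z * z) ` A \<subseteq> A"
  proof
    fix y assume "y \<in> (\<lambda>z. z * z) ` A"
    then obtain z where z: "\<pi> dvd z - 1" "y = z * z" by (auto simp: A_def)
    have "y - 1 = (z - 1) * (z + 1)" using z by (simp add: algebra_simps)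
    thus "y \<in> A" using z(1) by (simp add: A_def dvd_mult2)
  qed
  ultimately have "(\<lambda>z. z * z) ` A = A" by (intro endo_inj_surj finite_ring)
  moreover have "1 + x \<in> A" using x by (simp add: A_def)
  ultimately have "1 + x \<in> (\<lambda>z. z * z) ` A" by simp
  thus ?thesis by (auto dest: sym)
qed

text \<open>A unit has at most two square roots, so the squares \<open>S\<close> fill at least half
  of the units. If a b were not a square, then \<open>S\<close>, a times \<open>S\<close> and the
  single element b would be disjoint sets of units, one element too many.\<close>

lemma nonsquare_mult:
  fixes a b :: 'r
  assumes a: "a dvd 1" "\<nexists>x. x * x = a" and b: "b dvd 1" "\<nexists>x. x * x = b"
  shows "\<exists>x. x * x = a * b"
proof (rule ccontr)
  assume ab: "\<nexists>x. x * x = a * b"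
  define U where "U = {u::'r. u dvd 1}"
  define S where "S = (\<lambda>x. x * x) ` U"
  have "card U \<le> card S * 2"
    unfolding S_def
  proof (rule card_le_image_mult[OF finite_ring])
    fix y assume "y \<in> (\<lambda>x. x * x) ` U"
    then obtain z where z: "z dvd 1" "y = z * z" by (auto simp: U_def)
    have "{x \<in> U. x * x = y} \<subseteq> {z, - z}"
    proof
      fix x assume "x \<in> {x \<in> U. x * x = y}"
      hence xz: "x * x = z * z" using z by simp
      show "x \<in> {z, - z}"
      \<comment> \<open>\<open>x - z\<close> and \<open>x + z\<close> differ by the unit 2 z, so one
        of them is a unit and can be cancelled from their product, which is 0.\<close>
      proof (cases "x - z dvd 1")
        case True
        have "(x - z) * (x + z) = (x - z) * 0" using xz by (simp add: algebra_simps)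
        hence "x + z = 0" using unit_cancel[OF True] by blast
        thus ?thesis by (simp add: eq_neg_iff_add_eq_0)
      next
        case False
        have "2 * z + (x - z) dvd 1" using nonunit[OF False] unit_mult[OF two_unit z(1)] by (intro unit_add_pi)
        moreover have "2 * z + (x - z) = x + z" by (simp add: algebra_simps)
        ultimately have u: "x + z dvd 1" by simp
        have "(x + z) * x = (x + z) * z" using xz by (simp add: algebra_simps)
        thus ?thesis using unit_cancel[OF u] by blast
      qed
    qed
    hence "card {x \<in> U. x * x = y} \<le> card {z, - z}" by (intro card_mono) auto
    also have "\<dots> \<le> 2" by (simp add: card_insert_if)
    finally show "card {x \<in> U. x * x = y} \<le> 2" .
  qed
  moreover have "card (S \<union> (*) a ` S \<union> {b}) \<le> card U"
    using a b by (intro card_mono finite_ring) (auto simp: S_def U_def intro: unit_mult)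
  moreover have "card (S \<union> (*) a ` S \<union> {b}) = card S * 2 + 1"
  proof -
    have "b \<notin> S" using b(2) by (auto simp: S_def)
    moreover have "b \<notin> (*) a ` S"
    proof
      assume "b \<in> (*) a ` S"
      then obtain x where "b = a * (x * x)" by (auto simp: S_def)
      hence "(a * x) * (a * x) = a * b" by (simp add: mult_ac)
      thus False using ab by blast
    qed
    moreover have "S \<inter> (*) a ` S = {}"
    proof (rule ccontr)
      assume "S \<inter> (*) a ` S \<noteq> {}"
      then obtain x y where xy: "x dvd 1" "y dvd 1" "x * x = a * (y * y)" by (auto simp: S_def U_def)
      obtain v where v: "y * v = 1" using xy(2) by (auto simp: dvd_one_iff)
      have "(x * v) * (x * v) = (x * x) * (v * v)" by (simp add: mult_ac)
      also have "\<dots> = a * ((y * v) * (y * v))" unfolding xy(3) by (simp add: mult_ac)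
      finally show False using a(2) v by auto
    qed
    moreover have "card ((*) a ` S) = card S"
      by (intro card_image inj_onI) (rule unit_cancel[OF a(1)])
    ultimately show ?thesis by (simp add: card_Un_disjoint finite_ring)
  qed
  ultimately show False by simp
qed

text \<open>
  Otherwise -d is a square and every unit that is a sum of two squares is a square, hence so is every
  natural number below the least non-unit n; but n - 1 and -1 differ by a square factor.
\<close>
lemma nonsquare_norm_exists:
  fixes d :: 'r
  assumes d: "d dvd 1" "\<nexists>x. x * x = d"
  shows "\<exists>x y. x * x - d * (y * y) dvd 1 \<and> (\<nexists>z. z * z = x * x - d * (y * y))"
proof (rule ccontr)
  assume "\<not> ?thesis"
  hence H: "\<exists>z. z * z = x * x - d * (y * y)" if "x * x - d * (y * y) dvd 1" for x y :: 'r using that by blast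
  obtain e where e: "e * e = - d" using H[of 0 1] d(1) by auto
  have "e * e dvd 1" unfolding e using d(1) by simp
  hence "e dvd 1" by (rule unit_factor)
  then obtain v where v: "e * v = 1" by (auto simp: dvd_one_iff)
  have H': "\<exists>z. z * z = x * x + w * w" if u: "x * x + w * w dvd 1" for x w :: 'r
  proof -
    have "x * x - d * ((v * w) * (v * w)) = x * x + (e * e) * ((v * w) * (v * w))" unfolding e by simp
    also have "\<dots> = x * x + (e * v) * (e * v) * (w * w)" by (simp add: mult_ac)
    finally have eq: "x * x - d * ((v * w) * (v * w)) = x * x + w * w" by (simp add: v)
    show ?thesis by (rule H[of x "v * w", unfolded eq, OF u])
  qed
  have neg1: "\<nexists>f::'r. f * f = - 1"
  proof
    assume "\<exists>f::'r. f * f = - 1"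
    then obtain f :: 'r where f: "f * f = - 1" by blast
    have "(f * e) * (f * e) = (f * f) * (e * e)" by (simp add: mult_ac)
    thus False using d(2) unfolding f e by auto
  qed
  have sq: "(\<And>k. 1 \<le> k \<Longrightarrow> k \<le> n \<Longrightarrow> of_nat k dvd (1::'r)) \<Longrightarrow> 1 \<le> n \<Longrightarrow> \<exists>z::'r. z * z = of_nat n" for n
  proof (induction n)
    case (Suc n)
    show ?case
    proof (cases "n = 0")
      case True thus ?thesis by (intro exI[of _ 1]) simp
    next
      case False
      then obtain z :: 'r where z: "z * z = of_nat n" using Suc by (metis Suc_leI le_SucI not_gr_zero One_nat_def)
      have eq: "of_nat (Suc n) = z * z + 1 * 1" by (simp add: z add.commute)
      have "of_nat (Suc n) dvd (1::'r)" by (rule Suc.prems(1)) auto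
      hence "z * z + 1 * 1 dvd 1" unfolding eq .
      from H'[OF this] show ?thesis unfolding eq .
    qed
  qed simp
  have "\<exists>n\<ge>1. \<not> of_nat n dvd (1::'r)"
  proof -
    have "\<not> inj (of_nat :: nat \<Rightarrow> 'r)" using finite_ring[of UNIV] finite_imageD[of "of_nat :: nat \<Rightarrow> 'r" UNIV]
        finite_ring[of "range of_nat"] infinite_UNIV_nat by blast
    then obtain m n where mn: "(of_nat m :: 'r) = of_nat n" "m < n"
      unfolding inj_def by (metis linorder_neqE_nat)
    hence "of_nat (n - m) = (0::'r)" by (simp add: of_nat_diff)
    thus ?thesis using mn zero_nonunit by (intro exI[of _ "n - m"]) auto
  qed
  then obtain n where n: "n \<ge> 1" "\<not> of_nat n dvd (1::'r)" "\<And>k. k < n \<Longrightarrow> \<not> (k \<ge> 1 \<and> \<not> of_nat k dvd (1::'r))"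
    using exists_least_iff[of "\<lambda>n. n \<ge> 1 \<and> \<not> of_nat n dvd (1::'r)"] by blast
  have "n \<noteq> 1" using n(2) by auto
  hence n2: "n \<ge> 2" using n(1) by simp
  obtain z :: 'r where z: "z * z = of_nat (n - 1)"
    using sq[of "n - 1"] n n2 by force
  have zu: "z dvd 1"
  proof -
    have "of_nat (n - 1) dvd (1::'r)" using n(3)[of "n - 1"] n2 by auto
    thus ?thesis using z unit_factor[of z z] by simp
  qed
  have zz: "- (z * z) = 1 + (- of_nat n)" unfolding z using n2 by (simp add: of_nat_diff)
  have "\<pi> dvd - of_nat n" using nonunit[OF n(2)] by simp
  then obtain y where y: "y * y = - (z * z)" using one_plus_pi_square zz by metis
  obtain w where w: "z * w = 1" using zu by (auto simp: dvd_one_iff)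
  have "(y * w) * (y * w) = (y * y) * (w * w)" by (simp add: mult_ac)
  also have "\<dots> = - ((z * w) * (z * w))" unfolding y by (simp add: mult_ac)
  finally show False using neg1 w by auto
qed

text \<open>The form represents squares with y = 0, and also some nonsquare unit n. For a nonsquare
  c the product c n is a square, say of s, and scaling the representation of n by s divided by n
  represents c.\<close>

lemma unit_norm:
  fixes c d :: 'r
  assumes d: "d dvd 1" "\<nexists>x. x * x = d" and c: "c dvd 1"
  shows "\<exists>x y. x * x - d * (y * y) = c"
proof (cases "\<exists>s. s * s = c")
  case True
  then obtain s where "s * s = c" by blast
  thus ?thesis by (intro exI[of _ s] exI[of _ 0]) simp
next
  case False
  obtain x y where xy: "x * x - d * (y * y) dvd 1" "\<nexists>z. z * z = x * x - d * (y * y)"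
    using nonsquare_norm_exists[OF d] by blast
  define n where "n = x * x - d * (y * y)"
  obtain s where s: "s * s = c * n" using nonsquare_mult[OF c False, of n] xy unfolding n_def by blast
  obtain v where v: "n * v = 1" using xy(1) by (auto simp: n_def dvd_one_iff)
  have "(s * v * x) * (s * v * x) - d * ((s * v * y) * (s * v * y)) = (s * s) * (v * v) * n"
    by (simp add: n_def algebra_simps)
  also have "\<dots> = c * ((n * v) * (n * v))" unfolding s by (simp add: mult_ac)
  finally show ?thesis using v by auto
qed

end

section \<open>Two-by-two matrix groups\<close>

definition mat2 :: "'a \<Rightarrow> 'a \<Rightarrow> 'a \<Rightarrow> 'a \<Rightarrow> 'a::comm_ring_1 mat" where
  "mat2 a b c d = mat 2 2 (\<lambda>(i, j). if i = 0 then (if j = 0 then a else b) else (if j = 0 then c else d))"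

lemma mat2_carrier [simp]: "mat2 a b c d \<in> carrier_mat 2 2" by (simp add: mat2_def)

lemma mat2_index [simp]:
  "mat2 a b c d $$ (0, 0) = a" "mat2 a b c d $$ (0, Suc 0) = b"
  "mat2 a b c d $$ (Suc 0, 0) = c" "mat2 a b c d $$ (Suc 0, Suc 0) = d"
  by (simp_all add: mat2_def)

lemma mat2_dim [simp]: "dim_row (mat2 a b c d) = 2" "dim_col (mat2 a b c d) = 2" by (simp_all add: mat2_def)

lemma mat2_eqI:
  assumes "A \<in> carrier_mat 2 2" "B \<in> carrier_mat 2 2"
    "A $$ (0, 0) = B $$ (0, 0)" "A $$ (0, Suc 0) = B $$ (0, Suc 0)"
    "A $$ (Suc 0, 0) = B $$ (Suc 0, 0)" "A $$ (Suc 0, Suc 0) = B $$ (Suc 0, Suc 0)"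
  shows "A = B"
  using assms by (intro eq_matI) (auto simp: less_2_cases_iff)

lemma mat2_eta: "A \<in> carrier_mat 2 2 \<Longrightarrow>
    mat2 (A $$ (0, 0)) (A $$ (0, Suc 0)) (A $$ (Suc 0, 0)) (A $$ (Suc 0, Suc 0)) = A"
  by (rule mat2_eqI) auto

lemma mat2_cases:
  assumes "A \<in> carrier_mat 2 2"
  obtains a b c d where "A = mat2 a b c d"
  using mat2_eta[OF assms] by metis

lemma mat2_eq_iff [simp]: "mat2 a b c d = mat2 a' b' c' d' \<longleftrightarrow> a = a' \<and> b = b' \<and> c = c' \<and> d = d'"
  by (metis mat2_index)

lemma mat2_mult [simp]:
  "mat2 a b c d * mat2 a' b' c' d' = mat2 (a * a' + b * c') (a * b' + b * d') (c * a' + d * c') (c * b' + d * d')"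
  by (rule mat2_eqI) (auto simp: scalar_prod_def numeral_2_eq_2)

lemma mat2_one: "1\<^sub>m 2 = mat2 1 0 0 1"
  by (rule mat2_eqI) auto

lemma minv_mat2:
  assumes "(a * d - b * c) * e = 1"
  shows "minv (mat2 a b c d) = mat2 (e * d) (- (e * b)) (- (e * c)) (e * a)"
  using assms by (intro minv_unique) (auto simp: mat2_one algebra_simps)

lemma (in mat_group) det_unit:
  assumes "mat2 a b c d \<in> G"
  shows "\<exists>e. (a * d - b * c) * e = 1"
proof -
  obtain h where h: "h \<in> G" "mat2 a b c d * h = 1\<^sub>m 2" using invG[OF assms] by blast
  obtain a' b' c' d' where h': "h = mat2 a' b' c' d'" using mat2_cases[OF carr[OF h(1)]] .
  have "a * a' + b * c' = 1" "a * b' + b * d' = 0" "c * a' + d * c' = 0" "c * b' + d * d' = 1"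
    using h(2) unfolding h' by (auto simp: mat2_one)
  moreover have "(a * d - b * c) * (a' * d' - b' * c') =
      (a * a' + b * c') * (c * b' + d * d') - (a * b' + b * d') * (c * a' + d * c')"
    by (simp add: algebra_simps)
  ultimately show ?thesis by (metis mult_zero_left diff_zero mult_1)
qed

text \<open>
  For the general linear group \<open>\<iota>\<close> is the identity and \<open>\<epsilon> = d0 = 1\<close>; for the unitary group \<open>\<iota>\<close> is the
  embedding into the quadratic extension, \<open>\<epsilon> = \<theta>\<close> and \<open>d0 = \<theta>\<^sup>2\<close>. The last assumption says that all ratios
  of a, d, \<open>\<epsilon> b\<close>, \<open>\<epsilon> c\<close> lie in the small ring.
\<close>
locale rank2_setup = chain_ring \<pi> l + mat_group G
  for \<pi> :: "'r::comm_ring_1" and l :: nat and G :: "'a::comm_ring_1 mat set" +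
  fixes \<iota> :: "'r \<Rightarrow> 'a" and \<epsilon> :: 'a and d0 :: 'r and \<psi> :: "'a \<Rightarrow> complex"
  assumes hom_add: "\<iota> (x + y) = \<iota> x + \<iota> y"
    and hom_mult: "\<iota> (x * y) = \<iota> x * \<iota> y"
    and hom_one: "\<iota> 1 = 1"
    and eps_sq: "\<epsilon> * \<epsilon> = \<iota> d0" and d0_unit: "d0 dvd 1"
    and psi_char: "add_char \<psi>" and psi_nontriv: "\<exists>x. \<psi> (\<iota> (\<pi> ^ (l - 1) * x)) \<noteq> 1"
    and G_diag: "r dvd 1 \<Longrightarrow> \<exists>t. t dvd 1 \<and> mat2 t 0 0 (t * \<iota> r) \<in> G"
    and G_upper: "mat2 1 (\<epsilon> * \<iota> s) 0 1 \<in> G"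
    and G_torus: "u * u' = 1 \<Longrightarrow> mat2 (\<iota> u) 0 0 (\<iota> u') \<in> G"
    and G_lines: "mat2 a b c d \<in> G \<Longrightarrow> \<exists>m1 m2 m3 m4. d * d = (a * d - b * c) * \<iota> m1 \<and>
      a * d = (a * d - b * c) * \<iota> m2 \<and> \<epsilon> * b * d = (a * d - b * c) * \<iota> m3 \<and>
      \<epsilon> * c * d = (a * d - b * c) * \<iota> m4"
begin

section \<open>The congruence subgroups and conjugation on them\<close>

abbreviation l1 where "l1 \<equiv> l div 2"
abbreviation l2 where "l2 \<equiv> l - l div 2"
abbreviation P :: "nat \<Rightarrow> 'a" where "P k \<equiv> \<iota> (\<pi> ^ k)"

lemma hom_zero: "\<iota> 0 = 0" using hom_add[of 0 0] by simp
lemma hom_neg: "\<iota> (- x) = - \<iota> x"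
  using hom_add[of x "- x"] by (simp add: hom_zero eq_neg_iff_add_eq_0 add.commute)
lemma hom_diff: "\<iota> (x - y) = \<iota> x - \<iota> y" using hom_add[of x "- y"] by (simp add: hom_neg)

lemmas hom = hom_add hom_mult hom_one hom_zero hom_neg hom_diff

lemma hom_unit: "u dvd 1 \<Longrightarrow> \<iota> u dvd 1"
  by (metis dvd_one_iff hom_mult hom_one)

lemma eps_unit: "\<epsilon> dvd 1"
  using hom_unit[OF d0_unit] unit_factor[of \<epsilon> \<epsilon>] by (simp add: eps_sq)

lemma psi_add: "\<psi> (x + y) = \<psi> x * \<psi> y" and psi_zero: "\<psi> 0 = 1"
  using psi_char by (auto simp: add_char_def)

lemma psi_diff:
  assumes "\<psi> x = \<psi> y" shows "\<psi> (x - y) = 1"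
proof -
  have "\<psi> (x - y) * \<psi> y = \<psi> y" using psi_add[of "x - y" y] assms by simp
  moreover have "\<psi> y * \<psi> (- y) = 1" using psi_add[of y "- y"] psi_zero by simp
  hence "\<psi> y \<noteq> 0" by auto
  ultimately show ?thesis by simp
qed

lemma psi_nondegenerate: "(\<And>s. \<psi> (\<iota> (y * s)) = 1) \<Longrightarrow> y = 0"
  using nondegenerate[of "\<lambda>x. \<psi> (\<iota> x)" y] psi_nontriv by blast

lemma l1_pos: "l1 \<ge> 1" and l12: "l1 + l2 = l" and l1_le: "l1 \<le> l2" and l2_le: "l2 \<le> 2 * l1"
  using l_ge2 by auto

lemma P_dvd: "i \<le> j \<Longrightarrow> P i dvd P j"
  by (metis dvd_def hom_mult le_Suc_ex power_add)

lemma P_zero: "P i dvd x \<Longrightarrow> P j dvd y \<Longrightarrow> l \<le> i + j \<Longrightarrow> x * y = 0"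
proof -
  assume "P i dvd x" "P j dvd y" and ij: "l \<le> i + j"
  then obtain x' y' where "x = P i * x'" "y = P j * y'" by (auto simp: dvd_def)
  hence "x * y = \<iota> (\<pi> ^ (i + j)) * (x' * y')" by (simp add: power_add hom mult_ac)
  thus ?thesis using pi_pow_0[OF ij] by (simp add: hom)
qed

text \<open>\<open>Ngrp l2\<close> is the group N of the overview. The level of the condition on the
  diagonal is a parameter because \<open>Ngrp l1\<close> is the larger abelian group in which the
  multiplicities for odd l are found.\<close>

definition Ngrp :: "nat \<Rightarrow> 'a mat set" where
  "Ngrp i = {g \<in> G. P l2 dvd g $$ (0, Suc 0) \<and> P l2 dvd g $$ (Suc 0, 0) \<and>
     P i dvd g $$ (0, 0) - g $$ (Suc 0, Suc 0)}"

text \<open>The congruence subgroup of level \<open>l2\<close>, described by its entries;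
  \<open>Kgrp_form\<close> and \<open>Kgrp_form_ex\<close> relate it to matrices of the form 1 plus
  a multiple of the \<open>l2\<close>-th power of \<open>\<pi>\<close>.\<close>

definition Kgrp :: "'a mat set" where
  "Kgrp = {g \<in> G. P l2 dvd g $$ (0, Suc 0) \<and> P l2 dvd g $$ (Suc 0, 0) \<and>
     P l2 dvd g $$ (0, 0) - 1 \<and> P l2 dvd g $$ (Suc 0, Suc 0) - 1}"

lemma Ngrp_iff: "mat2 a b c d \<in> Ngrp i \<longleftrightarrow> mat2 a b c d \<in> G \<and> P l2 dvd b \<and> P l2 dvd c \<and> P i dvd a - d"
  by (simp add: Ngrp_def)

lemma Kgrp_iff: "mat2 a b c d \<in> Kgrp \<longleftrightarrow>
    mat2 a b c d \<in> G \<and> P l2 dvd b \<and> P l2 dvd c \<and> P l2 dvd a - 1 \<and> P l2 dvd d - 1"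
  by (simp add: Kgrp_def)

lemma G_cases:
  assumes "g \<in> G"
  obtains a b c d e where "g = mat2 a b c d" "(a * d - b * c) * e = 1"
proof -
  obtain a b c d where "g = mat2 a b c d" using mat2_cases[OF carr[OF assms]] .
  thus ?thesis using det_unit assms that by blast
qed

lemma Ngrp_sub: "Ngrp i \<subseteq> G" and Kgrp_sub: "Kgrp \<subseteq> G" by (auto simp: Ngrp_def Kgrp_def)

lemma Ngrp_group:
  assumes i: "i \<le> l2"
  shows "mat_group (Ngrp i)"
proof
  show "finite (Ngrp i)" using finG Ngrp_sub finite_subset by blast
  show "Ngrp i \<subseteq> carrier_mat 2 2" using carrG Ngrp_sub by blast
  show "1\<^sub>m 2 \<in> Ngrp i" using oneG by (simp add: mat2_one Ngrp_iff)
next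
  fix g h assume gh: "g \<in> Ngrp i" "h \<in> Ngrp i"
  have G: "g \<in> G" "h \<in> G" using gh Ngrp_sub by auto
  obtain a b c d where g: "g = mat2 a b c d" using mat2_cases[OF carr[OF G(1)]] .
  obtain a' b' c' d' where h: "h = mat2 a' b' c' d'" using mat2_cases[OF carr[OF G(2)]] .
  have dv: "P l2 dvd b" "P l2 dvd c" "P i dvd a - d" "P l2 dvd b'" "P l2 dvd c'" "P i dvd a' - d'"
    using gh unfolding g h Ngrp_iff by auto
  have bc: "P i dvd b" "P i dvd c" using dv P_dvd[OF i] dvd_trans by blast+
  have eq: "a * a' + b * c' - (c * b' + d * d') = a * (a' - d') + (a - d) * d' + b * c' - c * b'"
    by (simp add: algebra_simps)
  have "P i dvd a * a' + b * c' - (c * b' + d * d')"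
    unfolding eq using dv bc by (simp add: dvd_mult dvd_mult2)
  thus "g * h \<in> Ngrp i" using multG[OF G] dv unfolding g h mat2_mult Ngrp_iff by (simp add: dvd_mult dvd_mult2)
next
  fix g assume g: "g \<in> Ngrp i"
  hence G: "g \<in> G" using Ngrp_sub by auto
  obtain a b c d e where gm: "g = mat2 a b c d" and e: "(a * d - b * c) * e = 1" using G_cases[OF G] .
  have "minv g = mat2 (e * d) (- (e * b)) (- (e * c)) (e * a)" unfolding gm by (rule minv_mat2[OF e])
  moreover have "e * d - e * a = (- e) * (a - d)" by (simp add: algebra_simps)
  ultimately have "minv g \<in> Ngrp i" using minv_props(1)[OF G] g unfolding gm Ngrp_iff
    by (simp add: dvd_mult Ngrp_iff)
  thus "\<exists>h\<in>Ngrp i. g * h = 1\<^sub>m 2 \<and> h * g = 1\<^sub>m 2" using minv_props[OF G] by blast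
qed

text \<open>The entries of g h - h g are combinations of products such as b c' and b (a' - d'). They
  are divisible by the power of \<open>\<pi>\<close> with exponent l2 + l2 or l2 + i, and both
  exponents are at least l1 + l2 = l.\<close>

lemma Ngrp_commute:
  assumes i: "l1 \<le> i" and gh: "g \<in> Ngrp i" "h \<in> Ngrp i"
  shows "g * h = h * g"
proof -
  have G: "g \<in> G" "h \<in> G" using gh Ngrp_sub by auto
  obtain a b c d where g: "g = mat2 a b c d" using mat2_cases[OF carr[OF G(1)]] .
  obtain a' b' c' d' where h: "h = mat2 a' b' c' d'" using mat2_cases[OF carr[OF G(2)]] .
  have dv: "P l2 dvd b" "P l2 dvd c" "P i dvd a - d" "P l2 dvd b'" "P l2 dvd c'" "P i dvd a' - d'"
    using gh unfolding g h Ngrp_iff by auto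
  have li: "l \<le> l2 + i" "l \<le> l2 + l2" using i by auto
  have z: "b * c' = 0" "b' * c = 0" "b' * (a - d) = 0" "b * (a' - d') = 0" "c' * (a - d) = 0" "c * (a' - d') = 0"
    using P_zero[OF _ _ li(1)] P_zero[OF _ _ li(2)] dv by blast+
  have "a * b' + b * d' = a' * b + b' * d + (b' * (a - d) - b * (a' - d'))"
    "c * a' + d * c' = c' * a + d' * c + (c * (a' - d') - c' * (a - d))"
    by (simp_all add: algebra_simps)
  thus ?thesis unfolding g h using z by (simp add: mult.commute)
qed

lemma conj_entries:
  assumes e: "(\<alpha> * \<delta> - \<beta> * \<gamma>) * e = 1"
  shows "minv (mat2 \<alpha> \<beta> \<gamma> \<delta>) * mat2 a b c d * mat2 \<alpha> \<beta> \<gamma> \<delta> =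
    mat2 (a + e * (b * \<gamma> * \<delta> - c * \<alpha> * \<beta> + \<beta> * \<gamma> * (a - d))) (e * (\<delta> * \<beta> * (a - d) + b * \<delta> * \<delta> - c * \<beta> * \<beta>))
      (e * (- (\<alpha> * \<gamma> * (a - d)) - b * \<gamma> * \<gamma> + c * \<alpha> * \<alpha>)) (d - e * (b * \<gamma> * \<delta> - c * \<alpha> * \<beta> + \<beta> * \<gamma> * (a - d)))"
proof -
  \<comment> \<open>The factor \<open>(\<alpha> * \<delta> - \<beta> * \<gamma>) * e\<close>, which
    equals 1, is inserted so that both sides agree as polynomials.\<close>
  have "minv (mat2 \<alpha> \<beta> \<gamma> \<delta>) * mat2 a b c d * mat2 \<alpha> \<beta> \<gamma> \<delta> =
    mat2 (a * ((\<alpha> * \<delta> - \<beta> * \<gamma>) * e) + e * (b * \<gamma> * \<delta> - c * \<alpha> * \<beta> + \<beta> * \<gamma> * (a - d))) (e * (\<delta> * \<beta> * (a - d) + b * \<delta> * \<delta> - c * \<beta> * \<beta>))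
      (e * (- (\<alpha> * \<gamma> * (a - d)) - b * \<gamma> * \<gamma> + c * \<alpha> * \<alpha>)) (d * ((\<alpha> * \<delta> - \<beta> * \<gamma>) * e) - e * (b * \<gamma> * \<delta> - c * \<alpha> * \<beta> + \<beta> * \<gamma> * (a - d)))"
    unfolding minv_mat2[OF e] mat2_mult mat2_eq_iff by (simp add: algebra_simps)
  thus ?thesis unfolding e by simp
qed

text \<open>Conjugation by a general matrix puts multiples of a - d into the off-diagonal entries;
  these stay divisible because the diagonal and off-diagonal conditions have the same level
  \<open>l2\<close>.\<close>

lemma Ngrp_normal:
  assumes x: "x \<in> G" and n: "n \<in> Ngrp l2"
  shows "minv x * n * x \<in> Ngrp l2"
proof -
  obtain \<alpha> \<beta> \<gamma> \<delta> e where xm: "x = mat2 \<alpha> \<beta> \<gamma> \<delta>" and e: "(\<alpha> * \<delta> - \<beta> * \<gamma>) * e = 1" using G_cases[OF x] .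
  have nG: "n \<in> G" using n Ngrp_sub by auto
  obtain a b c d where nm: "n = mat2 a b c d" using mat2_cases[OF carr[OF nG]] .
  have dv: "P l2 dvd b" "P l2 dvd c" "P l2 dvd a - d" using n unfolding nm Ngrp_iff by auto
  define f where "f = e * (b * \<gamma> * \<delta> - c * \<alpha> * \<beta> + \<beta> * \<gamma> * (a - d))"
  have f: "P l2 dvd f" unfolding f_def using dv by (simp add: dvd_mult dvd_mult2)
  have "a + f - (d - f) = (a - d) + f + f" by simp
  hence "P l2 dvd a + f - (d - f)" using dv f by (metis dvd_add)
  moreover have "minv x * n * x \<in> G" by (intro multG minv_props(1) x nG)
  ultimately show ?thesis unfolding xm nm conj_entries[OF e] f_def[symmetric] Ngrp_iff
    using dv by (simp add: dvd_mult dvd_mult2)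
qed

lemma Kgrp_normal:
  assumes x: "x \<in> G" and n: "n \<in> Kgrp"
  shows "minv x * n * x \<in> Kgrp"
proof -
  obtain \<alpha> \<beta> \<gamma> \<delta> e where xm: "x = mat2 \<alpha> \<beta> \<gamma> \<delta>" and e: "(\<alpha> * \<delta> - \<beta> * \<gamma>) * e = 1" using G_cases[OF x] .
  have nG: "n \<in> G" using n Kgrp_sub by auto
  obtain a b c d where nm: "n = mat2 a b c d" using mat2_cases[OF carr[OF nG]] .
  have dv: "P l2 dvd b" "P l2 dvd c" "P l2 dvd a - 1" "P l2 dvd d - 1" using n unfolding nm Kgrp_iff by auto
  have ad: "P l2 dvd a - d" using dvd_diff[OF dv(3,4)] by simp
  define f where "f = e * (b * \<gamma> * \<delta> - c * \<alpha> * \<beta> + \<beta> * \<gamma> * (a - d))"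
  have f: "P l2 dvd f" unfolding f_def using dv ad by (simp add: dvd_mult dvd_mult2)
  have "a + f - 1 = (a - 1) + f" "d - f - 1 = (d - 1) - f" by simp_all
  hence "P l2 dvd a + f - 1" "P l2 dvd d - f - 1" using dv f by (metis dvd_add, metis dvd_diff)
  moreover have "minv x * n * x \<in> G" by (intro multG minv_props(1) x nG)
  ultimately show ?thesis unfolding xm nm conj_entries[OF e] f_def[symmetric] Kgrp_iff
    using dv ad by (simp add: dvd_mult dvd_mult2)
qed

lemma Kgrp_Ngrp: "i \<le> l2 \<Longrightarrow> Kgrp \<subseteq> Ngrp i"
proof
  fix k assume i: "i \<le> l2" and k: "k \<in> Kgrp"
  have "P l2 dvd k $$ (0, 0) - 1" "P l2 dvd k $$ (Suc 0, Suc 0) - 1" using k by (auto simp: Kgrp_def)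
  from dvd_diff[OF this] have "P i dvd k $$ (0, 0) - k $$ (Suc 0, Suc 0)" using P_dvd[OF i] dvd_trans by (simp add: algebra_simps)
  thus "k \<in> Ngrp i" using k by (simp add: Kgrp_def Ngrp_def)
qed

lemma Kgrp_group: "mat_group Kgrp"
proof
  show "finite Kgrp" using finG Kgrp_sub finite_subset by blast
  show "Kgrp \<subseteq> carrier_mat 2 2" using carrG Kgrp_sub by blast
  show "1\<^sub>m 2 \<in> Kgrp" using oneG by (simp add: mat2_one Kgrp_iff)
next
  fix g h assume gh: "g \<in> Kgrp" "h \<in> Kgrp"
  have G: "g \<in> G" "h \<in> G" using gh Kgrp_sub by auto
  obtain a b c d where g: "g = mat2 a b c d" using mat2_cases[OF carr[OF G(1)]] .
  obtain a' b' c' d' where h: "h = mat2 a' b' c' d'" using mat2_cases[OF carr[OF G(2)]] .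
  have dv: "P l2 dvd b" "P l2 dvd c" "P l2 dvd a - 1" "P l2 dvd d - 1"
    "P l2 dvd b'" "P l2 dvd c'" "P l2 dvd a' - 1" "P l2 dvd d' - 1"
    using gh unfolding g h Kgrp_iff by auto
  have eq: "a * a' + b * c' - 1 = a * (a' - 1) + (a - 1) + b * c'"
    "c * b' + d * d' - 1 = c * b' + (d * (d' - 1) + (d - 1))" by (simp_all add: algebra_simps)
  have "P l2 dvd a * a' + b * c' - 1" "P l2 dvd c * b' + d * d' - 1"
    unfolding eq using dv by (meson dvd_add dvd_mult dvd_mult2)+
  thus "g * h \<in> Kgrp" using multG[OF G] dv unfolding g h mat2_mult Kgrp_iff by (simp add: dvd_mult dvd_mult2)
next
  fix g assume g: "g \<in> Kgrp"
  hence G: "g \<in> G" using Kgrp_sub by auto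
  obtain a b c d e where gm: "g = mat2 a b c d" and e: "(a * d - b * c) * e = 1" using G_cases[OF G] .
  have dv: "P l2 dvd b" "P l2 dvd c" "P l2 dvd a - 1" "P l2 dvd d - 1"
    using g unfolding gm Kgrp_iff by auto
  have "minv g = mat2 (e * d) (- (e * b)) (- (e * c)) (e * a)" unfolding gm by (rule minv_mat2[OF e])
  moreover have "e * d - (a * d - b * c) * e = e * (b * c - (a - 1) * d)"
    "e * a - (a * d - b * c) * e = e * (b * c - (d - 1) * a)" by (simp_all add: algebra_simps)
  hence "P l2 dvd e * d - 1" "P l2 dvd e * a - 1" unfolding e using dv by (simp_all add: dvd_mult dvd_mult2 dvd_diff)
  ultimately have "minv g \<in> Kgrp" using minv_props(1)[OF G] dv
    by (simp add: dvd_mult Kgrp_iff)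
  thus "\<exists>h\<in>Kgrp. g * h = 1\<^sub>m 2 \<and> h * g = 1\<^sub>m 2" using minv_props[OF G] by blast
qed

lemma N_locale: "l1 \<le> i \<Longrightarrow> i \<le> l2 \<Longrightarrow> abelian_subgroup G (Ngrp i)"
  by (intro abelian_subgroup.intro abelian_subgroup_axioms.intro mat_group_axioms Ngrp_group Ngrp_sub Ngrp_commute) auto

lemma K_locale: "abelian_subgroup G Kgrp"
  using Kgrp_Ngrp[of l2] Ngrp_commute[of l2]
  by (intro abelian_subgroup.intro abelian_subgroup_axioms.intro mat_group_axioms Kgrp_group Kgrp_sub)
     (auto simp: subset_iff)

end

sublocale rank2_setup \<subseteq> N: abelian_normal_subgroup G "Ngrp l2"
  by (intro abelian_normal_subgroup.intro abelian_normal_subgroup_axioms.intro N_locale Ngrp_normal) auto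

section \<open>Characters of N above \<open>psi_A\<close> and their conjugates\<close>

context rank2_setup
begin

abbreviation NN where "NN \<equiv> Ngrp l2"

text \<open>This says that \<open>\<mu>\<close> restricts to \<open>psi_A\<close>: the only nonzero
  entry of A is \<open>\<epsilon>\<close> in the lower left corner, so the trace of A B is
  \<open>\<epsilon>\<close> times the upper right entry of B.\<close>

definition over_psi :: "('a mat \<Rightarrow> complex) \<Rightarrow> bool" where
  "over_psi \<mu> \<longleftrightarrow> (\<forall>k\<in>Kgrp. \<mu> k = \<psi> (\<epsilon> * k $$ (0, Suc 0)))"

text \<open>The conjugate of n equals k n with k in K, because conjugation changes n only by
  multiples of the \<open>l2\<close>-th power of \<open>\<pi>\<close>. Hence \<open>\<mu>\<close>
  changes by \<open>psi_A\<close> of k, which is read off the upper right entry of k and is the same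
  for every extension \<open>\<mu>\<close> of \<open>psi_A\<close>.\<close>

lemma conj_formula:
  assumes m: "\<mu> \<in> lchar NN" and o: "over_psi \<mu>" and x: "x \<in> G" and n: "mat2 a b c d \<in> NN"
    and en: "(a * d - b * c) * en = 1"
  shows "\<mu> (minv x * mat2 a b c d * x) =
    \<mu> (mat2 a b c d) * \<psi> (\<epsilon> * (en * a * ((minv x * mat2 a b c d * x) $$ (0, Suc 0) - b)))"
proof -
  let ?n = "mat2 a b c d"
  let ?n' = "minv x * ?n * x"
  have nG: "?n \<in> G" using n Ngrp_sub by auto
  have n': "?n' \<in> NN" using Ngrp_normal[OF x n] .
  have dv: "P l2 dvd b" "P l2 dvd c" "P l2 dvd a - d" using n unfolding Ngrp_iff by auto
  obtain \<alpha> \<beta> \<gamma> \<delta> e where xm: "x = mat2 \<alpha> \<beta> \<gamma> \<delta>" and e: "(\<alpha> * \<delta> - \<beta> * \<gamma>) * e = 1" using G_cases[OF x] .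
  define f where "f = e * (b * \<gamma> * \<delta> - c * \<alpha> * \<beta> + \<beta> * \<gamma> * (a - d))"
  have f: "P l2 dvd f" unfolding f_def using dv by (simp add: dvd_mult dvd_mult2)
  obtain b' c' where n'm: "?n' = mat2 (a + f) b' c' (d - f)"
    unfolding xm conj_entries[OF e] f_def by blast
  have dv': "P l2 dvd b'" "P l2 dvd c'" using n' unfolding n'm Ngrp_iff by auto
  define k where "k = ?n' * minv ?n"
  have kn: "k * ?n = ?n'" unfolding k_def
    using nG Ngrp_sub n' by (simp add: assoc minv_props r_one subset_iff del: mat2_mult)
  \<comment> \<open>Both factors are divisible by the \<open>l2\<close>-th power of
    \<open>\<pi>\<close>, and \<open>2 * l2 \<ge> l\<close>. This removes the shift \<open>f\<close>
    from the upper right entry of \<open>k\<close>.\<close>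
  have z: "f * b = 0" using P_zero[OF f dv(1)] by auto
  have km: "k = mat2 ((a + f) * (en * d) - b' * (en * c)) ((a + f) * (- (en * b)) + b' * (en * a))
      (c' * (en * d) - (d - f) * (en * c)) (c' * (- (en * b)) + (d - f) * (en * a))"
    unfolding k_def n'm minv_mat2[OF en] by simp
  have kG: "k \<in> G" unfolding k_def by (intro multG minv_props(1) nG x)
  have k12: "(a + f) * (- (en * b)) + b' * (en * a) = en * a * (b' - b)"
  proof -
    have "(a + f) * (- (en * b)) + b' * (en * a) = en * a * (b' - b) - en * (f * b)" by (simp add: algebra_simps)
    thus ?thesis using z by simp
  qed
  have "k \<in> Kgrp"
  proof -
    have e1: "(a + f) * (en * d) - b' * (en * c) - 1 = en * (f * d - b' * c + b * c)"
      unfolding en[symmetric] by (simp add: algebra_simps)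
    have e2: "c' * (- (en * b)) + (d - f) * (en * a) - 1 = en * (b * c - c' * b - f * a)"
      unfolding en[symmetric] by (simp add: algebra_simps)
    have "P l2 dvd (a + f) * (en * d) - b' * (en * c) - 1" unfolding e1 using dv dv' f by (simp add: dvd_mult dvd_mult2)
    moreover have "P l2 dvd c' * (- (en * b)) + (d - f) * (en * a) - 1"
      unfolding e2 using dv dv' f by (simp add: dvd_mult dvd_mult2)
    ultimately show ?thesis using kG dv dv' f unfolding km Kgrp_iff
      unfolding k12 by (simp add: dvd_mult dvd_mult2 dvd_diff)
  qed
  hence "\<mu> k = \<psi> (\<epsilon> * (en * a * (b' - b)))" using o k12 unfolding over_psi_def km by simp
  moreover have "\<mu> ?n' = \<mu> k * \<mu> ?n"
    using N.N.lcharD(1)[OF m, of k ?n] \<open>k \<in> Kgrp\<close> Kgrp_Ngrp[of l2] n kn by auto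
  ultimately show ?thesis unfolding n'm by (simp add: mult.commute)
qed

text \<open>The element is a unipotent with entry \<open>\<epsilon> * \<iota> \<beta>\<close> times
  a diagonal matrix with ratio \<open>\<iota> c\<close>. The scalar t places the diagonal matrix in
  \<open>G\<close> and cancels under conjugation.\<close>

lemma pair_element_exists:
  assumes c: "c dvd 1"
  shows "\<exists>g\<in>G. \<forall>a b c' d. (minv g * mat2 a b c' d * g) $$ (0, Suc 0) =
    \<iota> c * (b + \<epsilon> * \<iota> \<beta> * (a - d) - \<epsilon> * \<iota> \<beta> * (\<epsilon> * \<iota> \<beta>) * c')"
proof -
  obtain t where t: "t dvd 1" "mat2 t 0 0 (t * \<iota> c) \<in> G" using G_diag[OF c] by blast
  define x where "x = \<epsilon> * \<iota> \<beta>"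
  define g where "g = mat2 t (x * (t * \<iota> c)) 0 (t * \<iota> c)"
  have "mat2 1 x 0 1 * mat2 t 0 0 (t * \<iota> c) \<in> G" unfolding x_def by (intro multG G_upper t)
  hence gG: "g \<in> G" by (simp add: g_def)
  then obtain e where e: "(t * (t * \<iota> c) - x * (t * \<iota> c) * 0) * e = 1" using det_unit unfolding g_def by blast
  have "(minv g * mat2 a b c' d * g) $$ (0, Suc 0) = \<iota> c * (b + x * (a - d) - x * x * c')" for a b c' d
  proof -
    have "(minv g * mat2 a b c' d * g) $$ (0, Suc 0) =
        ((t * (t * \<iota> c) - x * (t * \<iota> c) * 0) * e) * (\<iota> c * (b + x * (a - d) - x * x * c'))"
      unfolding g_def conj_entries[OF e] by (simp add: algebra_simps)
    thus ?thesis unfolding e by simp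
  qed
  thus ?thesis using gG unfolding x_def by blast
qed

text \<open>Only the effect of conjugation on the upper right entry is kept, since by
  \<open>conj_formula\<close> it determines the conjugated character.\<close>

definition pair_elt :: "'r \<Rightarrow> 'r \<Rightarrow> 'a mat" where
  "pair_elt c \<beta> = (SOME g. g \<in> G \<and> (\<forall>a b c' d. (minv g * mat2 a b c' d * g) $$ (0, Suc 0) =
    \<iota> c * (b + \<epsilon> * \<iota> \<beta> * (a - d) - \<epsilon> * \<iota> \<beta> * (\<epsilon> * \<iota> \<beta>) * c')))"

lemma pair_elt:
  assumes "c dvd 1"
  shows "pair_elt c \<beta> \<in> G" "(minv (pair_elt c \<beta>) * mat2 a b c' d * pair_elt c \<beta>) $$ (0, Suc 0) =
    \<iota> c * (b + \<epsilon> * \<iota> \<beta> * (a - d) - \<epsilon> * \<iota> \<beta> * (\<epsilon> * \<iota> \<beta>) * c')"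
proof -
  have "\<exists>g. g \<in> G \<and> (\<forall>a b c' d. (minv g * mat2 a b c' d * g) $$ (0, Suc 0) =
    \<iota> c * (b + \<epsilon> * \<iota> \<beta> * (a - d) - \<epsilon> * \<iota> \<beta> * (\<epsilon> * \<iota> \<beta>) * c'))"
    using pair_element_exists[OF assms] by blast
  from someI_ex[OF this] show "pair_elt c \<beta> \<in> G" "(minv (pair_elt c \<beta>) * mat2 a b c' d * pair_elt c \<beta>) $$ (0, Suc 0) =
    \<iota> c * (b + \<epsilon> * \<iota> \<beta> * (a - d) - \<epsilon> * \<iota> \<beta> * (\<epsilon> * \<iota> \<beta>) * c')"
    unfolding pair_elt_def by blast+
qed

text \<open>The exponent \<open>l1 - l1 div 2\<close> is half of \<open>l1\<close> rounded up, so
  the square of \<open>\<beta>\<close> is divisible by \<open>\<pi> ^ l1\<close>, and l1 + l2 = l.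
  This restriction on \<open>\<beta>\<close> is the origin of \<open>l1 div 2\<close> in the bound:
  it removes the quadratic term and keeps the conjugation linear in \<open>\<beta>\<close>.\<close>

lemma beta_sq_zero:
  assumes "\<pi> ^ (l1 - l1 div 2) dvd \<beta>" "P l2 dvd c'"
  shows "\<epsilon> * \<iota> \<beta> * (\<epsilon> * \<iota> \<beta>) * c' = 0"
proof -
  obtain x where x: "\<beta> = \<pi> ^ (l1 - l1 div 2) * x" using assms(1) by auto
  let ?m = "l1 - l1 div 2"
  have "\<iota> \<beta> * \<iota> \<beta> = P (?m + ?m) * (\<iota> x * \<iota> x)"
    unfolding power_add by (simp add: x hom mult_ac)
  hence "P (?m + ?m) dvd \<iota> \<beta> * \<iota> \<beta>" by simp
  hence "\<iota> \<beta> * \<iota> \<beta> * c' = 0" using assms(2) by (rule P_zero) linarith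
  moreover have "\<epsilon> * \<iota> \<beta> * (\<epsilon> * \<iota> \<beta>) * c' = \<epsilon> * \<epsilon> * (\<iota> \<beta> * \<iota> \<beta> * c')" by (simp add: mult_ac)
  ultimately show ?thesis by simp
qed

lemma conj_pair_elt_entry:
  assumes c: "c dvd 1" and b: "\<pi> ^ (l1 - l1 div 2) dvd \<beta>" and n: "P l2 dvd c'"
  shows "(minv (pair_elt c \<beta>) * mat2 a b c' d * pair_elt c \<beta>) $$ (0, Suc 0) = \<iota> c * (b + \<epsilon> * \<iota> \<beta> * (a - d))"
  unfolding pair_elt(2)[OF c] beta_sq_zero[OF b n] by simp

lemma conj_pair_elt_formula:
  assumes m: "\<mu> \<in> lchar NN" "over_psi \<mu>" and n: "mat2 a b c' d \<in> NN"
    and en: "(a * d - b * c') * en = 1" and c: "c dvd 1" and b: "\<pi> ^ (l1 - l1 div 2) dvd \<beta>"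
  shows "conj_char NN (pair_elt c \<beta>) \<mu> (mat2 a b c' d) = \<mu> (mat2 a b c' d) *
    \<psi> (\<epsilon> * (en * a * (\<iota> c * (b + \<epsilon> * \<iota> \<beta> * (a - d)) - b)))"
proof -
  have "P l2 dvd c'" using n unfolding Ngrp_iff by simp
  from conj_pair_elt_entry[OF c b this, of a b d]
  show ?thesis using conj_formula[OF m pair_elt(1)[OF c, of \<beta>] n en] n by (simp add: conj_char_def)
qed

lemma conj_pair_elt_K:
  assumes o: "over_psi \<mu>" and k: "mat2 a b c' d \<in> Kgrp"
    and c: "c dvd 1" and b: "\<pi> ^ (l1 - l1 div 2) dvd \<beta>"
  shows "conj_char NN (pair_elt c \<beta>) \<mu> (mat2 a b c' d) = \<psi> (\<epsilon> * (\<iota> c * (b + \<epsilon> * \<iota> \<beta> * (a - d))))"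
proof -
  have "P l2 dvd c'" using k unfolding Kgrp_iff by simp
  from conj_pair_elt_entry[OF c b this, of a b d] show ?thesis
    using Kgrp_normal[OF pair_elt(1)[OF c, of \<beta>] k] o k Kgrp_Ngrp[of l2] unfolding over_psi_def
    by (auto simp: conj_char_def)
qed

definition half :: 'r where "half = (SOME h. 2 * h = 1)"

lemma half: "half + half = 1" "half dvd 1"
proof -
  have "\<exists>h::'r. 2 * h = 1" using two_unit by (simp add: dvd_one_iff)
  hence h: "2 * half = 1" unfolding half_def by (rule someI_ex)
  thus "half + half = 1" by (metis mult_2)
  show "half dvd 1" using h by (metis dvd_triv_right)
qed

text \<open>The reference pair is X = Y = A / 2, that is c = 1/2 and \<open>\<beta>\<close> = 0. Its
  product of conjugates is the character \<open>\<kappa>\<close> to which all other pairs are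
  compared.\<close>

definition joint_char :: "('a mat \<Rightarrow> complex) \<Rightarrow> ('a mat \<Rightarrow> complex) \<Rightarrow> 'a mat \<Rightarrow> complex" where
  "joint_char \<mu> \<nu> n = conj_char NN (pair_elt half 0) \<mu> n * conj_char NN (pair_elt half 0) \<nu> n"

lemma joint_char_lchar: "\<mu> \<in> lchar NN \<Longrightarrow> \<nu> \<in> lchar NN \<Longrightarrow> joint_char \<mu> \<nu> \<in> lchar NN"
  using N.conj_char_lchar[OF N.normalizesI[OF pair_elt(1)[OF half(2), of 0]]]
  by (auto simp: lchar_def joint_char_def)

lemma joint_char_over_psi:
  assumes "over_psi \<mu>" "over_psi \<nu>"
  shows "over_psi (joint_char \<mu> \<nu>)"
  unfolding over_psi_def
proof
  fix k assume k: "k \<in> Kgrp"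
  then obtain a b c d where km: "k = mat2 a b c d" using Kgrp_sub carr mat2_cases by (metis subsetD)
  have "joint_char \<mu> \<nu> k = \<psi> (\<epsilon> * (\<iota> half * b)) * \<psi> (\<epsilon> * (\<iota> half * b))"
    using conj_pair_elt_K[OF assms(1) _ half(2), of a b c d 0] conj_pair_elt_K[OF assms(2) _ half(2), of a b c d 0] k
    by (simp add: joint_char_def km hom_zero)
  also have "\<dots> = \<psi> (\<epsilon> * (\<iota> (half + half) * b))" unfolding psi_add[symmetric] by (simp only: hom_add) (simp add: algebra_simps)
  finally show "joint_char \<mu> \<nu> k = \<psi> (\<epsilon> * k $$ (0, Suc 0))" by (simp add: half hom km)
qed

lemma joint_char_factor:
  assumes m: "\<mu> \<in> lchar NN" "over_psi \<mu>" and n: "\<nu> \<in> lchar NN" "over_psi \<nu>"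
    and c: "c dvd 1" "1 - c dvd 1" and b: "\<pi> ^ (l1 - l1 div 2) dvd \<beta>"
  shows "\<exists>y\<in>G. \<forall>n\<in>NN. joint_char \<mu> \<nu> n = conj_char NN (pair_elt c \<beta>) \<mu> n * conj_char NN y \<nu> n"
proof -
  obtain v where v: "(1 - c) * v = 1" using c(2) by (auto simp: dvd_one_iff)
  \<comment> \<open>X + Y = A requires the multipliers to add up to 1 and the diagonal terms to
    cancel. With multipliers c and 1 - c the second condition is
    \<open>c * \<beta> + (1 - c) * \<beta>' = 0\<close>, solved here for
    \<open>\<beta>'\<close>.\<close>
  define \<beta>' where "\<beta>' = - (c * \<beta> * v)"
  have b': "\<pi> ^ (l1 - l1 div 2) dvd \<beta>'" using b by (simp add: \<beta>'_def dvd_mult dvd_mult2)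
  have sum0: "c * \<beta> + (1 - c) * \<beta>' = 0"
  proof -
    have "(1 - c) * \<beta>' = - (c * \<beta>) * ((1 - c) * v)" by (simp add: \<beta>'_def algebra_simps)
    thus ?thesis unfolding v by simp
  qed
  have "joint_char \<mu> \<nu> n = conj_char NN (pair_elt c \<beta>) \<mu> n * conj_char NN (pair_elt (1 - c) \<beta>') \<nu> n" if nn: "n \<in> NN" for n
  proof -
    have nG: "n \<in> G" using nn Ngrp_sub by auto
    obtain a b c' d en where nm: "n = mat2 a b c' d" and en: "(a * d - b * c') * en = 1" using G_cases[OF nG] .
    have nN: "mat2 a b c' d \<in> NN" using nn nm by simp
    let ?X = "\<epsilon> * (en * a * (\<iota> c * (b + \<epsilon> * \<iota> \<beta> * (a - d)) - b))"
    let ?Y = "\<epsilon> * (en * a * (\<iota> (1 - c) * (b + \<epsilon> * \<iota> \<beta>' * (a - d)) - b))"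
    let ?H = "\<epsilon> * (en * a * (\<iota> half * (b + \<epsilon> * \<iota> 0 * (a - d)) - b))"
    \<comment> \<open>The sum of the two exponents depends only on the sum of the multipliers and on
      the sum of their products with \<open>\<beta>\<close> and \<open>\<beta>'\<close>. These are 1
      and 0, as for the reference pair.\<close>
    have "?X + ?Y = \<epsilon> * (en * a) * (\<iota> (c + (1 - c)) * b - b - b + \<epsilon> * \<iota> (c * \<beta> + (1 - c) * \<beta>') * (a - d))"
      by (simp only: hom) (simp add: algebra_simps)
    also have "\<dots> = \<epsilon> * (en * a) * (\<iota> (half + half) * b - b - b)"
      unfolding sum0 half by (simp add: hom)
    also have "\<dots> = ?H + ?H" by (simp only: hom_add hom_zero) (simp add: algebra_simps)
    finally have XY: "\<psi> ?X * \<psi> ?Y = \<psi> ?H * \<psi> ?H" by (simp only: psi_add[symmetric])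
    have "conj_char NN (pair_elt c \<beta>) \<mu> n * conj_char NN (pair_elt (1 - c) \<beta>') \<nu> n = \<mu> n * \<nu> n * (\<psi> ?X * \<psi> ?Y)"
      unfolding nm conj_pair_elt_formula[OF m nN en c(1) b] conj_pair_elt_formula[OF n nN en c(2) b'] by (simp add: mult_ac)
    also have "\<dots> = joint_char \<mu> \<nu> n"
      unfolding XY joint_char_def nm conj_pair_elt_formula[OF m nN en half(2) dvd_0_right]
        conj_pair_elt_formula[OF n nN en half(2) dvd_0_right] by (simp add: mult_ac)
    finally show ?thesis by simp
  qed
  thus ?thesis using pair_elt(1)[OF c(2)] by blast
qed

text \<open>
  With \<open>x = \<epsilon> \<beta>\<close>, the element \<open>pair_elt c \<beta>\<close> conjugates A to X = ((xc, 0), (c, -xc)) up to the factor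
  \<open>\<epsilon>\<close>, because \<open>x\<^sup>2 = 0\<close> modulo \<open>\<pi>\<close>\<open>\<^bsup>l1\<^esup>\<close>; then A - X has the same shape with 1 - c in place of c.
\<close>
definition pairs :: "('r \<times> 'r) set" where
  "pairs = {(c, \<beta>). c dvd 1 \<and> 1 - c dvd 1 \<and> \<pi> ^ (l1 - l1 div 2) dvd \<beta>}"

text \<open>A family of test elements: on unipotents of K a conjugated character reveals the
  coefficient of b, and on the torus elements of \<open>torus_K\<close> it reveals the coefficient
  of a - d.\<close>

lemma upper_K: "mat2 1 (\<epsilon> * \<iota> (\<pi> ^ l2 * s)) 0 1 \<in> Kgrp"
  using G_upper[of "\<pi> ^ l2 * s"] by (simp add: Kgrp_iff hom dvd_mult dvd_mult2)

lemma torus_K: "mat2 (\<iota> (1 + \<pi> ^ l2 * s)) 0 0 (\<iota> (1 - \<pi> ^ l2 * s)) \<in> Kgrp"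
proof -
  have "\<pi> ^ (l2 + l2) = 0" by (rule pi_pow_0) simp
  hence "\<pi> ^ l2 * \<pi> ^ l2 = 0" unfolding power_add .
  hence "(\<pi> ^ l2 * \<pi> ^ l2) * (s * s) = 0" by simp
  hence "(\<pi> ^ l2 * s) * (\<pi> ^ l2 * s) = 0" by (simp add: mult_ac)
  hence "(1 + \<pi> ^ l2 * s) * (1 - \<pi> ^ l2 * s) = 1" by (simp add: algebra_simps)
  from G_torus[OF this] show ?thesis by (simp add: Kgrp_iff hom dvd_mult dvd_mult2)
qed

text \<open>Testing on unipotents determines c modulo \<open>\<pi> ^ l1\<close>. Testing on the
  torus then determines c times \<open>\<beta>\<close>, where the 2 comes from the difference of the
  two diagonal entries, and the unit c is cancelled. The product
  \<open>\<epsilon> * \<epsilon>\<close> brings the arguments of \<open>\<psi>\<close> into the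
  small ring, where nondegeneracy is available.\<close>

lemma pairs_distinct:
  assumes o: "over_psi \<mu>" and p: "(c, \<beta>) \<in> pairs" "(c', \<beta>') \<in> pairs"
    and eq: "conj_char NN (pair_elt c \<beta>) \<mu> = conj_char NN (pair_elt c' \<beta>') \<mu>"
  shows "\<pi> ^ l2 * c = \<pi> ^ l2 * c'" "\<pi> ^ l2 * \<beta> = \<pi> ^ l2 * \<beta>'"
proof -
  have c: "c dvd 1" "c' dvd 1" and b: "\<pi> ^ (l1 - l1 div 2) dvd \<beta>" "\<pi> ^ (l1 - l1 div 2) dvd \<beta>'"
    using p by (auto simp: pairs_def)
  have "d0 * (\<pi> ^ l2 * (c - c')) = 0"
  proof (rule psi_nondegenerate)
    fix s
    have "\<psi> (\<epsilon> * (\<iota> c * (\<epsilon> * \<iota> (\<pi> ^ l2 * s)))) = \<psi> (\<epsilon> * (\<iota> c' * (\<epsilon> * \<iota> (\<pi> ^ l2 * s))))"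
      using fun_cong[OF eq, of "mat2 1 (\<epsilon> * \<iota> (\<pi> ^ l2 * s)) 0 1"]
        conj_pair_elt_K[OF o upper_K[of s] c(1) b(1)] conj_pair_elt_K[OF o upper_K[of s] c(2) b(2)] by simp
    from psi_diff[OF this] have "\<psi> (\<epsilon> * \<epsilon> * (\<iota> c - \<iota> c') * \<iota> (\<pi> ^ l2 * s)) = 1" by (simp add: algebra_simps)
    thus "\<psi> (\<iota> (d0 * (\<pi> ^ l2 * (c - c')) * s)) = 1" by (simp add: eps_sq hom mult_ac)
  qed
  hence "\<pi> ^ l2 * (c - c') = 0" using unit_cancel[OF d0_unit, of _ 0] by simp
  thus cc: "\<pi> ^ l2 * c = \<pi> ^ l2 * c'" by (simp add: algebra_simps)
  have "2 * d0 * (\<pi> ^ l2 * (c * \<beta> - c' * \<beta>')) = 0"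
  proof (rule psi_nondegenerate)
    fix s
    let ?a = "\<iota> (1 + \<pi> ^ l2 * s)" and ?d = "\<iota> (1 - \<pi> ^ l2 * s)"
    have ad: "?a - ?d = \<iota> (2 * (\<pi> ^ l2 * s))"
      by (simp only: hom_diff[symmetric]) (rule arg_cong[of _ _ \<iota>], simp)
    have "\<psi> (\<epsilon> * (\<iota> c * (0 + \<epsilon> * \<iota> \<beta> * (?a - ?d)))) = \<psi> (\<epsilon> * (\<iota> c' * (0 + \<epsilon> * \<iota> \<beta>' * (?a - ?d))))"
      using fun_cong[OF eq, of "mat2 ?a 0 0 ?d"]
        conj_pair_elt_K[OF o torus_K[of s] c(1) b(1)] conj_pair_elt_K[OF o torus_K[of s] c(2) b(2)] by simp
    from psi_diff[OF this] have "\<psi> (\<epsilon> * \<epsilon> * (\<iota> c * \<iota> \<beta> - \<iota> c' * \<iota> \<beta>') * (?a - ?d)) = 1" by (simp add: algebra_simps)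
    hence "\<psi> (\<iota> d0 * \<iota> (c * \<beta> - c' * \<beta>') * \<iota> (2 * (\<pi> ^ l2 * s))) = 1" unfolding ad eps_sq by (simp only: hom)
    moreover have "\<iota> d0 * \<iota> (c * \<beta> - c' * \<beta>') * \<iota> (2 * (\<pi> ^ l2 * s)) = \<iota> (2 * d0 * (\<pi> ^ l2 * (c * \<beta> - c' * \<beta>')) * s)"
      by (simp only: hom_mult[symmetric]) (simp add: mult_ac)
    ultimately show "\<psi> (\<iota> (2 * d0 * (\<pi> ^ l2 * (c * \<beta> - c' * \<beta>')) * s)) = 1" by simp
  qed
  hence "\<pi> ^ l2 * (c * \<beta> - c' * \<beta>') = 0" using unit_cancel[OF unit_mult[OF two_unit d0_unit], of _ 0] by simp
  hence "c * (\<pi> ^ l2 * \<beta>) = (\<pi> ^ l2 * c') * \<beta>'" by (simp add: algebra_simps)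
  hence "c * (\<pi> ^ l2 * \<beta>) = c * (\<pi> ^ l2 * \<beta>')" unfolding cc[symmetric] by (simp add: mult_ac)
  thus "\<pi> ^ l2 * \<beta> = \<pi> ^ l2 * \<beta>'" using unit_cancel[OF c(1)] by blast
qed

text \<open>Modulo \<open>\<pi> ^ l1\<close> there are at least (q - 2) q^(l1 - 1) classes of c, and
  the multiples of \<open>\<pi> ^ (l1 - l1 div 2)\<close> form q^(l1 div 2) classes of
  \<open>\<beta>\<close>. The conjugated character remembers both classes.\<close>

lemma card_pairs:
  assumes o: "over_psi \<mu>"
  shows "(q - 2) * q ^ (l1 - 1) * q ^ (l1 div 2) \<le> card ((\<lambda>(c, \<beta>). conj_char NN (pair_elt c \<beta>) \<mu>) ` pairs)"
proof -
  let ?m = "l1 - l1 div 2"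
  let ?U = "(\<lambda>c. \<pi> ^ l2 * c) ` {c. c dvd 1 \<and> 1 - c dvd 1}"
  have pr: "pairs = {c. c dvd 1 \<and> 1 - c dvd 1} \<times> {\<beta>. \<pi> ^ ?m dvd \<beta>}" by (auto simp: pairs_def)
  have im2: "(\<lambda>\<beta>. \<pi> ^ l2 * \<beta>) ` {\<beta>. \<pi> ^ ?m dvd \<beta>} = pideal (l2 + ?m)"
  proof -
    have "(\<lambda>\<beta>. \<pi> ^ l2 * \<beta>) ` {\<beta>. \<pi> ^ ?m dvd \<beta>} = range (\<lambda>x. \<pi> ^ l2 * (\<pi> ^ ?m * x))"
      by (auto elim!: dvdE)
    thus ?thesis unfolding pideal_def power_add by (simp add: mult.assoc)
  qed
  have "(\<lambda>(c, \<beta>). (\<pi> ^ l2 * c, \<pi> ^ l2 * \<beta>)) ` pairs = ?U \<times> (\<lambda>\<beta>. \<pi> ^ l2 * \<beta>) ` {\<beta>. \<pi> ^ ?m dvd \<beta>}"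
    unfolding pr by auto
  hence "card ((\<lambda>(c, \<beta>). (\<pi> ^ l2 * c, \<pi> ^ l2 * \<beta>)) ` pairs) = card ?U * card (pideal (l2 + ?m))"
    unfolding im2 by (simp add: card_cartesian_product)
  also have "card (pideal (l2 + ?m)) = q ^ (l1 div 2)"
  proof -
    have "l2 + ?m \<le> l" "l - (l2 + ?m) = l1 div 2" using l12 by auto
    thus ?thesis using card_pideal[of "l2 + ?m"] by simp
  qed
  finally have "(q - 2) * q ^ (l1 - 1) * q ^ (l1 div 2) \<le> card ((\<lambda>(c, \<beta>). (\<pi> ^ l2 * c, \<pi> ^ l2 * \<beta>)) ` pairs)"
    using card_unit_classes[OF l12 l1_pos] by simp
  also have "\<dots> \<le> card ((\<lambda>(c, \<beta>). conj_char NN (pair_elt c \<beta>) \<mu>) ` pairs)"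
  proof (rule card_image_le_card_image)
    have "finite (UNIV :: 'r set)" by (rule finite_ring)
    thus "finite pairs" by (meson finite_Prod_UNIV finite_subset subset_UNIV)
  next
    fix i j assume ij: "i \<in> pairs" "j \<in> pairs"
      "(case i of (c, \<beta>) \<Rightarrow> conj_char NN (pair_elt c \<beta>) \<mu>) = (case j of (c, \<beta>) \<Rightarrow> conj_char NN (pair_elt c \<beta>) \<mu>)"
    obtain c \<beta> c' \<beta>' where "i = (c, \<beta>)" "j = (c', \<beta>')" by fastforce
    thus "(case i of (c, \<beta>) \<Rightarrow> (\<pi> ^ l2 * c, \<pi> ^ l2 * \<beta>)) = (case j of (c, \<beta>) \<Rightarrow> (\<pi> ^ l2 * c, \<pi> ^ l2 * \<beta>))"
      using pairs_distinct[OF o, of c \<beta> c' \<beta>'] ij by simp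
  qed
  finally show ?thesis .
qed

end

section \<open>The stabilizer of a character above \<open>psi_A\<close>\<close>

lemma unit_dvd_cancel: "(u::'a::comm_ring_1) dvd 1 \<Longrightarrow> k dvd u * x \<Longrightarrow> k dvd x"
  by (metis dvd_mult dvd_one_iff mult.assoc mult.commute mult_1)

context rank2_setup
begin

lemma hom_inj: "\<iota> x = \<iota> y \<Longrightarrow> x = y"
  using psi_nondegenerate[of "x - y"] by (simp add: hom psi_zero left_diff_distrib)

text \<open>Modulo the \<open>l1\<close>-th power of \<open>\<pi>\<close> the stabilizer is the
  centralizer of A: a = d and b = 0, with c free. Unipotent test elements show that the square of d
  is congruent to the determinant, so d is a unit; torus test elements show that b vanishes. The
  multipliers are the ratios of a, \<open>\<epsilon> * b\<close> and \<open>\<epsilon> * c\<close>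
  to d, which lie in the small ring by \<open>G_lines\<close>.\<close>

lemma stab_lines:
  assumes o: "over_psi \<kappa>" and g: "mat2 a b c d \<in> G" and st: "conj_char NN (mat2 a b c d) \<kappa> = \<kappa>"
  shows "\<exists>\<alpha> \<beta> \<gamma>. d dvd 1 \<and> a = d * \<iota> \<alpha> \<and> \<epsilon> * b = d * \<iota> \<beta> \<and> \<epsilon> * c = d * \<iota> \<gamma> \<and>
    \<pi> ^ l1 dvd \<alpha> - 1 \<and> \<pi> ^ l1 dvd \<beta>"
proof -
  define \<Delta> where "\<Delta> = a * d - b * c"
  obtain e where e: "(a * d - b * c) * e = 1" using det_unit[OF g] by blast
  obtain m1 m2 m3 m4 where m: "d * d = \<Delta> * \<iota> m1" "a * d = \<Delta> * \<iota> m2" "\<epsilon> * b * d = \<Delta> * \<iota> m3" "\<epsilon> * c * d = \<Delta> * \<iota> m4"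
    using G_lines[OF g] unfolding \<Delta>_def by blast
  have De: "\<Delta> * e = 1" using e by (simp add: \<Delta>_def)
  have K: "\<psi> (\<epsilon> * (minv (mat2 a b c d) * k * mat2 a b c d) $$ (0, Suc 0)) = \<psi> (\<epsilon> * k $$ (0, Suc 0))"
    if k: "k \<in> Kgrp" for k
  proof -
    have "k \<in> NN" using k Kgrp_Ngrp[of l2] by auto
    hence "\<kappa> (minv (mat2 a b c d) * k * mat2 a b c d) = \<kappa> k" using fun_cong[OF st, of k] by (simp add: conj_char_def)
    thus ?thesis using o k Kgrp_normal[OF g k] unfolding over_psi_def by simp
  qed
  have "d0 * (\<pi> ^ l2 * (m1 - 1)) = 0"
  proof (rule psi_nondegenerate)
    fix s
    let ?b = "\<epsilon> * \<iota> (\<pi> ^ l2 * s)"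
    have "e * (?b * d * d) = e * ?b * (d * d)" by (simp add: mult_ac)
    also have "\<dots> = (\<Delta> * e) * (?b * \<iota> m1)" unfolding m(1) by (simp add: mult_ac)
    finally have "e * (?b * d * d) = (\<Delta> * e) * (?b * \<iota> m1)" .
    hence "e * (?b * d * d) = ?b * \<iota> m1" unfolding De by simp
    hence "\<psi> (\<epsilon> * (?b * \<iota> m1)) = \<psi> (\<epsilon> * ?b)" using K[OF upper_K[of s]] unfolding conj_entries[OF e] by simp
    from psi_diff[OF this] have "\<psi> (\<epsilon> * \<epsilon> * (\<iota> m1 - 1) * \<iota> (\<pi> ^ l2 * s)) = 1" by (simp add: algebra_simps)
    thus "\<psi> (\<iota> (d0 * (\<pi> ^ l2 * (m1 - 1)) * s)) = 1" by (simp add: eps_sq hom mult_ac)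
  qed
  hence "\<pi> ^ l2 * (m1 - 1) = 0" using unit_cancel[OF d0_unit, of _ 0] by simp
  hence m11: "\<pi> ^ l1 dvd m1 - 1" using pi_mult_zero_iff[of l2 "m1 - 1"] by simp
  have "\<pi> dvd \<pi> ^ l1" using l1_pos by (intro dvd_power) auto
  hence "\<pi> dvd m1 - 1" using m11 dvd_trans by blast
  hence "1 + (m1 - 1) dvd 1" by (intro unit_add_pi) auto
  hence m1u: "m1 dvd 1" by simp
  then obtain v where v: "m1 * v = 1" by (auto simp: dvd_one_iff)
  have "d * d dvd 1" unfolding m(1) using hom_unit[OF m1u] De by (intro unit_mult) (auto simp: dvd_one_iff)
  hence du: "d dvd 1" by (rule unit_factor)
  have "2 * (\<pi> ^ l2 * m3) = 0"
  proof (rule psi_nondegenerate)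
    fix s
    let ?a = "\<iota> (1 + \<pi> ^ l2 * s)" and ?d = "\<iota> (1 - \<pi> ^ l2 * s)"
    have ad: "?a - ?d = \<iota> (2 * (\<pi> ^ l2 * s))"
      by (simp only: hom_diff[symmetric]) (rule arg_cong[of _ _ \<iota>], simp)
    have "\<epsilon> * (e * (d * b * (?a - ?d))) = e * (\<epsilon> * b * d) * (?a - ?d)" by (simp add: mult_ac)
    also have "\<dots> = (\<Delta> * e) * (\<iota> m3 * (?a - ?d))" unfolding m(3) by (simp add: mult_ac)
    also have "\<dots> = \<iota> (2 * (\<pi> ^ l2 * m3) * s)" unfolding De ad
      by (simp only: hom_mult[symmetric] mult_1) (rule arg_cong[of _ _ \<iota>], simp add: mult_ac)
    finally have "\<epsilon> * (e * (d * b * (?a - ?d))) = \<iota> (2 * (\<pi> ^ l2 * m3) * s)" .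
    thus "\<psi> (\<iota> (2 * (\<pi> ^ l2 * m3) * s)) = 1"
      using K[OF torus_K[of s]] unfolding conj_entries[OF e] by (simp add: psi_zero)
  qed
  hence "\<pi> ^ l2 * m3 = 0" using unit_cancel[OF two_unit, of _ 0] by simp
  hence m30: "\<pi> ^ l1 dvd m3" using pi_mult_zero_iff[of l2 m3] by simp
  have D: "\<Delta> = d * d * \<iota> v"
  proof -
    have "d * d * \<iota> v = \<Delta> * \<iota> (m1 * v)" unfolding m(1) by (simp add: hom mult_ac)
    thus ?thesis by (simp add: v hom)
  qed
  have div: "x = d * \<iota> (v * k)" if "x * d = \<Delta> * \<iota> k" for x k
    by (rule unit_cancel[OF du]) (use that D in \<open>simp add: hom mult_ac\<close>)
  note a = div[OF m(2)] and b = div[OF m(3)] and c = div[OF m(4)]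
  define \<alpha> \<beta> \<gamma> where "\<alpha> = v * m2" and "\<beta> = v * m3" and "\<gamma> = v * m4"
  note abc = a[folded \<alpha>_def] b[folded \<beta>_def] c[folded \<gamma>_def]
  have bd: "\<pi> ^ l1 dvd \<beta>" using m30 by (simp add: \<beta>_def dvd_mult)
  \<comment> \<open>Divided by the square of d, the determinant becomes
    \<open>d0 * v = d0 * \<alpha> - \<beta> * \<gamma>\<close>. As \<open>\<beta>\<close> and
    \<open>v - 1\<close> are divisible by \<open>\<pi> ^ l1\<close>, so is
    \<open>\<alpha> - 1\<close>.\<close>
  have "\<iota> d0 * \<Delta> = \<epsilon> * \<epsilon> * (a * d) - (\<epsilon> * b) * (\<epsilon> * c)"
    by (simp add: \<Delta>_def eps_sq[symmetric] algebra_simps)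
  also have "\<dots> = d * d * \<iota> (d0 * \<alpha> - \<beta> * \<gamma>)" unfolding abc(2,3) eps_sq
    by (subst abc(1)) (simp add: hom algebra_simps)
  finally have "d * d * \<iota> (d0 * v) = d * d * \<iota> (d0 * \<alpha> - \<beta> * \<gamma>)" unfolding D by (simp add: hom mult_ac)
  hence "\<iota> (d0 * v) = \<iota> (d0 * \<alpha> - \<beta> * \<gamma>)" using unit_cancel[OF \<open>d * d dvd 1\<close>] by blast
  hence "d0 * v = d0 * \<alpha> - \<beta> * \<gamma>" by (rule hom_inj)
  hence "d0 * (\<alpha> - v) = \<beta> * \<gamma>" by (simp add: algebra_simps)
  hence "\<pi> ^ l1 dvd d0 * (\<alpha> - v)" using bd by (simp add: dvd_mult2)
  hence av: "\<pi> ^ l1 dvd \<alpha> - v" by (rule unit_dvd_cancel[OF d0_unit])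
  have "v - m1 * v = - (v * (m1 - 1))" by (simp add: algebra_simps)
  hence "\<pi> ^ l1 dvd v - 1" unfolding v using m11 by (simp add: dvd_mult)
  hence "\<pi> ^ l1 dvd \<alpha> - 1" using dvd_add[OF av, of "v - 1"] by simp
  thus ?thesis using du abc bd by blast
qed

text \<open>Two stabilizing matrices whose ratios \<open>\<alpha>\<close>, \<open>\<beta>\<close>,
  \<open>\<gamma>\<close> agree modulo \<open>\<pi> ^ l2\<close> are proportional modulo that power,
  hence differ by an element of N. By \<open>stab_lines\<close> there are at most q^(l2 - l1)
  classes for \<open>\<alpha>\<close>, as many for \<open>\<beta>\<close>, and q^l2 for
  \<open>\<gamma>\<close>.\<close>

lemma card_stab:
  assumes o: "over_psi \<kappa>"
  shows "card {x \<in> G. conj_char NN x \<kappa> = \<kappa>} \<le> q ^ (l2 + 2 * (l2 - l1)) * card NN"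
proof -
  define A where "A = {x \<in> G. conj_char NN x \<kappa> = \<kappa>}"
  have finA: "finite A" using finG by (simp add: A_def)
  have "\<forall>g\<in>A. \<exists>t. \<exists>a b c d. g = mat2 a b c d \<and> d dvd 1 \<and> a = d * \<iota> (fst t) \<and> \<epsilon> * b = d * \<iota> (fst (snd t)) \<and>
      \<epsilon> * c = d * \<iota> (snd (snd t)) \<and> \<pi> ^ l1 dvd fst t - 1 \<and> \<pi> ^ l1 dvd fst (snd t)"
  proof
    fix g assume g: "g \<in> A"
    hence gG: "g \<in> G" by (simp add: A_def)
    obtain a b c d where gm: "g = mat2 a b c d" using mat2_cases[OF carr[OF gG]] .
    have "\<exists>\<alpha> \<beta> \<gamma>. d dvd 1 \<and> a = d * \<iota> \<alpha> \<and> \<epsilon> * b = d * \<iota> \<beta> \<and> \<epsilon> * c = d * \<iota> \<gamma> \<and>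
      \<pi> ^ l1 dvd \<alpha> - 1 \<and> \<pi> ^ l1 dvd \<beta>"
      by (rule stab_lines[OF o]) (use g gG in \<open>auto simp: A_def gm\<close>)
    then obtain \<alpha> \<beta> \<gamma> where h: "d dvd 1" "a = d * \<iota> \<alpha>" "\<epsilon> * b = d * \<iota> \<beta>" "\<epsilon> * c = d * \<iota> \<gamma>"
      "\<pi> ^ l1 dvd \<alpha> - 1" "\<pi> ^ l1 dvd \<beta>" by blast
    show "\<exists>t. \<exists>a b c d. g = mat2 a b c d \<and> d dvd 1 \<and> a = d * \<iota> (fst t) \<and> \<epsilon> * b = d * \<iota> (fst (snd t)) \<and>
      \<epsilon> * c = d * \<iota> (snd (snd t)) \<and> \<pi> ^ l1 dvd fst t - 1 \<and> \<pi> ^ l1 dvd fst (snd t)"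
      by (intro exI[of _ "(\<alpha>, \<beta>, \<gamma>)"] exI[of _ a] exI[of _ b] exI[of _ c] exI[of _ d])
         (use gm h in simp)
  qed
  from bchoice[OF this] obtain f where f: "\<forall>g\<in>A. \<exists>a b c d. g = mat2 a b c d \<and> d dvd 1 \<and> a = d * \<iota> (fst (f g)) \<and>
      \<epsilon> * b = d * \<iota> (fst (snd (f g))) \<and> \<epsilon> * c = d * \<iota> (snd (snd (f g))) \<and>
      \<pi> ^ l1 dvd fst (f g) - 1 \<and> \<pi> ^ l1 dvd fst (snd (f g))" by blast
  define \<phi> where "\<phi> g = (\<pi> ^ l1 * fst (f g), \<pi> ^ l1 * fst (snd (f g)), \<pi> ^ l1 * snd (snd (f g)))" for g
  let ?T = "(+) (\<pi> ^ l1) ` pideal (l1 + l1) \<times> pideal (l1 + l1) \<times> pideal l1"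
  have im: "\<phi> ` A \<subseteq> ?T"
  proof
    fix y assume "y \<in> \<phi> ` A"
    then obtain g where g: "g \<in> A" "y = \<phi> g" by auto
    obtain x where x: "fst (f g) - 1 = \<pi> ^ l1 * x" using f g by (auto elim!: dvdE)
    obtain z where z: "fst (snd (f g)) = \<pi> ^ l1 * z" using f g by (auto elim!: dvdE)
    have "fst (f g) = 1 + \<pi> ^ l1 * x" using x by (simp add: algebra_simps)
    hence "\<pi> ^ l1 * fst (f g) = \<pi> ^ l1 + \<pi> ^ (l1 + l1) * x" by (simp only: power_add) (simp add: algebra_simps)
    hence "\<pi> ^ l1 * fst (f g) \<in> (+) (\<pi> ^ l1) ` pideal (l1 + l1)" unfolding pideal_def by blast
    moreover have "\<pi> ^ l1 * fst (snd (f g)) = \<pi> ^ (l1 + l1) * z" unfolding z power_add by (simp add: mult.assoc)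
    hence "\<pi> ^ l1 * fst (snd (f g)) \<in> pideal (l1 + l1)" unfolding pideal_def by blast
    moreover have "\<pi> ^ l1 * snd (snd (f g)) \<in> pideal l1" unfolding pideal_def by blast
    ultimately show "y \<in> ?T" using g(2) by (simp add: \<phi>_def)
  qed
  have "card (\<phi> ` A) \<le> card ?T"
    by (rule card_mono[OF _ im]) (auto intro!: finite_cartesian_product finite_ring)
  also have "card ?T = card (pideal (l1 + l1)) * (card (pideal (l1 + l1)) * card (pideal l1))"
    by (simp add: card_cartesian_product card_image)
  also have "\<dots> = q ^ (l2 + 2 * (l2 - l1))"
  proof -
    have "l1 + l1 \<le> l" "l - (l1 + l1) = l2 - l1" "l1 \<le> l" by auto
    hence "card (pideal (l1 + l1)) = q ^ (l2 - l1)" "card (pideal l1) = q ^ l2"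
      using card_pideal[of "l1 + l1"] card_pideal[of l1] by metis+
    thus ?thesis unfolding mult_2 power_add by simp
  qed
  finally have cim: "card (\<phi> ` A) \<le> q ^ (l2 + 2 * (l2 - l1))" .
  have "card A \<le> card (\<phi> ` A) * card NN"
  proof (rule card_le_image_mult[OF finA])
    fix y assume "y \<in> \<phi> ` A"
    then obtain g0 where g0: "g0 \<in> A" "y = \<phi> g0" by auto
    have g0G: "g0 \<in> G" using g0 by (simp add: A_def)
    show "card {x \<in> A. \<phi> x = y} \<le> card NN"
    proof (rule card_inj_on_le[where f = "\<lambda>g. minv g0 * g"])
      show "inj_on (\<lambda>g. minv g0 * g) {x \<in> A. \<phi> x = y}"
        by (rule inj_on_inverseI[where g = "\<lambda>z. g0 * z"]) (use g0G in \<open>auto simp: minv_cancel_right A_def\<close>)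
      show "finite NN" by (rule N.N.finG)
      show "(\<lambda>g. minv g0 * g) ` {x \<in> A. \<phi> x = y} \<subseteq> NN"
      proof
        fix z assume "z \<in> (\<lambda>g. minv g0 * g) ` {x \<in> A. \<phi> x = y}"
        then obtain g where g: "g \<in> A" "\<phi> g = \<phi> g0" "z = minv g0 * g" using g0 by auto
        have gG: "g \<in> G" using g by (simp add: A_def)
        obtain \<alpha> \<beta> \<gamma> where f0: "f g0 = (\<alpha>, \<beta>, \<gamma>)" by (cases "f g0") auto
        obtain \<alpha>' \<beta>' \<gamma>' where f1: "f g = (\<alpha>', \<beta>', \<gamma>')" by (cases "f g") auto
        obtain a b c d where m0: "g0 = mat2 a b c d" "a = d * \<iota> \<alpha>" "\<epsilon> * b = d * \<iota> \<beta>" "\<epsilon> * c = d * \<iota> \<gamma>"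
          using bspec[OF f g0(1)] unfolding f0 by auto
        obtain a' b' c' d' where m1: "g = mat2 a' b' c' d'" "a' = d' * \<iota> \<alpha>'" "\<epsilon> * b' = d' * \<iota> \<beta>'" "\<epsilon> * c' = d' * \<iota> \<gamma>'"
          using bspec[OF f g(1)] unfolding f1 by auto
        have dvd0: "P l2 dvd \<iota> (y - x)" if "\<pi> ^ l1 * y = \<pi> ^ l1 * x" for x y
        proof -
          have "\<pi> ^ l1 * (y - x) = 0" using that by (simp add: right_diff_distrib)
          hence "\<pi> ^ l2 dvd y - x" using pi_mult_zero_iff[of l1 "y - x"] by simp
          thus ?thesis by (metis dvd_def hom_mult)
        qed
        have dA: "P l2 dvd \<iota> (\<alpha>' - \<alpha>)" and dB: "P l2 dvd \<iota> (\<beta>' - \<beta>)" and dC: "P l2 dvd \<iota> (\<gamma>' - \<gamma>)"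
          using g(2) by (auto simp: \<phi>_def f0 f1 intro!: dvd0)
        obtain e where e: "(a * d - b * c) * e = 1" using det_unit g0G m0(1) by blast
        have zm: "z = mat2 (e * (d * a' - b * c')) (e * (d * b' - b * d')) (e * (a * c' - c * a')) (e * (a * d' - c * b'))"
          unfolding g(3) m0(1) m1(1) minv_mat2[OF e] by (simp add: algebra_simps)
        \<comment> \<open>After multiplication by the unit \<open>\<epsilon>\<close>, the entries of
          the quotient matrix become combinations of differences of ratios, which are divisible by
          the \<open>l2\<close>-th power of \<open>\<pi>\<close>.\<close>
        have "\<epsilon> * (d * b' - b * d') = d * (\<epsilon> * b') - (\<epsilon> * b) * d'" by (simp add: algebra_simps)
        also have "\<dots> = d * d' * \<iota> (\<beta>' - \<beta>)" unfolding m0(3) m1(3) by (simp add: hom algebra_simps)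
        finally have "P l2 dvd \<epsilon> * (d * b' - b * d')" using dB by (simp add: dvd_mult)
        hence 1: "P l2 dvd d * b' - b * d'" by (rule unit_dvd_cancel[OF eps_unit])
        have "\<epsilon> * (a * c' - c * a') = a * (\<epsilon> * c') - (\<epsilon> * c) * a'" by (simp add: algebra_simps)
        also have "\<dots> = d * d' * (\<iota> \<alpha> * \<iota> (\<gamma>' - \<gamma>) - \<iota> \<gamma> * \<iota> (\<alpha>' - \<alpha>))"
          unfolding m0(2,4) m1(2,4) by (simp add: hom algebra_simps)
        finally have "P l2 dvd \<epsilon> * (a * c' - c * a')" using dA dC by (simp add: dvd_mult)
        hence 2: "P l2 dvd a * c' - c * a'" by (rule unit_dvd_cancel[OF eps_unit])
        have "\<epsilon> * (\<epsilon> * (d * a' - b * c' - (a * d' - c * b'))) =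
            \<epsilon> * \<epsilon> * (d * a' - a * d') - (\<epsilon> * b) * (\<epsilon> * c') + (\<epsilon> * c) * (\<epsilon> * b')"
          by (simp add: algebra_simps)
        also have "\<dots> = d * d' * (\<iota> d0 * \<iota> (\<alpha>' - \<alpha>) + (\<iota> \<gamma> * \<iota> (\<beta>' - \<beta>) - \<iota> \<beta> * \<iota> (\<gamma>' - \<gamma>)))"
          unfolding m0(3,4) m1(3,4) eps_sq unfolding m0(2) m1(2) by (simp add: hom algebra_simps)
        finally have "P l2 dvd \<epsilon> * (\<epsilon> * (d * a' - b * c' - (a * d' - c * b')))" using dA dB dC by (simp add: dvd_mult)
        hence "P l2 dvd d * a' - b * c' - (a * d' - c * b')" using unit_dvd_cancel[OF eps_unit] by blast
        hence 3: "P l2 dvd e * (d * a' - b * c') - e * (a * d' - c * b')" unfolding right_diff_distrib[symmetric] by (rule dvd_mult)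
        have "z \<in> G" unfolding g(3) by (intro multG minv_props(1) g0G gG)
        thus "z \<in> NN" unfolding zm Ngrp_iff using dvd_mult[OF 1, of e] dvd_mult[OF 2, of e] 3 by blast
      qed
    qed
  qed
  also have "\<dots> \<le> q ^ (l2 + 2 * (l2 - l1)) * card NN" using cim by (rule mult_le_mono1)
  finally show ?thesis by (simp add: A_def)
qed

section \<open>Multiplicities for odd l\<close>

lemma conj_upper:
  "minv (mat2 1 x 0 1) * mat2 a b c d * mat2 1 x 0 1 = mat2 (a - c * x) (b + x * (a - d) - c * x * x) c (d + c * x)"
  using conj_entries[of 1 1 x 0 1 a b c d] by (simp add: algebra_simps)

text \<open>
  Conjugation by upper unipotent elements congruent to 1 modulo \<open>\<pi>\<close>\<open>\<^bsup>l1\<^esup>\<close> fixes N pointwise but permutes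
  the q extensions of \<open>\<mu>\<close> to the larger abelian group \<open>Ngrp l1\<close> freely, as in a Heisenberg group.
\<close>
lemma rep_mult_ge_odd:
  assumes odd: "odd l" and r: "is_rep G n \<rho>" and m: "\<mu> \<in> lchar NN" and o: "over_psi \<mu>"
    and nz: "rep_mult NN \<rho> \<mu> \<noteq> 0"
  shows "\<exists>k\<ge>q. rep_mult NN \<rho> \<mu> = of_nat k"
proof -
  let ?M = "Ngrp l1"
  have ll: "l2 = Suc l1" "l = Suc (l1 + l1)" using odd by presburger+
  interpret M: abelian_subgroup G ?M by (rule N_locale) (use l1_le in auto)
  have sub: "NN \<subseteq> ?M" using P_dvd[OF l1_le] dvd_trans by (auto simp: Ngrp_def)
  interpret T: abelian_tower G ?M NN by unfold_locales (rule sub)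
  obtain \<nu> where \<nu>: "\<nu> \<in> lchar ?M" "\<forall>g\<in>NN. \<nu> g = \<mu> g" "rep_mult ?M \<rho> \<nu> \<noteq> 0"
    using T.extension_exists[OF r m nz] by blast
  define X where "X s = \<epsilon> * \<iota> (\<pi> ^ l1 * s)" for s
  define Y where "Y s = mat2 1 (X s) 0 1" for s
  have XP: "P l1 dvd X s" for s by (simp add: X_def hom dvd_mult dvd_mult2)
  have YG: "Y s \<in> G" for s unfolding Y_def X_def by (rule G_upper)
  have PP: "P l2 dvd P l1 * P l1"
  proof -
    have "P l1 * P l1 = P (l1 + l1)" by (simp only: power_add hom_mult)
    thus ?thesis using P_dvd[of l2 "l1 + l1"] l2_le by (simp add: mult_2)
  qed
  have PPd: "P l2 dvd x * y" if "P l1 dvd x" "P l1 dvd y" for x y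
    using mult_dvd_mono[OF that] PP dvd_trans by blast
  have norm: "M.normalizes (Y s)" for s
    unfolding M.normalizes_def
  proof (intro conjI ballI YG)
    fix g assume g: "g \<in> ?M"
    hence gG: "g \<in> G" using Ngrp_sub by auto
    obtain a b c d where gm: "g = mat2 a b c d" using mat2_cases[OF carr[OF gG]] .
    have dv: "P l2 dvd b" "P l2 dvd c" "P l1 dvd a - d" using g unfolding gm Ngrp_iff by auto
    have z: "c * X s = 0" using P_zero[OF dv(2) XP] l12 by simp
    have "minv (Y s) * g * Y s \<in> G" by (intro multG minv_props(1) YG gG)
    thus "minv (Y s) * g * Y s \<in> ?M"
      unfolding Y_def gm conj_upper Ngrp_iff z using dv PPd[OF XP dv(3)] by simp
  qed
  have fix_N: "minv (Y s) * g * Y s = g" if g: "g \<in> NN" for s g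
  proof -
    have gG: "g \<in> G" using g Ngrp_sub by auto
    obtain a b c d where gm: "g = mat2 a b c d" using mat2_cases[OF carr[OF gG]] .
    have dv: "P l2 dvd c" "P l2 dvd a - d" using g unfolding gm Ngrp_iff by auto
    have "c * X s = 0" "X s * (a - d) = 0" using P_zero[OF dv(1) XP] P_zero[OF XP dv(2)] l12 by simp_all
    thus ?thesis unfolding Y_def gm conj_upper by simp
  qed
  define Q where "Q = (\<lambda>s. conj_char ?M (Y s) \<nu>) ` UNIV"
  have "q \<le> card Q"
  proof -
    have "q = card ((\<lambda>s. \<pi> ^ (l - 1) * s) ` UNIV)" by (simp add: residue_card_eq pideal_def)
    also have "\<dots> \<le> card Q" unfolding Q_def
    proof (rule card_image_le_card_image[OF finite_ring])
      fix s s' assume eq: "conj_char ?M (Y s) \<nu> = conj_char ?M (Y s') \<nu>"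
      have "2 * d0 * (\<pi> ^ (l - 1) * (s - s')) = 0"
      proof (rule psi_nondegenerate)
        fix t
        \<comment> \<open>The diagonal matrix with entries u and its inverse lies in
          \<open>Ngrp l1\<close>, and for odd l it separates the conjugates of \<open>\<nu>\<close>:
          conjugation by \<open>Y r\<close> multiplies its value by \<open>\<psi>\<close> of the
          image of \<open>2 * d0 * \<pi> ^ (l - 1) * r * t\<close>.\<close>
        define u where "u = 1 + \<pi> ^ l1 * t"
        have "\<pi> dvd \<pi> ^ l1" using l1_pos by (intro dvd_power) auto
        hence "u dvd 1" unfolding u_def by (intro unit_add_pi) (auto simp: dvd_mult2)
        then obtain w where w: "u * w = 1" by (auto simp: dvd_one_iff)
        define x where "x = mat2 (\<iota> u) 0 0 (\<iota> w)"
        have xG: "x \<in> G" unfolding x_def by (rule G_torus[OF w])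
        have uw: "\<iota> u * \<iota> w = 1" by (simp add: hom_mult[symmetric] w hom_one)
        have e0: "u - w = \<pi> ^ l1 * (t + t * w)"
        proof -
          have "w - 1 = w - u * w" by (simp add: w)
          also have "\<dots> = - (\<pi> ^ l1 * t * w)" by (simp add: u_def algebra_simps)
          finally have "w = 1 - \<pi> ^ l1 * t * w" by (simp add: algebra_simps)
          hence "u - w = u - (1 - \<pi> ^ l1 * t * w)" by simp
          thus ?thesis by (simp add: u_def algebra_simps)
        qed
        have "\<iota> u - \<iota> w = P l1 * \<iota> (t + t * w)" unfolding hom_diff[symmetric] e0 hom_mult by simp
        hence duw: "P l1 dvd \<iota> u - \<iota> w" by simp
        have xM: "x \<in> ?M" using xG duw unfolding x_def Ngrp_iff by simp
        have val: "conj_char ?M (Y r) \<nu> x = \<nu> x * \<psi> (\<iota> (2 * d0 * (\<pi> ^ (l - 1) * r) * t))" for r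
        proof -
          define k where "k = mat2 1 (X r * (\<iota> u - \<iota> w) * \<iota> u) 0 1"
          have "k = mat2 1 (\<epsilon> * \<iota> (\<pi> ^ l1 * r * (u - w) * u)) 0 1" by (simp add: k_def X_def hom mult_ac)
          hence "k \<in> G" using G_upper by simp
          hence kK: "k \<in> Kgrp" using PPd[OF XP duw] unfolding k_def Kgrp_iff by (simp add: dvd_mult2)
          have "minv (Y r) * x * Y r = k * x" unfolding Y_def x_def conj_upper k_def
            using uw by (simp add: mult.assoc)
          hence "conj_char ?M (Y r) \<nu> x = \<nu> (k * x)" using xM by (simp add: conj_char_def)
          also have "\<dots> = \<nu> k * \<nu> x"
            using M.N.lcharD(1)[OF \<nu>(1) _ xM, of k] kK Kgrp_Ngrp[OF l1_le] by auto
          also have "\<nu> k = \<mu> k" using \<nu>(2) kK Kgrp_Ngrp[of l2] by auto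
          also have "\<dots> = \<psi> (\<epsilon> * (X r * (\<iota> u - \<iota> w) * \<iota> u))" using o kK by (simp add: over_psi_def k_def)
          also have "\<epsilon> * (X r * (\<iota> u - \<iota> w) * \<iota> u) = \<epsilon> * \<epsilon> * \<iota> (\<pi> ^ l1 * r * ((u - w) * u))"
            by (simp add: X_def hom mult_ac)
          also have "(u - w) * u = u * u - 1" using w by (simp add: algebra_simps)
          also have "u * u - 1 = 2 * (\<pi> ^ l1 * t) + \<pi> ^ l1 * \<pi> ^ l1 * t * t" by (simp add: u_def algebra_simps)
          also have "\<pi> ^ l1 * r * (2 * (\<pi> ^ l1 * t) + \<pi> ^ l1 * \<pi> ^ l1 * t * t) =
              2 * (\<pi> ^ l1 * \<pi> ^ l1) * r * t + (\<pi> ^ l1 * \<pi> ^ l1 * \<pi> ^ l1) * r * t * t"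
            by (simp add: algebra_simps)
          also have "\<pi> ^ l1 * \<pi> ^ l1 * \<pi> ^ l1 = \<pi> ^ (l1 + l1 + l1)" by (simp only: power_add)
          \<comment> \<open>Here l = 2 l1 + 1 with l1 at least 1, so 3 l1 reaches l and only the
            term of order l - 1 survives.\<close>
          also have "\<pi> ^ (l1 + l1 + l1) = 0" by (rule pi_pow_0) (use ll l1_pos in linarith)
          also have "\<pi> ^ l1 * \<pi> ^ l1 = \<pi> ^ (l - 1)" using ll by (metis diff_Suc_1 power_add)
          also have "\<epsilon> * \<epsilon> * \<iota> (2 * \<pi> ^ (l - 1) * r * t + 0 * r * t * t) = \<iota> (2 * d0 * (\<pi> ^ (l - 1) * r) * t)"
            unfolding eps_sq hom_mult[symmetric] by (rule arg_cong[of _ _ \<iota>]) (simp add: mult_ac)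
          finally show ?thesis by (simp add: mult.commute)
        qed
        have "\<nu> x \<noteq> 0" using M.N.lchar_norm[OF \<nu>(1) xM] by auto
        hence "\<psi> (\<iota> (2 * d0 * (\<pi> ^ (l - 1) * s) * t)) = \<psi> (\<iota> (2 * d0 * (\<pi> ^ (l - 1) * s') * t))"
          using fun_cong[OF eq, of x] unfolding val by simp
        from psi_diff[OF this] show "\<psi> (\<iota> (2 * d0 * (\<pi> ^ (l - 1) * (s - s')) * t)) = 1"
          unfolding hom_diff[symmetric] by (simp add: algebra_simps)
      qed
      hence "\<pi> ^ (l - 1) * (s - s') = 0" using unit_cancel[OF unit_mult[OF two_unit d0_unit], of _ 0] by simp
      thus "\<pi> ^ (l - 1) * s = \<pi> ^ (l - 1) * s'" by (simp add: right_diff_distrib)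
    qed
    finally show ?thesis .
  qed
  moreover have "\<eta> \<in> lchar ?M \<and> (\<forall>g\<in>NN. \<eta> g = \<mu> g) \<and> rep_mult ?M \<rho> \<eta> \<noteq> 0" if "\<eta> \<in> Q" for \<eta>
  proof -
    obtain s where s: "\<eta> = conj_char ?M (Y s) \<nu>" using \<open>\<eta> \<in> Q\<close> by (auto simp: Q_def)
    have "\<eta> \<in> lchar ?M" unfolding s by (rule M.conj_char_lchar[OF norm \<nu>(1)])
    moreover have "\<eta> g = \<mu> g" if "g \<in> NN" for g
      using that \<nu>(2) sub fix_N[OF that] unfolding s conj_char_def by auto
    moreover have "rep_mult ?M \<rho> \<eta> = rep_mult ?M \<rho> \<nu>"
      unfolding s using M.trace_conj[OF r YG] Ngrp_sub by (intro M.char_mult_conj[OF norm]) auto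
    ultimately show ?thesis using \<nu>(3) by simp
  qed
  ultimately show ?thesis using T.mult_ge_card[OF r m, of Q] le_trans by blast
qed

text \<open>\<open>l2 - l1\<close> is the parity of l. For even l the bound only says that a nonzero
  multiplicity is a positive integer.\<close>

lemma rep_mult_ge:
  assumes r: "is_rep G n \<rho>" and m: "\<mu> \<in> lchar NN" and o: "over_psi \<mu>"
    and nz: "rep_mult NN \<rho> \<mu> \<noteq> 0"
  shows "\<exists>k\<ge>q ^ (l2 - l1). rep_mult NN \<rho> \<mu> = of_nat k"
proof (cases "odd l")
  case True
  hence "l2 - l1 = 1" by presburger
  thus ?thesis using rep_mult_ge_odd[OF True assms] by simp
next
  case False
  hence "l2 - l1 = 0" by presburger
  moreover obtain L where L: "\<forall>\<mu>\<in>lchar NN. rep_mult NN \<rho> \<mu> = of_nat (count_list L \<mu>)"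
    using N.rep_lchar_list[OF r] by blast
  moreover have "count_list L \<mu> \<ge> 1" using L m nz by (cases "count_list L \<mu>") auto
  ultimately show ?thesis using m by (intro exI[of _ "count_list L \<mu>"]) auto
qed

section \<open>From the hypothesis on \<open>psi_A\<close> to the final count\<close>

lemma hom_power: "\<iota> (x ^ k) = \<iota> x ^ k" by (induction k) (auto simp: hom)

lemma Kgrp_form:
  assumes B: "B \<in> carrier_mat 2 2"
  shows "(1\<^sub>m 2 + \<iota> \<pi> ^ l2 \<cdot>\<^sub>m B) $$ (0, Suc 0) = P l2 * B $$ (0, Suc 0)"
    "\<iota> \<pi> ^ l2 * mat_tr (Amat \<epsilon> * B) = \<epsilon> * (P l2 * B $$ (0, Suc 0))"
    "1\<^sub>m 2 + \<iota> \<pi> ^ l2 \<cdot>\<^sub>m B \<in> G \<Longrightarrow> 1\<^sub>m 2 + \<iota> \<pi> ^ l2 \<cdot>\<^sub>m B \<in> Kgrp"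
proof -
  obtain a b c d where Bm: "B = mat2 a b c d" using mat2_cases[OF B] .
  show "(1\<^sub>m 2 + \<iota> \<pi> ^ l2 \<cdot>\<^sub>m B) $$ (0, Suc 0) = P l2 * B $$ (0, Suc 0)"
    using B by (simp add: hom_power)
  have "Amat \<epsilon> = mat2 0 0 \<epsilon> 0" unfolding Amat_def mat2_def by (rule eq_matI) (auto simp: less_2_cases_iff)
  thus "\<iota> \<pi> ^ l2 * mat_tr (Amat \<epsilon> * B) = \<epsilon> * (P l2 * B $$ (0, Suc 0))"
    by (simp add: Bm mat_tr_def numeral_2_eq_2 hom_power mult_ac)
  show "1\<^sub>m 2 + \<iota> \<pi> ^ l2 \<cdot>\<^sub>m B \<in> Kgrp" if "1\<^sub>m 2 + \<iota> \<pi> ^ l2 \<cdot>\<^sub>m B \<in> G"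
    using that B by (simp add: Kgrp_def hom_power)
qed

lemma Kgrp_form_ex:
  assumes k: "k \<in> Kgrp"
  shows "\<exists>B\<in>carrier_mat 2 2. k = 1\<^sub>m 2 + \<iota> \<pi> ^ l2 \<cdot>\<^sub>m B"
proof -
  have kG: "k \<in> G" using k Kgrp_sub by auto
  obtain a b c d where km: "k = mat2 a b c d" using mat2_cases[OF carr[OF kG]] .
  have "P l2 dvd b" "P l2 dvd c" "P l2 dvd a - 1" "P l2 dvd d - 1" using k unfolding km Kgrp_iff by auto
  then obtain b' c' a' d' where "b = P l2 * b'" "c = P l2 * c'" "a - 1 = P l2 * a'" "d - 1 = P l2 * d'"
    by (auto elim!: dvdE)
  hence "k = 1\<^sub>m 2 + \<iota> \<pi> ^ l2 \<cdot>\<^sub>m mat2 a' b' c' d'"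
    unfolding km by (intro mat2_eqI) (auto simp: hom_power algebra_simps)
  thus ?thesis by (intro bexI[of _ "mat2 a' b' c' d'"]) auto
qed

text \<open>The given eigenvector makes \<open>psi_A\<close> occur on K with positive multiplicity,
  and a character of K that occurs extends to one of N that occurs.\<close>

lemma exists_lchar_over_psi:
  assumes r: "is_rep G n \<rho>" and c: "contains_psiA G (\<iota> \<pi>) l2 (Amat \<epsilon>) \<psi> n \<rho>"
  shows "\<exists>\<mu>\<in>lchar NN. over_psi \<mu> \<and> rep_mult NN \<rho> \<mu> \<noteq> 0"
proof -
  interpret K: abelian_subgroup G Kgrp by (rule K_locale)
  interpret T: abelian_tower G NN Kgrp by unfold_locales (rule Kgrp_Ngrp, simp)
  obtain v where v: "v \<in> carrier_vec n" "v \<noteq> 0\<^sub>v n"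
    and ev: "\<forall>B\<in>carrier_mat 2 2. 1\<^sub>m 2 + \<iota> \<pi> ^ l2 \<cdot>\<^sub>m B \<in> G \<longrightarrow>
            \<rho> (1\<^sub>m 2 + \<iota> \<pi> ^ l2 \<cdot>\<^sub>m B) *\<^sub>v v = \<psi> (\<iota> \<pi> ^ l2 * mat_tr (Amat \<epsilon> * B)) \<cdot>\<^sub>v v"
    using c unfolding contains_psiA_def by blast
  define \<mu> where "\<mu> k = (if k \<in> Kgrp then \<psi> (\<epsilon> * k $$ (0, Suc 0)) else 0)" for k
  have evK: "\<rho> k *\<^sub>v v = \<mu> k \<cdot>\<^sub>v v" if k: "k \<in> Kgrp" for k
  proof -
    obtain B where B: "B \<in> carrier_mat 2 2" "k = 1\<^sub>m 2 + \<iota> \<pi> ^ l2 \<cdot>\<^sub>m B" using Kgrp_form_ex[OF k] by blast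
    have "k \<in> G" using k Kgrp_sub by auto
    hence "\<rho> k *\<^sub>v v = \<psi> (\<iota> \<pi> ^ l2 * mat_tr (Amat \<epsilon> * B)) \<cdot>\<^sub>v v" using ev B by auto
    thus ?thesis using k Kgrp_form(1,2)[OF B(1)] by (simp add: \<mu>_def B(2))
  qed
  have "\<mu> \<in> lchar Kgrp"
    unfolding lchar_def
  proof (intro CollectI conjI ballI allI impI)
    fix g h assume gh: "g \<in> Kgrp" "h \<in> Kgrp"
    have G: "g \<in> G" "h \<in> G" using gh Kgrp_sub by auto
    obtain a b c d where g: "g = mat2 a b c d" using mat2_cases[OF carr[OF G(1)]] .
    obtain a' b' c' d' where h: "h = mat2 a' b' c' d'" using mat2_cases[OF carr[OF G(2)]] .
    have dv: "P l2 dvd b" "P l2 dvd a - 1" "P l2 dvd b'" "P l2 dvd d' - 1"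
      using gh unfolding g h Kgrp_iff by auto
    \<comment> \<open>Products of two multiples of the \<open>l2\<close>-th power of
      \<open>\<pi>\<close> vanish, so the upper right entry is additive on K and
      \<open>psi_A\<close> is a homomorphism.\<close>
    have z: "(a - 1) * b' = 0" "b * (d' - 1) = 0" using P_zero[OF dv(2,3)] P_zero[OF dv(1,4)] by simp_all
    have "a * b' + b * d' = b' + b + (a - 1) * b' + b * (d' - 1)" by (simp add: algebra_simps)
    hence "(g * h) $$ (0, Suc 0) = b + b'" using z by (simp add: g h)
    moreover have "g * h \<in> Kgrp" by (rule K.N.multG[OF gh])
    ultimately show "\<mu> (g * h) = \<mu> g * \<mu> h" using gh
      by (simp add: \<mu>_def distrib_left psi_add) (simp add: g h)
  next
    show "\<mu> (1\<^sub>m 2) = 1" using K.N.oneG by (simp add: \<mu>_def psi_zero)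
  qed (simp add: \<mu>_def)
  note mK = this
  obtain k where "k > 0" "rep_mult Kgrp \<rho> \<mu> = of_nat k"
    using K.mult_pos_of_eigenvector[OF r v mK evK] by blast
  hence "rep_mult Kgrp \<rho> \<mu> \<noteq> 0" by simp
  from T.extension_exists[OF r mK this] show ?thesis by (auto simp: over_psi_def \<mu>_def)
qed

theorem tensor_bound: "tensor_bound_claim G (\<iota> \<pi>) l \<epsilon> \<psi> q"
  unfolding tensor_bound_claim_def Let_def
proof (intro allI impI, elim conjE)
  fix n1 \<rho>1 n2 \<rho>2
  assume i1: "irrep G n1 \<rho>1" and c1: "contains_psiA G (\<iota> \<pi>) l2 (Amat \<epsilon>) \<psi> n1 \<rho>1"
    and i2: "irrep G n2 \<rho>2" and c2: "contains_psiA G (\<iota> \<pi>) l2 (Amat \<epsilon>) \<psi> n2 \<rho>2"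
  have r1: "is_rep G n1 \<rho>1" and r2: "is_rep G n2 \<rho>2" using i1 i2 by (auto simp: irrep_def)
  obtain \<mu> where m: "\<mu> \<in> lchar NN" "over_psi \<mu>" "rep_mult NN \<rho>1 \<mu> \<noteq> 0"
    using exists_lchar_over_psi[OF r1 c1] by blast
  obtain \<nu> where n: "\<nu> \<in> lchar NN" "over_psi \<nu>" "rep_mult NN \<rho>2 \<nu> \<noteq> 0"
    using exists_lchar_over_psi[OF r2 c2] by blast
  define \<kappa> where "\<kappa> = joint_char \<mu> \<nu>"
  have k: "\<kappa> \<in> lchar NN" "over_psi \<kappa>" unfolding \<kappa>_def using joint_char_lchar joint_char_over_psi m n by auto
  define d where "d = q ^ (l2 - l1)"
  have d: "d > 0" using q_ge_3 by (simp add: d_def)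
  have md: "\<exists>k\<ge>d. rep_mult NN \<rho>1 (conj_char NN x \<mu>) = of_nat k" if x: "x \<in> G" for x
  proof -
    have "rep_mult NN \<rho>1 (conj_char NN x \<mu>) = rep_mult NN \<rho>1 \<mu>"
      using N.trace_conj[OF r1 x] Ngrp_sub by (intro N.char_mult_conj[OF N.normalizesI[OF x]]) auto
    thus ?thesis using rep_mult_ge[OF r1 m] unfolding d_def by simp
  qed
  have nd: "\<exists>k\<ge>d. rep_mult NN \<rho>2 (conj_char NN x \<nu>) = of_nat k" if x: "x \<in> G" for x
  proof -
    have "rep_mult NN \<rho>2 (conj_char NN x \<nu>) = rep_mult NN \<rho>2 \<nu>"
      using N.trace_conj[OF r2 x] Ngrp_sub by (intro N.char_mult_conj[OF N.normalizesI[OF x]]) auto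
    thus ?thesis using rep_mult_ge[OF r2 n] unfolding d_def by simp
  qed
  define A where "A = (\<lambda>(c, \<beta>). conj_char NN (pair_elt c \<beta>) \<mu>) ` pairs"
  have finA: "finite A"
  proof -
    have "finite (UNIV :: 'r set)" by (rule finite_ring)
    hence "finite pairs" by (meson finite_Prod_UNIV finite_subset subset_UNIV)
    thus ?thesis by (simp add: A_def)
  qed
  have A: "\<exists>c \<beta>. \<eta> = conj_char NN (pair_elt c \<beta>) \<mu> \<and> c dvd 1 \<and> 1 - c dvd 1 \<and> \<pi> ^ (l1 - l1 div 2) dvd \<beta>" if "\<eta> \<in> A" for \<eta>
    using that by (auto simp: A_def pairs_def)
  have "\<exists>D\<ge>d * d * card A. rep_mult NN (tensor_rep \<rho>1 \<rho>2) \<kappa> = of_nat D"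
  proof (rule N.mult_tensor_ge[OF r1 r2 k(1) finA _ d])
    show "A \<subseteq> lchar NN"
      using A N.conj_char_lchar[OF N.normalizesI[OF pair_elt(1)] m(1)] by blast
  next
    fix \<eta> assume eta: "\<eta> \<in> A"
    obtain c \<beta> where cb: "\<eta> = conj_char NN (pair_elt c \<beta>) \<mu>" "c dvd 1" "1 - c dvd 1" "\<pi> ^ (l1 - l1 div 2) dvd \<beta>"
      using A[OF eta] by blast
    show "\<exists>k\<ge>d. rep_mult NN \<rho>1 \<eta> = of_nat k" unfolding cb(1) by (rule md[OF pair_elt(1)[OF cb(2)]])
    obtain y where y: "y \<in> G" "\<forall>x\<in>NN. \<kappa> x = \<eta> x * conj_char NN y \<nu> x"
      using joint_char_factor[OF m(1,2) n(1,2) cb(2,3,4)] unfolding \<kappa>_def cb(1) by blast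
    show "\<exists>\<nu>\<in>lchar NN. (\<forall>n\<in>NN. \<kappa> n = \<eta> n * \<nu> n) \<and>
        (\<exists>k\<ge>d. rep_mult NN \<rho>2 \<nu> = of_nat k)"
      using y nd[OF y(1)] N.conj_char_lchar[OF N.normalizesI[OF y(1)] n(1)] by blast
  qed
  then obtain D where D: "d * d * card A \<le> D" "rep_mult NN (tensor_rep \<rho>1 \<rho>2) \<kappa> = of_nat D" by blast
  define M where "M = (q - 2) * q ^ (l1 - 1) * q ^ (l1 div 2)"
  have "d * d * M \<le> d * d * card A" using card_pairs[OF m(2)] unfolding M_def A_def by (rule mult_le_mono2)
  hence MD: "d * d * M \<le> D" using D(1) by linarith
  have Mpos: "d * d * M > 0" using d q_ge_3 by (simp add: M_def)
  obtain n0 \<rho> v where \<rho>: "irrep G n0 \<rho>" and v: "v \<in> carrier_vec n0" "v \<noteq> 0\<^sub>v n0" "\<forall>g\<in>NN. \<rho> g *\<^sub>v v = \<kappa> g \<cdot>\<^sub>v v"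
    and bd: "real (d * d * M) \<le> real (q ^ (l2 + 2 * (l2 - l1))) * Re (rep_inner G (tensor_rep \<rho>1 \<rho>2) \<rho>)"
    using N.tensor_constituent[OF r1 r2 k(1) card_stab[OF k(2)] D(2) MD Mpos] by blast
  have "contains_psiA G (\<iota> \<pi>) l2 (Amat \<epsilon>) \<psi> n0 \<rho>"
    unfolding contains_psiA_def
  proof (intro bexI[of _ v] conjI ballI impI)
    fix B assume B: "B \<in> carrier_mat 2 2" "1\<^sub>m 2 + \<iota> \<pi> ^ l2 \<cdot>\<^sub>m B \<in> G"
    have K: "1\<^sub>m 2 + \<iota> \<pi> ^ l2 \<cdot>\<^sub>m B \<in> Kgrp" by (rule Kgrp_form(3)[OF B])
    have "\<kappa> (1\<^sub>m 2 + \<iota> \<pi> ^ l2 \<cdot>\<^sub>m B) = \<psi> (\<iota> \<pi> ^ l2 * mat_tr (Amat \<epsilon> * B))"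
      using k(2) K Kgrp_form(1,2)[OF B(1)] unfolding over_psi_def by metis
    thus "\<rho> (1\<^sub>m 2 + \<iota> \<pi> ^ l2 \<cdot>\<^sub>m B) *\<^sub>v v = \<psi> (\<iota> \<pi> ^ l2 * mat_tr (Amat \<epsilon> * B)) \<cdot>\<^sub>v v"
      using v(3) K Kgrp_Ngrp[of l2] by auto
  qed (use v in auto)
  moreover have "(real q - 2) * real q powi (int (l1 div 2) + int l1 - int l2 - 1)
      \<le> Re (rep_inner G (tensor_rep \<rho>1 \<rho>2) \<rho>)"
  proof -
    define x where "x = real q"
    have x: "x > 0" using q_ge_3 by (simp add: x_def)
    have q2: "real (q - 2) = x - 2" using q_ge_3 by (simp add: x_def of_nat_diff)
    let ?e = "int (l1 div 2) + int l1 - int l2 - 1"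
    let ?s = "l2 + 2 * (l2 - l1)"
    have "real (d * d * M) = (x - 2) * x ^ ((l2 - l1) + (l2 - l1) + (l1 - 1) + l1 div 2)"
      by (simp only: d_def M_def power_add of_nat_mult of_nat_power q2 x_def[symmetric] mult_ac)
    also have "x ^ ((l2 - l1) + (l2 - l1) + (l1 - 1) + l1 div 2) = x ^ ?s * x powi ?e"
    proof -
      \<comment> \<open>Subtracting the exponent of the stabilizer index from that of the number of
        weighted pairs. The difference can be negative, already for l = 2, which is why integer
        exponents appear.\<close>
      have "int ((l2 - l1) + (l2 - l1) + (l1 - 1) + l1 div 2) = int ?s + ?e" using l1_pos l1_le by simp
      hence "x powi int ((l2 - l1) + (l2 - l1) + (l1 - 1) + l1 div 2) = x powi (int ?s + ?e)" by (rule arg_cong)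
      also have "\<dots> = x powi int ?s * x powi ?e" using x by (intro power_int_add) auto
      finally show ?thesis by (simp only: power_int_of_nat)
    qed
    finally have "x ^ ?s * ((x - 2) * x powi ?e) \<le> x ^ ?s * Re (rep_inner G (tensor_rep \<rho>1 \<rho>2) \<rho>)"
      using bd by (simp add: x_def mult_ac)
    thus ?thesis using x by (simp add: x_def)
  qed
  ultimately show "\<exists>n \<rho>. irrep G n \<rho> \<and> contains_psiA G (\<iota> \<pi>) l2 (Amat \<epsilon>) \<psi> n \<rho> \<and>
           (real q - 2) * real q powi (int (l1 div 2) + int l1 - int l2 - 1)
             \<le> Re (rep_inner G (tensor_rep \<rho>1 \<rho>2) \<rho>)" using \<rho> by blast
qed

end

section \<open>General linear and unitary groups\<close>

lemma invertible_mat2_iff: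
  assumes A: "(A :: 'a::comm_ring_1 mat) \<in> carrier_mat 2 2"
  shows "invertible_mat A \<longleftrightarrow> (\<exists>B\<in>carrier_mat 2 2. A * B = 1\<^sub>m 2 \<and> B * A = 1\<^sub>m 2)"
proof
  assume "invertible_mat A"
  then obtain B where B: "A * B = 1\<^sub>m 2" "B * A = 1\<^sub>m (dim_row B)"
    using A by (auto simp: invertible_mat_def inverts_mat_def)
  have "dim_col B = 2" using arg_cong[OF B(1), of dim_col] by simp
  moreover have "dim_row B = 2" using arg_cong[OF B(2), of dim_col] A by simp
  ultimately show "\<exists>B\<in>carrier_mat 2 2. A * B = 1\<^sub>m 2 \<and> B * A = 1\<^sub>m 2"
    using B by (intro bexI[of _ B]) auto
next
  assume "\<exists>B\<in>carrier_mat 2 2. A * B = 1\<^sub>m 2 \<and> B * A = 1\<^sub>m 2"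
  thus "invertible_mat A" using A unfolding invertible_mat_def inverts_mat_def square_mat.simps by (metis carrier_matD)
qed

lemma invertible_mat2:
  assumes "(a * d - b * c) * e = 1"
  shows "invertible_mat (mat2 a b c d)"
  unfolding invertible_mat2_iff[OF mat2_carrier]
  using assms by (intro bexI[of _ "mat2 (e * d) (- (e * b)) (- (e * c)) (e * a)"])
    (auto simp: mat2_one algebra_simps)

lemma finite_carrier_mat2:
  assumes "finite (UNIV :: 'a::comm_ring_1 set)"
  shows "finite (carrier_mat 2 2 :: 'a mat set)"
proof -
  have "carrier_mat 2 2 \<subseteq> (\<lambda>(a, b, c, d). mat2 a b c d) ` (UNIV :: ('a \<times> 'a \<times> 'a \<times> 'a) set)"
  proof
    fix A :: "'a mat" assume "A \<in> carrier_mat 2 2"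
    then obtain a b c d where "A = mat2 a b c d" by (rule mat2_cases)
    thus "A \<in> (\<lambda>(a, b, c, d). mat2 a b c d) ` UNIV" by (intro image_eqI[of _ _ "(a, b, c, d)"]) auto
  qed
  thus ?thesis using assms by (meson finite_Prod_UNIV finite_imageI finite_subset)
qed

lemma mat2_mult_closed: "A \<in> carrier_mat 2 2 \<Longrightarrow> B \<in> carrier_mat 2 2 \<Longrightarrow> A * B \<in> carrier_mat 2 2"
  by simp

lemma mat2_assoc:
  "(A :: 'a::comm_ring_1 mat) \<in> carrier_mat 2 2 \<Longrightarrow> B \<in> carrier_mat 2 2 \<Longrightarrow> C \<in> carrier_mat 2 2 \<Longrightarrow> A * B * C = A * (B * C)"
  by (rule assoc_mult_mat)

lemma invertible_mult2:
  assumes A: "(A :: 'a::comm_ring_1 mat) \<in> carrier_mat 2 2" "invertible_mat A" and B: "B \<in> carrier_mat 2 2" "invertible_mat B"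
  shows "invertible_mat (A * B)"
proof -
  obtain A' where A': "A' \<in> carrier_mat 2 2" "A * A' = 1\<^sub>m 2" "A' * A = 1\<^sub>m 2" using A invertible_mat2_iff by blast
  obtain B' where B': "B' \<in> carrier_mat 2 2" "B * B' = 1\<^sub>m 2" "B' * B = 1\<^sub>m 2" using B invertible_mat2_iff by blast
  have "B * (B' * A') = A'" using A B A' B' by (simp add: mat2_assoc[symmetric])
  hence "A * B * (B' * A') = 1\<^sub>m 2" using A B A' B' by (simp add: mat2_assoc)
  moreover have "A' * (A * B) = B" using A B A' B' by (simp add: mat2_assoc[symmetric])
  hence "B' * A' * (A * B) = 1\<^sub>m 2" using A B A' B' by (simp add: mat2_assoc)
  ultimately have "A * B * (B' * A') = 1\<^sub>m 2" "B' * A' * (A * B) = 1\<^sub>m 2" .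
  thus ?thesis using A B A' B' unfolding invertible_mat2_iff[OF mat2_mult_closed[OF A(1) B(1)]]
    by (intro bexI[of _ "B' * A'"]) auto
qed

lemma GL2_group:
  assumes "finite (UNIV :: 'a::comm_ring_1 set)"
  shows "mat_group (GL2 :: 'a mat set)"
proof
  show "finite (GL2 :: 'a mat set)" using finite_carrier_mat2[OF assms] by (simp add: GL2_def)
  show "GL2 \<subseteq> (carrier_mat 2 2 :: 'a mat set)" by (auto simp: GL2_def)
  show "1\<^sub>m 2 \<in> (GL2 :: 'a mat set)" unfolding GL2_def mat2_one using invertible_mat2[of 1 1 0 0 1] by simp
  show "A * B \<in> GL2" if "A \<in> GL2" "B \<in> GL2" for A B :: "'a mat"
    using that invertible_mult2 by (auto simp: GL2_def)
  show "\<exists>B\<in>GL2. A * B = 1\<^sub>m 2 \<and> B * A = 1\<^sub>m 2" if "A \<in> GL2" for A :: "'a mat"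
    using that invertible_mat2_iff unfolding GL2_def by blast
qed

section \<open>The quadratic extension and the unitary group\<close>

lemma star_mat2:
  fixes \<sigma> :: "'a::comm_ring_1 \<Rightarrow> 'a"
  shows "star_mat \<sigma> (mat2 a b c d) = mat2 (\<sigma> d) (\<sigma> b) (\<sigma> c) (\<sigma> a)"
proof -
  have W: "(Wmat :: 'a mat) = mat2 0 1 1 0" unfolding Wmat_def mat2_def by (rule eq_matI) (auto simp: less_2_cases_iff)
  have M: "mat 2 2 (\<lambda>(i, j). \<sigma> (mat2 a b c d $$ (j, i))) = mat2 (\<sigma> a) (\<sigma> c) (\<sigma> b) (\<sigma> d)"
    by (rule mat2_eqI) auto
  show ?thesis unfolding star_mat_def W M by simp
qed

locale quad_setup =
  fixes d :: "'r::comm_ring_1" and \<iota> :: "'r \<Rightarrow> 'k::comm_ring_1" and \<theta> :: 'k and \<sigma> :: "'k \<Rightarrow> 'k"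
  assumes qe: "quad_ext d \<iota> \<theta> \<sigma>" and two: "(2::'r) dvd 1"
begin

lemma i_add: "\<iota> (x + y) = \<iota> x + \<iota> y" and i_mult: "\<iota> (x * y) = \<iota> x * \<iota> y" and i_one: "\<iota> 1 = 1"
  and th_sq: "\<theta> * \<theta> = \<iota> d" and d_unit: "d dvd 1" and d_nonsq: "\<nexists>x. x * x = d"
  and sig: "\<sigma> (\<iota> x + \<theta> * \<iota> y) = \<iota> x - \<theta> * \<iota> y"
  using qe unfolding quad_ext_def by auto

lemma i_zero: "\<iota> 0 = 0" using i_add[of 0 0] by simp

lemma rep_ex: "\<exists>x y. z = \<iota> x + \<theta> * \<iota> y"
  using qe unfolding quad_ext_def by (metis)

lemma rep_unique: "\<iota> x + \<theta> * \<iota> y = \<iota> x' + \<theta> * \<iota> y' \<Longrightarrow> x = x' \<and> y = y'"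
proof -
  assume eq: "\<iota> x + \<theta> * \<iota> y = \<iota> x' + \<theta> * \<iota> y'"
  have u: "\<forall>z. \<exists>!p. z = \<iota> (fst p) + \<theta> * \<iota> (snd p)" using qe unfolding quad_ext_def by (elim conjE)
  obtain p0 where p0: "\<And>p. \<iota> x + \<theta> * \<iota> y = \<iota> (fst p) + \<theta> * \<iota> (snd p) \<Longrightarrow> p = p0"
    by (rule ex1E[OF spec[OF u, of "\<iota> x + \<theta> * \<iota> y"]]) blast
  have "(x, y) = p0" by (rule p0) simp
  moreover have "(x', y') = p0" by (rule p0) (simp add: eq)
  ultimately show ?thesis by auto
qed

lemma i_neg: "\<iota> (- x) = - \<iota> x"
  using i_add[of x "- x"] by (simp add: i_zero eq_neg_iff_add_eq_0 add.commute)

lemma sig_i [simp]: "\<sigma> (\<iota> x) = \<iota> x" using sig[of x 0] by (simp add: i_zero)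

lemma sig_add: "\<sigma> (z + w) = \<sigma> z + \<sigma> w"
proof -
  obtain x y x' y' where zw: "z = \<iota> x + \<theta> * \<iota> y" "w = \<iota> x' + \<theta> * \<iota> y'" using rep_ex by metis
  have "z + w = \<iota> (x + x') + \<theta> * \<iota> (y + y')" by (simp add: zw i_add algebra_simps)
  thus ?thesis by (simp add: zw sig) (simp add: i_add algebra_simps)
qed

lemma sig_mult: "\<sigma> (z * w) = \<sigma> z * \<sigma> w"
proof -
  obtain x y x' y' where zw: "z = \<iota> x + \<theta> * \<iota> y" "w = \<iota> x' + \<theta> * \<iota> y'" using rep_ex by metis
  have "z * w = \<iota> x * \<iota> x' + (\<theta> * \<theta>) * (\<iota> y * \<iota> y') + \<theta> * (\<iota> x * \<iota> y' + \<iota> y * \<iota> x')"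
    by (simp add: zw algebra_simps)
  also have "\<dots> = \<iota> (x * x' + d * (y * y')) + \<theta> * \<iota> (x * y' + y * x')" by (simp add: th_sq i_add i_mult)
  finally have "\<sigma> (z * w) = \<iota> (x * x' + d * (y * y')) - \<theta> * \<iota> (x * y' + y * x')" by (simp only: sig)
  also have "\<dots> = \<iota> x * \<iota> x' + (\<theta> * \<theta>) * (\<iota> y * \<iota> y') - \<theta> * (\<iota> x * \<iota> y' + \<iota> y * \<iota> x')"
    by (simp add: th_sq i_add i_mult)
  also have "\<dots> = \<sigma> z * \<sigma> w" by (simp add: zw sig algebra_simps)
  finally show ?thesis .
qed

lemma sig_one [simp]: "\<sigma> 1 = 1" using sig_i[of 1] by (simp add: i_one)
lemma sig_zero [simp]: "\<sigma> 0 = 0" using sig_i[of 0] by (simp add: i_zero)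
lemma sig_th: "\<sigma> \<theta> = - \<theta>" using sig[of 0 1] by (simp add: i_zero i_one)

lemma sig_sig [simp]: "\<sigma> (\<sigma> z) = z"
proof -
  obtain x y where z: "z = \<iota> x + \<theta> * \<iota> y" using rep_ex by metis
  have "\<sigma> z = \<iota> x + \<theta> * \<iota> (- y)" by (simp add: z sig i_neg)
  thus ?thesis by (simp only: sig) (simp add: z i_neg)
qed

lemma sig_fixed: "\<sigma> z = z \<Longrightarrow> \<exists>x. z = \<iota> x"
proof -
  assume f: "\<sigma> z = z"
  obtain x y where z: "z = \<iota> x + \<theta> * \<iota> y" using rep_ex by metis
  have "\<iota> x + \<theta> * \<iota> y = \<iota> x + \<theta> * \<iota> (- y)" using f by (simp add: z sig i_neg)
  hence "y = - y" using rep_unique by blast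
  hence "2 * y = 2 * 0" by (simp add: eq_neg_iff_add_eq_0)
  hence "y = 0" using unit_cancel[OF two] by blast
  thus ?thesis using z by (auto simp: i_zero)
qed

lemma star_mult:
  assumes "A \<in> carrier_mat 2 2" "B \<in> carrier_mat 2 2"
  shows "star_mat \<sigma> (A * B) = star_mat \<sigma> B * star_mat \<sigma> A"
proof -
  obtain a b c d where A: "A = mat2 a b c d" using mat2_cases[OF assms(1)] .
  obtain a' b' c' d' where B: "B = mat2 a' b' c' d'" using mat2_cases[OF assms(2)] .
  show ?thesis unfolding A B by (simp add: star_mat2 sig_add sig_mult algebra_simps)
qed

lemma star_star: "A \<in> carrier_mat 2 2 \<Longrightarrow> star_mat \<sigma> (star_mat \<sigma> A) = A"
  by (metis mat2_cases star_mat2 sig_sig)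

lemma star_carrier: "A \<in> carrier_mat 2 2 \<Longrightarrow> star_mat \<sigma> A \<in> carrier_mat 2 2"
  by (metis mat2_cases star_mat2 mat2_carrier)

lemma GU2_inverse:
  assumes "A \<in> GU2 \<sigma>"
  shows "A \<in> carrier_mat 2 2" "star_mat \<sigma> A \<in> GU2 \<sigma>" "A * star_mat \<sigma> A = 1\<^sub>m 2" "star_mat \<sigma> A * A = 1\<^sub>m 2"
proof -
  show A: "A \<in> carrier_mat 2 2" and s: "star_mat \<sigma> A * A = 1\<^sub>m 2" using assms by (auto simp: GU2_def)
  obtain B where B: "B \<in> carrier_mat 2 2" "A * B = 1\<^sub>m 2" "B * A = 1\<^sub>m 2"
    using assms A invertible_mat2_iff by (auto simp: GU2_def)
  have S: "star_mat \<sigma> A \<in> carrier_mat 2 2" using star_carrier[OF A] .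
  have "star_mat \<sigma> A = star_mat \<sigma> A * (A * B)" using B S by simp
  also have "\<dots> = B" using mat2_assoc[OF S A B(1)] s B(1) by simp
  finally show a: "A * star_mat \<sigma> A = 1\<^sub>m 2" using B by simp
  thus "star_mat \<sigma> A \<in> GU2 \<sigma>" using A S s unfolding GU2_def
    by (auto simp: star_star invertible_mat2_iff)
qed

lemma GU2_group:
  assumes "finite (UNIV :: 'k set)"
  shows "mat_group (GU2 \<sigma>)"
proof
  show "finite (GU2 \<sigma>)" using finite_carrier_mat2[OF assms] by (simp add: GU2_def)
  show "GU2 \<sigma> \<subseteq> carrier_mat 2 2" by (auto simp: GU2_def)
  show "1\<^sub>m 2 \<in> GU2 \<sigma>" unfolding GU2_def mat2_one using invertible_mat2[of 1 1 0 0 1] by (simp add: star_mat2)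
  show "A * B \<in> GU2 \<sigma>" if "A \<in> GU2 \<sigma>" "B \<in> GU2 \<sigma>" for A B
  proof -
    note A = GU2_inverse[OF that(1)] and B = GU2_inverse[OF that(2)]
    note SA = star_carrier[OF A(1)] and SB = star_carrier[OF B(1)]
    have "star_mat \<sigma> (A * B) * (A * B) = star_mat \<sigma> B * (star_mat \<sigma> A * A) * B"
      using A(1) B(1) SA SB by (simp add: star_mult mat2_assoc)
    also have "\<dots> = 1\<^sub>m 2" using A B SB by simp
    finally show ?thesis using that A(1) B(1) invertible_mult2[OF A(1) _ B(1)] by (auto simp: GU2_def)
  qed
  show "\<exists>B\<in>GU2 \<sigma>. A * B = 1\<^sub>m 2 \<and> B * A = 1\<^sub>m 2" if "A \<in> GU2 \<sigma>" for A
    using GU2_inverse[OF that] by blast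
qed

text \<open>The hypotheses are the four entries of the unitarity equation. Multiplicativity of the
  determinant, written out, then makes the determinant a unit.\<close>

lemma GU2I:
  assumes "\<sigma> d' * a + \<sigma> b * c = 1" "\<sigma> d' * b + \<sigma> b * d' = 0" "\<sigma> c * a + \<sigma> a * c = 0" "\<sigma> c * b + \<sigma> a * d' = 1"
  shows "mat2 a b c d' \<in> GU2 \<sigma>"
proof -
  have "(a * d' - b * c) * (\<sigma> d' * \<sigma> a - \<sigma> b * \<sigma> c) =
      (\<sigma> d' * a + \<sigma> b * c) * (\<sigma> c * b + \<sigma> a * d') - (\<sigma> d' * b + \<sigma> b * d') * (\<sigma> c * a + \<sigma> a * c)"
    by (simp add: algebra_simps)
  hence "(a * d' - b * c) * (\<sigma> d' * \<sigma> a - \<sigma> b * \<sigma> c) = 1" unfolding assms by simp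
  thus ?thesis using assms invertible_mat2 unfolding GU2_def by (auto simp: star_mat2 mat2_one)
qed

text \<open>The inverse of a unitary matrix is its \<open>star_mat\<close>. Comparing entries,
  \<open>\<sigma>\<close> multiplies a and e by the inverse determinant f, and b and c by -f. As
  \<open>\<sigma>\<close> negates \<open>\<theta>\<close>, the elements a, e,
  \<open>\<theta> * b\<close> and \<open>\<theta> * c\<close> all transform alike, so the product of
  each of them with \<open>\<sigma> e\<close> is fixed by \<open>\<sigma>\<close> and comes from the
  small ring.\<close>

lemma GU2_lines:
  assumes g: "mat2 a b c e \<in> GU2 \<sigma>" and fin: "finite (UNIV :: 'k set)"
  shows "\<exists>m1 m2 m3 m4. e * e = (a * e - b * c) * \<iota> m1 \<and> a * e = (a * e - b * c) * \<iota> m2 \<and>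
     \<theta> * b * e = (a * e - b * c) * \<iota> m3 \<and> \<theta> * c * e = (a * e - b * c) * \<iota> m4"
proof -
  define D where "D = a * e - b * c"
  interpret G: mat_group "GU2 \<sigma>" by (rule GU2_group[OF fin])
  obtain f where f: "(a * e - b * c) * f = 1" using G.det_unit[OF g] by blast
  have "minv (mat2 a b c e) = star_mat \<sigma> (mat2 a b c e)"
    using GU2_inverse[OF g] star_carrier by (intro minv_unique) auto
  hence s: "\<sigma> e = f * e" "\<sigma> b = - (f * b)" "\<sigma> c = - (f * c)" "\<sigma> a = f * a"
    unfolding minv_mat2[OF f] star_mat2 by simp_all
  have Df: "D * f = 1" using f by (simp add: D_def)
  have main: "\<exists>m. z * e = D * \<iota> m" if "\<sigma> z = f * z" for z
  proof -
    have "\<sigma> (z * \<sigma> e) = f * z * e" by (simp add: sig_mult that)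
    also have "\<dots> = z * \<sigma> e" by (simp add: s mult_ac)
    finally obtain m where m: "z * \<sigma> e = \<iota> m" using sig_fixed by blast
    have "D * (z * \<sigma> e) = (D * f) * (z * e)" by (simp add: s mult_ac)
    thus ?thesis using m Df by (intro exI[of _ m]) simp
  qed
  have "\<sigma> (\<theta> * b) = f * (\<theta> * b)" "\<sigma> (\<theta> * c) = f * (\<theta> * c)" by (simp_all add: sig_mult sig_th s mult_ac)
  thus ?thesis using main[of e] main[of a] main[of "\<theta> * b"] main[of "\<theta> * c"] s unfolding D_def[symmetric] by blast
qed

end

section \<open>The two groups satisfy the common assumptions\<close>

lemma (in chain_ring) GL2_setup:
  fixes \<psi> :: "'r \<Rightarrow> complex"
  assumes "add_char \<psi>" "\<exists>x. \<psi> (\<pi> ^ (l - 1) * x) \<noteq> 1"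
  shows "rank2_setup \<pi> l GL2 (\<lambda>x. x) 1 1 \<psi>"
proof -
  interpret G: mat_group "GL2 :: 'r mat set" by (rule GL2_group[OF finite_ring])
  have GL: "mat2 a b c d \<in> GL2" if "(a * d - b * c) * e = 1" for a b c d e :: 'r
    using invertible_mat2[OF that] by (simp add: GL2_def)
  show ?thesis
  proof unfold_locales
    fix r :: 'r assume "r dvd 1"
    then obtain e where "r * e = 1" by (auto simp: dvd_one_iff)
    thus "\<exists>t. t dvd 1 \<and> mat2 t 0 0 (t * r) \<in> GL2" using GL[of 1 r 0 0 e] by (intro exI[of _ 1]) simp
  next
    show "mat2 1 (1 * s) 0 1 \<in> GL2" for s :: 'r using GL[of 1 1 s 0 1] by simp
  next
    show "mat2 u 0 0 u' \<in> GL2" if "u * u' = 1" for u u' :: 'r using GL[of u u' 0 0 1] that by simp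
  next
    fix a b c d :: 'r assume "mat2 a b c d \<in> GL2"
    then obtain e where e: "(a * d - b * c) * e = 1" using G.det_unit by blast
    have "x = (a * d - b * c) * (e * x)" for x using e by (simp add: mult.assoc[symmetric])
    thus "\<exists>m1 m2 m3 m4. d * d = (a * d - b * c) * m1 \<and> a * d = (a * d - b * c) * m2 \<and>
        1 * b * d = (a * d - b * c) * m3 \<and> 1 * c * d = (a * d - b * c) * m4" by metis
  qed (use assms in auto)
qed

lemma (in chain_ring) GU2_setup:
  fixes \<iota> :: "'r \<Rightarrow> 'k::comm_ring_1" and \<psi> :: "'k \<Rightarrow> complex"
  assumes qe: "quad_ext d \<iota> \<theta> \<sigma>" and ch: "add_char \<psi>'" and nt: "\<exists>x. \<psi>' (\<pi> ^ (l - 1) * x) \<noteq> 1"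
    and psi: "\<And>x y. \<psi> (\<iota> x + \<theta> * \<iota> y) = \<psi>' x * \<psi>' y"
  shows "rank2_setup \<pi> l (GU2 \<sigma>) \<iota> \<theta> d \<psi>"
proof -
  interpret Q: quad_setup d \<iota> \<theta> \<sigma> by unfold_locales (use qe two_unit in auto)
  have "(UNIV :: 'k set) \<subseteq> (\<lambda>(x, y). \<iota> x + \<theta> * \<iota> y) ` (UNIV :: ('r \<times> 'r) set)"
    using Q.rep_ex by (auto simp: image_iff)
  moreover have "finite (UNIV :: ('r \<times> 'r) set)" using finite_ring[of UNIV] by (simp add: finite_Prod_UNIV)
  ultimately have fin: "finite (UNIV :: 'k set)" by (meson finite_imageI finite_subset)
  interpret G: mat_group "GU2 \<sigma>" by (rule Q.GU2_group[OF fin])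
  have psi_i: "\<psi> (\<iota> x) = \<psi>' x" for x
    using psi[of x 0] ch by (simp add: Q.i_zero add_char_def)
  have "add_char \<psi>"
    unfolding add_char_def
  proof (intro conjI allI)
    show "\<psi> 0 = 1" using psi_i[of 0] ch by (simp add: Q.i_zero add_char_def)
    fix z w
    obtain x y x' y' where zw: "z = \<iota> x + \<theta> * \<iota> y" "w = \<iota> x' + \<theta> * \<iota> y'" using Q.rep_ex by metis
    have "z + w = \<iota> (x + x') + \<theta> * \<iota> (y + y')" by (simp add: zw Q.i_add algebra_simps)
    thus "\<psi> (z + w) = \<psi> z * \<psi> w" using ch by (simp add: zw psi add_char_def mult_ac)
  qed
  show ?thesis
  proof unfold_locales
    fix r :: 'r assume "r dvd 1"
    then obtain s where s: "r * s = 1" by (auto simp: dvd_one_iff)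
    hence "s dvd 1" by (metis dvd_triv_right)
    \<comment> \<open>The diagonal matrix with entries t and \<open>t * \<iota> r\<close> is unitary
      exactly when the norm of t is the inverse s of r. Surjectivity of the norm on units provides
      such a t.\<close>
    then obtain x y where xy: "x * x - d * (y * y) = s"
      using unit_norm[OF Q.d_unit Q.d_nonsq] by blast
    define t where "t = \<iota> x + \<theta> * \<iota> y"
    have "t * \<sigma> t = \<iota> x * \<iota> x - (\<theta> * \<theta>) * (\<iota> y * \<iota> y)" by (simp add: t_def Q.sig algebra_simps)
    also have "\<dots> = \<iota> (x * x + - (d * (y * y)))" by (simp only: Q.th_sq Q.i_mult Q.i_add Q.i_neg) simp
    finally have "t * \<sigma> t = \<iota> s" using xy by simp
    hence "t * (\<sigma> t * \<iota> r) = \<iota> (s * r)" by (simp add: Q.i_mult mult.assoc[symmetric])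
    hence t1: "t * (\<sigma> t * \<iota> r) = 1" using s by (simp add: mult.commute Q.i_one)
    hence "mat2 t 0 0 (t * \<iota> r) \<in> GU2 \<sigma>" by (intro Q.GU2I) (simp_all add: Q.sig_mult mult_ac)
    thus "\<exists>t. t dvd 1 \<and> mat2 t 0 0 (t * \<iota> r) \<in> GU2 \<sigma>" using t1 by (auto simp: dvd_one_iff)
  next
    show "mat2 1 (\<theta> * \<iota> s) 0 1 \<in> GU2 \<sigma>" for s
      by (intro Q.GU2I) (simp_all add: Q.sig_mult Q.sig_th)
  next
    fix u u' :: 'r assume "u * u' = 1"
    hence "\<iota> u * \<iota> u' = 1" by (simp add: Q.i_mult[symmetric] Q.i_one)
    thus "mat2 (\<iota> u) 0 0 (\<iota> u') \<in> GU2 \<sigma>" by (intro Q.GU2I) (simp_all add: mult.commute)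
  next
    show "\<exists>x. \<psi> (\<iota> (\<pi> ^ (l - 1) * x)) \<noteq> 1" using nt by (simp add: psi_i)
  next
    fix a b c e assume "mat2 a b c e \<in> GU2 \<sigma>"
    thus "\<exists>m1 m2 m3 m4. e * e = (a * e - b * c) * \<iota> m1 \<and> a * e = (a * e - b * c) * \<iota> m2 \<and>
       \<theta> * b * e = (a * e - b * c) * \<iota> m3 \<and> \<theta> * c * e = (a * e - b * c) * \<iota> m4"
      by (rule Q.GU2_lines[OF _ fin])
  qed (use Q.i_add Q.i_mult Q.i_one Q.th_sq Q.d_unit \<open>add_char \<psi>\<close> in auto)
qed

theorem theorem9p2:
  fixes \<pi> :: "'r::comm_ring_1" and l :: nat
  assumes "chain_ring_of_length \<pi> l"
    and "odd (residue_card \<pi>)"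
    and "l \<ge> 2"
  shows "(\<forall>\<psi> :: 'r \<Rightarrow> complex.
            add_char \<psi> \<and> (\<exists>x. \<psi> (\<pi> ^ (l - 1) * x) \<noteq> 1) \<longrightarrow>
            tensor_bound_claim GL2 \<pi> l 1 \<psi> (residue_card \<pi>))
       \<and> (\<forall>(d::'r) (\<iota>::'r \<Rightarrow> 'k::comm_ring_1) \<theta> \<sigma> (\<psi>'::'r \<Rightarrow> complex) (\<psi>::'k \<Rightarrow> complex).
            quad_ext d \<iota> \<theta> \<sigma> \<and>
            add_char \<psi>' \<and> (\<exists>x. \<psi>' (\<pi> ^ (l - 1) * x) \<noteq> 1) \<and>
            (\<forall>x y. \<psi> (\<iota> x + \<theta> * \<iota> y) = \<psi>' x * \<psi>' y) \<longrightarrow>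
            tensor_bound_claim (GU2 \<sigma>) (\<iota> \<pi>) l \<theta> \<psi> (residue_card \<pi>))"
proof -
  interpret chain_ring \<pi> l using assms by unfold_locales
  show ?thesis
  proof (intro conjI allI impI, goal_cases)
    case (1 \<psi>)
    thus ?case using rank2_setup.tensor_bound[OF GL2_setup] by blast
  next
    case (2 d \<iota> \<theta> \<sigma> \<psi>' \<psi>)
    thus ?case using rank2_setup.tensor_bound[OF GU2_setup[of d \<iota> \<theta> \<sigma> \<psi>' \<psi>]] by blast
  qed
qed

end
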